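(* Let $R$ be a ring and let $A_\bullet^*$ be a simplicial differential graded $R$-algebra that satisfies: (a) for each $p\ge0$ the natural morphism $R\to A_p^*$ is a homotopy equivalence of cochain complexes; (b) for each $q\ge0$ the simplicial set $A_\bullet^q$ is simplicially contractible, i.e. its homotopy groups are zero; (c) $R$ is a principal ideal domain and for all $p,q$ the $R$-module $A_p^q$ is free. For any simplicial set $X$, the algebras $S^*(X;R)$ and $A^*(X)$ are weakly equivalent in the category of $R$-differential graded algebras, i.e. they are connected by a finite zigzag of quasi-isomorphisms of differential graded $R$-algebras.
   Context: A simplicial differential graded $R$-algebra $A_\bullet^*$ is a simplicial object in differential graded $R$-algebras (cochain algebras, graded in degrees $q\ge0$); $p$ is the simplicial degree and $q$ the differential degree. $A^*(X)=\mathrm{Hom}_\Delta(X_\bullet,A_\bullet^* )$ is the cochain complex which in degree $q$ is the $R$-module of simplicial maps $X_\bullet\to A_\bullet^q$. Its algebra structure is the composite $A^*(X)\otimes A^*(X)\to A^*(X\times X)\to A^*(X)$ of the Künneth morphism $\alpha\otimes\beta\mapsto\mathrm{pr}_1^*(\alpha)\cdot\mathrm{pr}_2^*(\beta)$ with restriction along the diagonal, i.e. the pointwise product. $S^*(X;R)$ is the cochain algebra of the simplicial set $X$ with coefficients in $R$ ($S^q(X;R)$ is the module of functions $X_q\to R$, with the Alexander–Whitney cup product). *)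

theory Defs
  imports "HOL-Algebra.Module" "HOL-Algebra.Ring_Divisibility" "HOL-Algebra.Coset" "HOL-Library.FuncSet"
begin

section \<open>Modules\<close>

definition linear_maps ::
  "('r, 'm) ring_scheme \<Rightarrow> ('r, 'a, 'n) module_scheme \<Rightarrow> ('r, 'b, 'k) module_scheme \<Rightarrow> ('a \<Rightarrow> 'b) set"
  where "linear_maps R M N =
    {f. f \<in> carrier M \<rightarrow> carrier N \<and>
        (\<forall>x\<in>carrier M. \<forall>y\<in>carrier M. f (x \<oplus>\<^bsub>M\<^esub> y) = f x \<oplus>\<^bsub>N\<^esub> f y) \<and>
        (\<forall>r\<in>carrier R. \<forall>x\<in>carrier M. f (r \<odot>\<^bsub>M\<^esub> x) = r \<odot>\<^bsub>N\<^esub> f x)}"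

definition module_basis ::
  "('r, 'm) ring_scheme \<Rightarrow> ('r, 'a, 'n) module_scheme \<Rightarrow> 'a set \<Rightarrow> bool"
  where "module_basis R M B \<longleftrightarrow>
    B \<subseteq> carrier M \<and>
    (\<forall>x\<in>carrier M. \<exists>!c. c \<in> B \<rightarrow>\<^sub>E carrier R \<and> finite {b \<in> B. c b \<noteq> \<zero>\<^bsub>R\<^esub>} \<and>
        x = (\<Oplus>\<^bsub>M\<^esub>b\<in>{b \<in> B. c b \<noteq> \<zero>\<^bsub>R\<^esub>}. c b \<odot>\<^bsub>M\<^esub> b))"

definition free_module :: "('r, 'm) ring_scheme \<Rightarrow> ('r, 'a, 'n) module_scheme \<Rightarrow> bool"
  where "free_module R M \<longleftrightarrow> module R M \<and> (\<exists>B. module_basis R M B)"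

definition signed :: "('a, 'm) ring_scheme \<Rightarrow> nat \<Rightarrow> 'a \<Rightarrow> 'a"
  where "signed M n x = (if even n then x else \<ominus>\<^bsub>M\<^esub> x)"


section \<open>Cochain complexes\<close>

text \<open>The fields \<open>mult\<close> and \<open>one\<close> that the library's \<open>module\<close> record inherits from \<open>ring\<close>
  play no role for the graded pieces; the product of a differential graded algebra is the
  separate field \<open>gmult\<close> below.\<close>

record ('r, 'a) cochain_complex =
  gr :: "nat \<Rightarrow> ('r, 'a) module"
  diff :: "nat \<Rightarrow> 'a \<Rightarrow> 'a"

locale cochain_complex = cring R for R :: "('r, 'm) ring_scheme" (structure) +
  fixes C :: "('r, 'a, 'n) cochain_complex_scheme"
  assumes gr_module: "module R (gr C q)"
    and diff_linear: "diff C q \<in> linear_maps R (gr C q) (gr C (Suc q))"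
    and diff_diff: "x \<in> carrier (gr C q) \<Longrightarrow> diff C (Suc q) (diff C q x) = \<zero>\<^bsub>gr C (Suc (Suc q))\<^esub>"

definition cochain_map ::
  "('r, 'm) ring_scheme \<Rightarrow> ('r, 'a, 'n) cochain_complex_scheme \<Rightarrow> ('r, 'b, 'k) cochain_complex_scheme
    \<Rightarrow> (nat \<Rightarrow> 'a \<Rightarrow> 'b) \<Rightarrow> bool"
  where "cochain_map R C D f \<longleftrightarrow>
    (\<forall>q. f q \<in> linear_maps R (gr C q) (gr D q)) \<and>
    (\<forall>q. \<forall>x\<in>carrier (gr C q). f (Suc q) (diff C q x) = diff D q (f q x))"

definition cochain_homotopic ::
  "('r, 'm) ring_scheme \<Rightarrow> ('r, 'a, 'n) cochain_complex_scheme \<Rightarrow> ('r, 'b, 'k) cochain_complex_scheme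
    \<Rightarrow> (nat \<Rightarrow> 'a \<Rightarrow> 'b) \<Rightarrow> (nat \<Rightarrow> 'a \<Rightarrow> 'b) \<Rightarrow> bool"
  where "cochain_homotopic R C D f g \<longleftrightarrow>
    (\<exists>h. (\<forall>q. h q \<in> linear_maps R (gr C (Suc q)) (gr D q)) \<and>
         (\<forall>x\<in>carrier (gr C 0). f 0 x \<ominus>\<^bsub>gr D 0\<^esub> g 0 x = h 0 (diff C 0 x)) \<and>
         (\<forall>q. \<forall>x\<in>carrier (gr C (Suc q)).
            f (Suc q) x \<ominus>\<^bsub>gr D (Suc q)\<^esub> g (Suc q) x =
            diff D q (h q x) \<oplus>\<^bsub>gr D (Suc q)\<^esub> h (Suc q) (diff C (Suc q) x)))"

definition cochain_homotopy_equivalence ::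
  "('r, 'm) ring_scheme \<Rightarrow> ('r, 'a, 'n) cochain_complex_scheme \<Rightarrow> ('r, 'b, 'k) cochain_complex_scheme
    \<Rightarrow> (nat \<Rightarrow> 'a \<Rightarrow> 'b) \<Rightarrow> bool"
  where "cochain_homotopy_equivalence R C D f \<longleftrightarrow>
    cochain_map R C D f \<and>
    (\<exists>g. cochain_map R D C g \<and>
         cochain_homotopic R C C (\<lambda>q x. g q (f q x)) (\<lambda>q x. x) \<and>
         cochain_homotopic R D D (\<lambda>q x. f q (g q x)) (\<lambda>q x. x))"

definition cocycle_group :: "('r, 'a, 'n) cochain_complex_scheme \<Rightarrow> nat \<Rightarrow> 'a monoid"
  where "cocycle_group C q =
    \<lparr>carrier = {x \<in> carrier (gr C q). diff C q x = \<zero>\<^bsub>gr C (Suc q)\<^esub>},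
     mult = add (gr C q), one = \<zero>\<^bsub>gr C q\<^esub>\<rparr>"

primrec coboundaries :: "('r, 'a, 'n) cochain_complex_scheme \<Rightarrow> nat \<Rightarrow> 'a set"
  where
    "coboundaries C 0 = {\<zero>\<^bsub>gr C 0\<^esub>}"
  | "coboundaries C (Suc q) = diff C q ` carrier (gr C q)"

definition cohomology :: "('r, 'a, 'n) cochain_complex_scheme \<Rightarrow> nat \<Rightarrow> 'a set monoid"
  where "cohomology C q = cocycle_group C q Mod coboundaries C q"

text \<open>The union below is over cosets that all coincide when \<open>K\<close> is a cohomology class.\<close>

definition cohomology_map ::
  "('r, 'b, 'k) cochain_complex_scheme \<Rightarrow> (nat \<Rightarrow> 'a \<Rightarrow> 'b) \<Rightarrow> nat \<Rightarrow> 'a set \<Rightarrow> 'b set"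
  where "cohomology_map D f q K = (\<Union>z\<in>K. coboundaries D q #>\<^bsub>cocycle_group D q\<^esub> f q z)"

definition quasi_iso ::
  "('r, 'm) ring_scheme \<Rightarrow> ('r, 'a, 'n) cochain_complex_scheme \<Rightarrow> ('r, 'b, 'k) cochain_complex_scheme
    \<Rightarrow> (nat \<Rightarrow> 'a \<Rightarrow> 'b) \<Rightarrow> bool"
  where "quasi_iso R C D f \<longleftrightarrow>
    cochain_map R C D f \<and> (\<forall>q. cohomology_map D f q \<in> iso (cohomology C q) (cohomology D q))"

text \<open>The ring \<open>R\<close> as a complex concentrated in degree \<open>0\<close>.\<close>

definition ring_complex :: "('r, 'm) ring_scheme \<Rightarrow> ('r, 'r) cochain_complex"
  where "ring_complex R =
    \<lparr>gr = (\<lambda>q. \<lparr>carrier = (if q = 0 then carrier R else {\<zero>\<^bsub>R\<^esub>}), mult = mult R, one = \<one>\<^bsub>R\<^esub>,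
                zero = \<zero>\<^bsub>R\<^esub>, add = add R, smult = mult R\<rparr>),
     diff = (\<lambda>q x. \<zero>\<^bsub>R\<^esub>)\<rparr>"


section \<open>Differential graded algebras\<close>

record ('r, 'a) dga = "('r, 'a) cochain_complex" +
  gmult :: "nat \<Rightarrow> nat \<Rightarrow> 'a \<Rightarrow> 'a \<Rightarrow> 'a"
  gone :: 'a

locale dg_algebra = cochain_complex R A for R :: "('r, 'm) ring_scheme" (structure) and A :: "('r, 'a, 'n) dga_scheme" +
  assumes gmult_linear_right:
      "x \<in> carrier (gr A p) \<Longrightarrow> gmult A p q x \<in> linear_maps R (gr A q) (gr A (p + q))"
    and gmult_linear_left:
      "y \<in> carrier (gr A q) \<Longrightarrow> (\<lambda>x. gmult A p q x y) \<in> linear_maps R (gr A p) (gr A (p + q))"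
    and gmult_assoc:
      "\<lbrakk>x \<in> carrier (gr A p); y \<in> carrier (gr A q); z \<in> carrier (gr A r)\<rbrakk> \<Longrightarrow>
        gmult A (p + q) r (gmult A p q x y) z = gmult A p (q + r) x (gmult A q r y z)"
    and gone_closed: "gone A \<in> carrier (gr A 0)"
    and gmult_one_left: "x \<in> carrier (gr A q) \<Longrightarrow> gmult A 0 q (gone A) x = x"
    and gmult_one_right: "x \<in> carrier (gr A q) \<Longrightarrow> gmult A q 0 x (gone A) = x"
    and leibniz:
      "\<lbrakk>x \<in> carrier (gr A p); y \<in> carrier (gr A q)\<rbrakk> \<Longrightarrow>
        diff A (p + q) (gmult A p q x y) =
        gmult A (Suc p) q (diff A p x) y
          \<oplus>\<^bsub>gr A (Suc (p + q))\<^esub> signed (gr A (Suc (p + q))) p (gmult A p (Suc q) x (diff A q y))"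

definition dga_hom ::
  "('r, 'm) ring_scheme \<Rightarrow> ('r, 'a, 'n) dga_scheme \<Rightarrow> ('r, 'b, 'k) dga_scheme
    \<Rightarrow> (nat \<Rightarrow> 'a \<Rightarrow> 'b) \<Rightarrow> bool"
  where "dga_hom R A B f \<longleftrightarrow>
    dg_algebra R A \<and> dg_algebra R B \<and> cochain_map R A B f \<and>
    f 0 (gone A) = gone B \<and>
    (\<forall>p q. \<forall>x\<in>carrier (gr A p). \<forall>y\<in>carrier (gr A q).
       f (p + q) (gmult A p q x y) = gmult B p q (f p x) (f q y))"

definition unit_map :: "('r, 'a, 'n) dga_scheme \<Rightarrow> nat \<Rightarrow> 'r \<Rightarrow> 'a"
  where "unit_map A q r = (if q = 0 then r \<odot>\<^bsub>gr A 0\<^esub> gone A else \<zero>\<^bsub>gr A q\<^esub>)"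

definition dga_linked ::
  "('r, 'm) ring_scheme \<Rightarrow> ('r, 'a, 'n) dga_scheme \<Rightarrow> ('r, 'b, 'k) dga_scheme \<Rightarrow> bool"
  where "dga_linked R A B \<longleftrightarrow>
    (\<exists>f. dga_hom R A B f \<and> quasi_iso R A B f) \<or> (\<exists>f. dga_hom R B A f \<and> quasi_iso R B A f)"

text \<open>A finite zigzag of quasi-isomorphisms of differential graded algebras from \<open>A\<close> to \<open>B\<close>.
  HOL has no quantification over types, so the type \<open>'u\<close> that carries the elements of the
  intermediate algebras is a parameter; a zigzag over any particular \<open>'u\<close> is a zigzag in
  the category of differential graded \<open>R\<close>-algebras.\<close>

definition weakly_equivalent ::
  "'u itself \<Rightarrow> ('r, 'm) ring_scheme \<Rightarrow> ('r, 'a) dga \<Rightarrow> ('r, 'b) dga \<Rightarrow> bool"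
  where "weakly_equivalent _ R A B \<longleftrightarrow>
    (\<exists>E E' :: ('r, 'u) dga. dga_linked R A E \<and> (dga_linked R)\<^sup>*\<^sup>* E E' \<and> dga_linked R E' B)"


section \<open>Simplicial sets\<close>

text \<open>Simplicial objects are contravariant functors on the category of the ordinals
  \<open>[n] = {0, \<dots>, n}\<close> and monotone maps; \<open>ord_maps m n\<close> is the set of morphisms \<open>[m] \<rightarrow> [n]\<close>, and
  \<open>act X m n \<theta>\<close> is the map \<open>X\<^sub>n \<rightarrow> X\<^sub>m\<close> induced by \<open>\<theta> : [m] \<rightarrow> [n]\<close>.
  The sets of simplices of different dimensions need not be disjoint.\<close>

definition ord_maps :: "nat \<Rightarrow> nat \<Rightarrow> (nat \<Rightarrow> nat) set"
  where "ord_maps m n = {\<theta> \<in> {..m} \<rightarrow>\<^sub>E {..n}. mono_on {..m} \<theta>}"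

record 'x sset =
  simplices :: "nat \<Rightarrow> 'x set"
  act :: "nat \<Rightarrow> nat \<Rightarrow> (nat \<Rightarrow> nat) \<Rightarrow> 'x \<Rightarrow> 'x"

locale simplicial_set =
  fixes X :: "('x, 'n) sset_scheme"
  assumes act_closed:
      "\<lbrakk>\<theta> \<in> ord_maps m n; x \<in> simplices X n\<rbrakk> \<Longrightarrow> act X m n \<theta> x \<in> simplices X m"
    and act_id: "x \<in> simplices X n \<Longrightarrow> act X n n (\<lambda>i\<in>{..n}. i) x = x"
    and act_compose:
      "\<lbrakk>\<theta> \<in> ord_maps l m; \<phi> \<in> ord_maps m n; x \<in> simplices X n\<rbrakk> \<Longrightarrow>
        act X l n (compose {..l} \<phi> \<theta>) x = act X l m \<theta> (act X m n \<phi> x)"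

definition simplicial_maps :: "('x, 'n) sset_scheme \<Rightarrow> ('y, 'k) sset_scheme \<Rightarrow> (nat \<Rightarrow> 'x \<Rightarrow> 'y) set"
  where "simplicial_maps X Y =
    {f. (\<forall>n. f n \<in> simplices X n \<rightarrow>\<^sub>E simplices Y n) \<and>
        (\<forall>m n. \<forall>\<theta>\<in>ord_maps m n. \<forall>x\<in>simplices X n. f m (act X m n \<theta> x) = act Y m n \<theta> (f n x))}"

text \<open>\<open>face X n i\<close> is the face operator \<open>d\<^sub>i : X\<^sub>n\<^sub>+\<^sub>1 \<rightarrow> X\<^sub>n\<close>.\<close>

definition face :: "('x, 'n) sset_scheme \<Rightarrow> nat \<Rightarrow> nat \<Rightarrow> 'x \<Rightarrow> 'x"
  where "face X n i = act X n (Suc n) (\<lambda>j\<in>{..n}. if j < i then j else Suc j)"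

text \<open>\<open>base_simplex X v n\<close> is the fully degenerate \<open>n\<close>-simplex on the vertex \<open>v\<close>.\<close>

definition base_simplex :: "('x, 'n) sset_scheme \<Rightarrow> 'x \<Rightarrow> nat \<Rightarrow> 'x"
  where "base_simplex X v n = act X n 0 (\<lambda>j\<in>{..n}. 0) v"

text \<open>The combinatorial homotopy groups \<open>\<pi>\<^sub>n(X, v)\<close>, \<open>n \<ge> 0\<close>, of a Kan complex (as underlying sets):
  \<open>n\<close>-simplices all of whose faces are at the base point, modulo \<open>x \<sim> y\<close> if there is an
  \<open>(n+1)\<close>-simplex \<open>w\<close> with \<open>d\<^sub>n w = x\<close>, \<open>d\<^sub>n\<^sub>+\<^sub>1 w = y\<close> and all other faces at the base point.
  They are applied only to simplicial modules, which are Kan complexes.\<close>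

definition spheres :: "('x, 'n) sset_scheme \<Rightarrow> 'x \<Rightarrow> nat \<Rightarrow> 'x set"
  where "spheres X v n =
    {x \<in> simplices X n. \<forall>m. n = Suc m \<longrightarrow> (\<forall>i\<le>n. face X m i x = base_simplex X v m)}"

definition sphere_homotopy :: "('x, 'n) sset_scheme \<Rightarrow> 'x \<Rightarrow> nat \<Rightarrow> ('x \<times> 'x) set"
  where "sphere_homotopy X v n =
    {(x, y) \<in> spheres X v n \<times> spheres X v n. \<exists>w\<in>simplices X (Suc n).
       (\<forall>i<n. face X n i w = base_simplex X v n) \<and> face X n n w = x \<and> face X n (Suc n) w = y}"

definition homotopy_group :: "('x, 'n) sset_scheme \<Rightarrow> 'x \<Rightarrow> nat \<Rightarrow> 'x set set"
  where "homotopy_group X v n = spheres X v n // sphere_homotopy X v n"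

definition simplicially_contractible :: "('x, 'n) sset_scheme \<Rightarrow> bool"
  where "simplicially_contractible X \<longleftrightarrow>
    simplices X 0 \<noteq> {} \<and> (\<forall>v\<in>simplices X 0. \<forall>n. is_singleton (homotopy_group X v n))"


section \<open>Simplicial differential graded algebras\<close>

record ('r, 'a) sdga =
  level :: "nat \<Rightarrow> ('r, 'a) dga"
  dact :: "nat \<Rightarrow> nat \<Rightarrow> (nat \<Rightarrow> nat) \<Rightarrow> nat \<Rightarrow> 'a \<Rightarrow> 'a"

locale simplicial_dga = cring R for R :: "('r, 'm) ring_scheme" (structure) +
  fixes A :: "('r, 'a, 'n) sdga_scheme"
  assumes level_dga: "dg_algebra R (level A p)"
    and dact_hom: "\<theta> \<in> ord_maps m n \<Longrightarrow> dga_hom R (level A n) (level A m) (dact A m n \<theta>)"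
    and dact_id: "x \<in> carrier (gr (level A n) q) \<Longrightarrow> dact A n n (\<lambda>i\<in>{..n}. i) q x = x"
    and dact_compose:
      "\<lbrakk>\<theta> \<in> ord_maps l m; \<phi> \<in> ord_maps m n; x \<in> carrier (gr (level A n) q)\<rbrakk> \<Longrightarrow>
        dact A l n (compose {..l} \<phi> \<theta>) q x = dact A l m \<theta> q (dact A m n \<phi> q x)"

text \<open>The simplicial set \<open>A\<^sub>\<bullet>\<^sup>q\<close>.\<close>

definition degree_part :: "('r, 'a, 'n) sdga_scheme \<Rightarrow> nat \<Rightarrow> 'a sset"
  where "degree_part A q =
    \<lparr>simplices = (\<lambda>p. carrier (gr (level A p) q)), act = (\<lambda>m n \<theta>. dact A m n \<theta> q)\<rparr>"

text \<open>The algebra \<open>A\<^sup>*(X)\<close> of simplicial maps from \<open>X\<close> to \<open>A\<^sub>\<bullet>\<^sup>*\<close>, with pointwise structure.\<close>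

definition forms :: "('r, 'a, 'n) sdga_scheme \<Rightarrow> ('x, 'k) sset_scheme \<Rightarrow> ('r, nat \<Rightarrow> 'x \<Rightarrow> 'a) dga"
  where "forms A X =
    \<lparr>gr = (\<lambda>q.
       \<lparr>carrier = simplicial_maps X (degree_part A q),
        mult = undefined, one = undefined,
        zero = (\<lambda>n. \<lambda>x\<in>simplices X n. \<zero>\<^bsub>gr (level A n) q\<^esub>),
        add = (\<lambda>\<alpha> \<beta> n. \<lambda>x\<in>simplices X n. \<alpha> n x \<oplus>\<^bsub>gr (level A n) q\<^esub> \<beta> n x),
        smult = (\<lambda>r \<alpha> n. \<lambda>x\<in>simplices X n. r \<odot>\<^bsub>gr (level A n) q\<^esub> \<alpha> n x)\<rparr>),
     diff = (\<lambda>q \<alpha> n. \<lambda>x\<in>simplices X n. diff (level A n) q (\<alpha> n x)),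
     gmult = (\<lambda>p q \<alpha> \<beta> n. \<lambda>x\<in>simplices X n. gmult (level A n) p q (\<alpha> n x) (\<beta> n x)),
     gone = (\<lambda>n. \<lambda>x\<in>simplices X n. gone (level A n))\<rparr>"

text \<open>The algebra \<open>S\<^sup>*(X; R)\<close> of all (not only the normalized) simplicial cochains:
  \<open>(\<delta> c)(x) = \<Sum>\<^sub>i (-1)\<^sup>i c(d\<^sub>i x)\<close>, and the Alexander--Whitney product evaluates the first factor
  on the front \<open>p\<close>-face and the second factor on the back \<open>q\<close>-face.\<close>

definition cochains :: "('r, 'm) ring_scheme \<Rightarrow> ('x, 'k) sset_scheme \<Rightarrow> ('r, 'x \<Rightarrow> 'r) dga"
  where "cochains R X =
    \<lparr>gr = (\<lambda>q.
       \<lparr>carrier = simplices X q \<rightarrow>\<^sub>E carrier R,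
        mult = undefined, one = undefined,
        zero = (\<lambda>x\<in>simplices X q. \<zero>\<^bsub>R\<^esub>),
        add = (\<lambda>c c'. \<lambda>x\<in>simplices X q. c x \<oplus>\<^bsub>R\<^esub> c' x),
        smult = (\<lambda>r c. \<lambda>x\<in>simplices X q. r \<otimes>\<^bsub>R\<^esub> c x)\<rparr>),
     diff = (\<lambda>q c. \<lambda>x\<in>simplices X (Suc q). \<Oplus>\<^bsub>R\<^esub>i\<in>{..Suc q}. signed R i (c (face X q i x))),
     gmult = (\<lambda>p q c c'. \<lambda>x\<in>simplices X (p + q).
       c (act X p (p + q) (\<lambda>j\<in>{..p}. j) x) \<otimes>\<^bsub>R\<^esub> c' (act X q (p + q) (\<lambda>j\<in>{..q}. p + j) x)),
     gone = (\<lambda>x\<in>simplices X 0. \<one>\<^bsub>R\<^esub>)\<rparr>"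

end

theory Submission
  imports Defs
begin

text \<open>Let \<open>E\<close> be the algebra of simplicial maps from \<open>X\<close> to the total complex of the bigraded algebra
  \<open>Map(\<Delta>\<^bsub>n\<^esub>[a], A\<^bsub>n\<^esub>\<^sup>q)\<close>, the \<open>a\<close>-cochains of the standard simplex with coefficients in \<open>A\<close>. Cochains of \<open>X\<close> map
  into it through the unit of \<open>A\<close> (\<open>q = 0\<close>), forms on \<open>X\<close> as constant functions on vertices (\<open>a = 0\<close>).
  Both maps are quasi-isomorphisms, because the rows and the columns of the double complex of natural families are exact.
  They are exact on each simplex: the rows by coning off the vertex \<open>0\<close>, the columns by (a). Exactness passes to
  natural families because the simplicial groups of cocycles are contractible, so that natural lifts
  can be chosen simplex by simplex. Row cocycles are contracted by multiplication with a path
  in \<open>A\<^sup>0\<close> from \<open>1\<close> to \<open>0\<close>, which (b) provides; column cocycles by cutting off at the first vertex.\<close>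

section \<open>Monotone maps of finite ordinals\<close>

text \<open>The cup product uses front and back faces while forms multiply pointwise, so neither
  algebra maps to the other in an evident way; a larger algebra has to contain both. Letting the
  standard simplex and the coefficient algebra vary with the same n makes the total complexes a
  simplicial differential graded algebra again, so that \<open>E\<close> is itself an algebra of
  forms. The obstacle is naturality. Coning off vertex 0 and choosing primitives are not compatible
  with monotone maps, so exactness for each n says nothing yet about simplicial maps out of X. The
  two directions need different contractions: a pulled back path in A^0 acts on values and commutes
  with \<open>del\<close>, but it need not be closed and may disturb \<open>der\<close>; cutting off
  by the first vertex acts at each argument separately and commutes with \<open>der\<close>, but not
  with \<open>del\<close>. Since a total degree has finitely many components, an element can be
  pushed to one edge of the double complex in finitely many steps, from the top component downwards
  for forms and from the bottom upwards for cochains.\<close>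

definition coface :: "nat \<Rightarrow> nat \<Rightarrow> nat \<Rightarrow> nat"
  where "coface n i = (\<lambda>j\<in>{..n}. if j < i then j else Suc j)"

definition codegen :: "nat \<Rightarrow> nat \<Rightarrow> nat \<Rightarrow> nat"
  where "codegen n i = (\<lambda>j\<in>{..Suc n}. if j \<le> i then j else j - 1)"

text \<open>For t from 0 to n + 1 these are all n-simplices of the standard interval; t counts the
  vertices sent to 0.\<close>

definition step_map :: "nat \<Rightarrow> nat \<Rightarrow> nat \<Rightarrow> nat"
  where "step_map n t = (\<lambda>j\<in>{..n}. if j < t then 0 else 1)"

lemma ord_mapsI:
  assumes "\<And>i. i \<le> m \<Longrightarrow> \<theta> i \<le> n" "\<And>i j. i \<le> j \<Longrightarrow> j \<le> m \<Longrightarrow> \<theta> i \<le> \<theta> j"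
    "\<And>i. \<not> i \<le> m \<Longrightarrow> \<theta> i = undefined"
  shows "\<theta> \<in> ord_maps m n"
  using assms by (auto simp: ord_maps_def PiE_iff extensional_def mono_on_def)

lemma ord_maps_le: "\<theta> \<in> ord_maps m n \<Longrightarrow> i \<le> m \<Longrightarrow> \<theta> i \<le> n"
  by (auto simp: ord_maps_def)

lemma ord_maps_mono: "\<theta> \<in> ord_maps m n \<Longrightarrow> i \<le> j \<Longrightarrow> j \<le> m \<Longrightarrow> \<theta> i \<le> \<theta> j"
  by (auto simp: ord_maps_def mono_on_def)

lemma ord_maps_undefined: "\<theta> \<in> ord_maps m n \<Longrightarrow> \<not> i \<le> m \<Longrightarrow> \<theta> i = undefined"
  by (auto simp: ord_maps_def PiE_iff extensional_def)

lemma ord_maps_eqI: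
  "\<theta> \<in> ord_maps m n \<Longrightarrow> \<phi> \<in> ord_maps m n' \<Longrightarrow> (\<And>i. i \<le> m \<Longrightarrow> \<theta> i = \<phi> i) \<Longrightarrow> \<theta> = \<phi>"
  by (metis ext ord_maps_undefined)

lemma compose_ord_maps:
  "\<theta> \<in> ord_maps l m \<Longrightarrow> \<phi> \<in> ord_maps m n \<Longrightarrow> compose {..l} \<phi> \<theta> \<in> ord_maps l n"
  by (rule ord_mapsI) (auto simp: compose_def ord_maps_le ord_maps_mono)

lemma id_ord_maps: "(\<lambda>i\<in>{..n}. i) \<in> ord_maps n n"
  by (rule ord_mapsI) auto

lemma coface_ord_maps: "coface n i \<in> ord_maps n (Suc n)"
  by (rule ord_mapsI) (auto simp: coface_def)

lemma codegen_ord_maps: "i \<le> n \<Longrightarrow> codegen n i \<in> ord_maps (Suc n) n"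
  by (rule ord_mapsI) (auto simp: codegen_def)

lemma step_map_ord_maps: "step_map n t \<in> ord_maps n 1"
  by (rule ord_mapsI) (auto simp: step_map_def)

lemma const_ord_maps: "c \<le> n \<Longrightarrow> (\<lambda>j\<in>{..m}. c) \<in> ord_maps m n"
  by (rule ord_mapsI) auto

lemma compose_assoc_ord_maps:
  "\<theta> \<in> ord_maps k l \<Longrightarrow>
    compose {..k} (compose {..l} \<psi> \<phi>) \<theta> = compose {..k} \<psi> (compose {..k} \<phi> \<theta>)"
  by (auto simp: compose_def fun_eq_iff ord_maps_le)

lemma compose_id_ord_maps: "\<theta> \<in> ord_maps m n \<Longrightarrow> compose {..m} (\<lambda>i\<in>{..n}. i) \<theta> = \<theta>"
  by (auto simp: compose_def fun_eq_iff ord_maps_le ord_maps_undefined)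

lemma compose_ord_maps_id: "\<theta> \<in> ord_maps m n \<Longrightarrow> compose {..m} \<theta> (\<lambda>i\<in>{..m}. i) = \<theta>"
  by (auto simp: compose_def fun_eq_iff ord_maps_le ord_maps_undefined)

section \<open>Cosimplicial identities\<close>

lemma coface_coface:
  "i < j \<Longrightarrow> compose {..n} (coface (Suc n) j) (coface n i) = compose {..n} (coface (Suc n) i) (coface n (j - 1))"
  by (auto simp: compose_def coface_def fun_eq_iff)

lemma codegen_coface_less:
  "i < j \<Longrightarrow> j \<le> Suc n \<Longrightarrow>
    compose {..Suc n} (codegen (Suc n) j) (coface (Suc n) i) = compose {..Suc n} (coface n i) (codegen n (j - 1))"
  by (auto simp: compose_def coface_def codegen_def fun_eq_iff)

lemma codegen_coface_greater:
  "Suc j < i \<Longrightarrow> i \<le> Suc (Suc n) \<Longrightarrow>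
    compose {..Suc n} (codegen (Suc n) j) (coface (Suc n) i) = compose {..Suc n} (coface n (i - 1)) (codegen n j)"
  by (auto simp: compose_def coface_def codegen_def fun_eq_iff)

lemma codegen_coface_same: "i = j \<or> i = Suc j \<Longrightarrow> compose {..n} (codegen n j) (coface n i) = (\<lambda>i\<in>{..n}. i)"
  by (auto simp: compose_def coface_def codegen_def fun_eq_iff)

text \<open>Omitting vertex i lowers the number of vertices sent to 0 exactly when i is one of
  them.\<close>

lemma step_map_coface: "compose {..n} (step_map (Suc n) t) (coface n i) = step_map n (if i < t then t - 1 else t)"
  by (auto simp: compose_def coface_def step_map_def fun_eq_iff)

lemma step_map_zero: "step_map n 0 = (\<lambda>j\<in>{..n}. 1)"
  by (simp add: step_map_def)

lemma step_map_Suc: "step_map n (Suc n) = (\<lambda>j\<in>{..n}. 0)"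
  by (auto simp: step_map_def fun_eq_iff)

text \<open>Shifting the values above the gap down by one loses nothing. In a simplicial set this
  turns the action of a map that is not surjective into the action on a face.\<close>

lemma ord_map_skips:
  assumes \<theta>: "\<theta> \<in> ord_maps m (Suc n)" and i: "i \<le> Suc n" "i \<notin> \<theta> ` {..m}"
  obtains \<theta>' where "\<theta>' \<in> ord_maps m n" "\<theta> = compose {..m} (coface n i) \<theta>'"
proof -
  have ne: "\<theta> j \<noteq> i" if "j \<le> m" for j using that i by auto
  have le: "\<theta> j \<le> Suc n" if "j \<le> m" for j using that \<theta> ord_maps_le by auto
  define \<theta>' where "\<theta>' = (\<lambda>j\<in>{..m}. if \<theta> j < i then \<theta> j else \<theta> j - 1)"
  have "\<theta>' \<in> ord_maps m n"
  proof (rule ord_mapsI)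
    fix j assume "j \<le> m"
    then show "\<theta>' j \<le> n" using ne[of j] le[of j] i by (auto simp: \<theta>'_def)
  next
    fix j k assume "j \<le> k" "k \<le> m"
    then show "\<theta>' j \<le> \<theta>' k"
      using ord_maps_mono[OF \<theta>, of j k] ne[of j] ne[of k] by (auto simp: \<theta>'_def)
  qed (simp add: \<theta>'_def)
  moreover have "\<theta> = compose {..m} (coface n i) \<theta>'"
  proof
    fix j show "\<theta> j = compose {..m} (coface n i) \<theta>' j"
      using ne[of j] le[of j] i ord_maps_undefined[OF \<theta>, of j]
      by (auto simp: compose_def \<theta>'_def coface_def)
  qed
  ultimately show thesis by (rule that)
qed

text \<open>The fibres of a monotone map are ordered like their values, so every choice of preimages
  is monotone. This leaves the freedom to prescribe the preimage j of one value, which later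
  separates a surjection from any other map.\<close>

lemma ord_map_section:
  assumes \<theta>: "\<theta> \<in> ord_maps m n" and surj: "\<theta> ` {..m} = {..n}" and j: "j \<le> m"
  obtains \<delta> where "\<delta> \<in> ord_maps n m" "compose {..n} \<theta> \<delta> = (\<lambda>i\<in>{..n}. i)" "\<delta> (\<theta> j) = j"
proof -
  have "\<exists>k. k \<le> m \<and> \<theta> k = i" if "i \<le> n" for i using surj that by (metis atMost_iff image_iff)
  then obtain s where s: "\<And>i. i \<le> n \<Longrightarrow> s i \<le> m \<and> \<theta> (s i) = i" by metis
  define \<delta> where "\<delta> = (\<lambda>i\<in>{..n}. if i = \<theta> j then j else s i)"
  have \<delta>: "\<delta> i \<le> m \<and> \<theta> (\<delta> i) = i" if "i \<le> n" for i using s[OF that] j that by (auto simp: \<delta>_def)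
  have "\<delta> \<in> ord_maps n m"
  proof (rule ord_mapsI)
    fix i k assume ik: "i \<le> k" "k \<le> n"
    show "\<delta> i \<le> \<delta> k"
    proof (rule ccontr)
      assume "\<not> \<delta> i \<le> \<delta> k"
      then have "\<theta> (\<delta> k) \<le> \<theta> (\<delta> i)" using ord_maps_mono[OF \<theta>, of "\<delta> k" "\<delta> i"] \<delta> ik by auto
      then have "i = k" using \<delta> ik by auto
      then show False using \<open>\<not> \<delta> i \<le> \<delta> k\<close> by simp
    qed
  qed (use \<delta> in \<open>auto simp: \<delta>_def\<close>)
  moreover have "compose {..n} \<theta> \<delta> = (\<lambda>i\<in>{..n}. i)" using \<delta> by (auto simp: compose_def fun_eq_iff)
  moreover have "\<delta> (\<theta> j) = j" using ord_maps_le[OF \<theta> j] by (simp add: \<delta>_def)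
  ultimately show thesis by (rule that)
qed

text \<open>Surjectivity on a finite set gives injectivity, and an injective monotone map that fixes
  everything below i can neither drop i below i nor skip over it.\<close>

lemma ord_map_surj_endo:
  assumes \<theta>: "\<theta> \<in> ord_maps n n" and surj: "\<theta> ` {..n} = {..n}"
  shows "\<theta> = (\<lambda>i\<in>{..n}. i)"
proof -
  have inj: "inj_on \<theta> {..n}" using surj by (intro eq_card_imp_inj_on) auto
  have "\<theta> i = i" if "i \<le> n" for i
    using that
  proof (induction i rule: less_induct)
    case (less i)
    obtain k where k: "k \<le> n" "\<theta> k = i" using surj less.prems by (metis atMost_iff image_iff)
    have "\<not> k < i" using less.IH[of k] k by auto
    then have "\<theta> i \<le> i" using ord_maps_mono[OF \<theta>, of i k] k by auto
    moreover have "\<not> \<theta> i < i"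
    proof
      assume l: "\<theta> i < i"
      then have "\<theta> (\<theta> i) = \<theta> i" using less by auto
      then show False using inj_onD[OF inj, of "\<theta> i" i] l less.prems by auto
    qed
    ultimately show ?case by simp
  qed
  then show ?thesis using ord_maps_eqI[OF \<theta> id_ord_maps] by simp
qed

section \<open>Contracted simplicial abelian groups\<close>

text \<open>The instances are the simplicial modules of simplex cochains in a fixed bidegree; only
  their addition matters for extending simplices.\<close>

locale simplicial_ab =
  fixes G :: "nat \<Rightarrow> ('g, 'e) ring_scheme" and s :: "nat \<Rightarrow> nat \<Rightarrow> (nat \<Rightarrow> nat) \<Rightarrow> 'g \<Rightarrow> 'g"
  assumes ab: "abelian_group (G n)"
    and s_closed: "\<theta> \<in> ord_maps m n \<Longrightarrow> x \<in> carrier (G n) \<Longrightarrow> s m n \<theta> x \<in> carrier (G m)"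
    and s_add: "\<theta> \<in> ord_maps m n \<Longrightarrow> x \<in> carrier (G n) \<Longrightarrow> y \<in> carrier (G n) \<Longrightarrow>
      s m n \<theta> (x \<oplus>\<^bsub>G n\<^esub> y) = s m n \<theta> x \<oplus>\<^bsub>G m\<^esub> s m n \<theta> y"
    and s_id: "x \<in> carrier (G n) \<Longrightarrow> s n n (\<lambda>i\<in>{..n}. i) x = x"
    and s_compose: "\<theta> \<in> ord_maps l m \<Longrightarrow> \<phi> \<in> ord_maps m n \<Longrightarrow> x \<in> carrier (G n) \<Longrightarrow>
      s l n (compose {..l} \<phi> \<theta>) x = s l m \<theta> (s m n \<phi> x)"
begin

abbreviation d :: "nat \<Rightarrow> nat \<Rightarrow> 'g \<Rightarrow> 'g" where "d n i \<equiv> s n (Suc n) (coface n i)"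
abbreviation sg :: "nat \<Rightarrow> nat \<Rightarrow> 'g \<Rightarrow> 'g" where "sg n i \<equiv> s (Suc n) n (codegen n i)"

lemma s_zero: assumes "\<theta> \<in> ord_maps m n" shows "s m n \<theta> \<zero>\<^bsub>G n\<^esub> = \<zero>\<^bsub>G m\<^esub>"
proof -
  interpret M: abelian_group "G m" by (rule ab)
  interpret N: abelian_group "G n" by (rule ab)
  have c: "s m n \<theta> \<zero>\<^bsub>G n\<^esub> \<in> carrier (G m)" using assms s_closed by simp
  have "s m n \<theta> \<zero>\<^bsub>G n\<^esub> = s m n \<theta> \<zero>\<^bsub>G n\<^esub> \<oplus>\<^bsub>G m\<^esub> s m n \<theta> \<zero>\<^bsub>G n\<^esub>"
    using s_add[OF assms, of "\<zero>\<^bsub>G n\<^esub>" "\<zero>\<^bsub>G n\<^esub>"] by simp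
  then show ?thesis using c M.add.r_cancel_one' by metis
qed

lemma s_minus:
  assumes \<theta>: "\<theta> \<in> ord_maps m n" and xy: "x \<in> carrier (G n)" "y \<in> carrier (G n)"
  shows "s m n \<theta> (x \<ominus>\<^bsub>G n\<^esub> y) = s m n \<theta> x \<ominus>\<^bsub>G m\<^esub> s m n \<theta> y"
proof -
  interpret M: abelian_group "G m" by (rule ab)
  interpret N: abelian_group "G n" by (rule ab)
  have "s m n \<theta> x = s m n \<theta> ((x \<ominus>\<^bsub>G n\<^esub> y) \<oplus>\<^bsub>G n\<^esub> y)"
    using xy by (simp add: N.minus_eq N.a_assoc N.l_neg)
  also have "\<dots> = s m n \<theta> (x \<ominus>\<^bsub>G n\<^esub> y) \<oplus>\<^bsub>G m\<^esub> s m n \<theta> y" using \<theta> xy by (simp add: s_add)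
  finally show ?thesis using \<theta> xy s_closed by (simp add: M.minus_eq M.a_assoc M.r_neg)
qed

lemma d_d: "i < j \<Longrightarrow> x \<in> carrier (G (Suc (Suc n))) \<Longrightarrow> d n i (d (Suc n) j x) = d n (j - 1) (d (Suc n) i x)"
  by (simp add: s_compose[symmetric] coface_ord_maps coface_coface)

lemma d_sg_less: "i < j \<Longrightarrow> j \<le> Suc n \<Longrightarrow> x \<in> carrier (G (Suc n)) \<Longrightarrow>
    d (Suc n) i (sg (Suc n) j x) = sg n (j - 1) (d n i x)"
  by (simp add: s_compose[symmetric] coface_ord_maps codegen_ord_maps codegen_coface_less)

lemma d_sg_greater: "Suc j < i \<Longrightarrow> i \<le> Suc (Suc n) \<Longrightarrow> x \<in> carrier (G (Suc n)) \<Longrightarrow>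
    d (Suc n) i (sg (Suc n) j x) = sg n j (d n (i - 1) x)"
  by (simp add: s_compose[symmetric] coface_ord_maps codegen_ord_maps codegen_coface_greater)

lemma d_sg_same: "i = j \<or> i = Suc j \<Longrightarrow> j \<le> n \<Longrightarrow> x \<in> carrier (G n) \<Longrightarrow> d n i (sg n j x) = x"
  by (subst s_compose[symmetric])
    (simp_all add: coface_ord_maps codegen_ord_maps codegen_coface_same s_id)

end

text \<open>The operators \<open>mu n \<sigma>\<close>, indexed by the simplices \<open>\<sigma>\<close> of the interval, form a simplicial homotopy
  from the identity of \<open>K\<close> to \<open>0\<close>.\<close>

locale contracted = simplicial_ab +
  fixes K :: "nat \<Rightarrow> 'a set" and mu :: "nat \<Rightarrow> (nat \<Rightarrow> nat) \<Rightarrow> 'a \<Rightarrow> 'a"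
  assumes K_carrier: "K n \<subseteq> carrier (G n)"
    and K_zero: "\<zero>\<^bsub>G n\<^esub> \<in> K n"
    and K_add: "x \<in> K n \<Longrightarrow> y \<in> K n \<Longrightarrow> x \<oplus>\<^bsub>G n\<^esub> y \<in> K n"
    and K_uminus: "x \<in> K n \<Longrightarrow> \<ominus>\<^bsub>G n\<^esub> x \<in> K n"
    and K_s: "\<theta> \<in> ord_maps m n \<Longrightarrow> x \<in> K n \<Longrightarrow> s m n \<theta> x \<in> K m"
    and mu_K: "\<sigma> \<in> ord_maps n 1 \<Longrightarrow> x \<in> K n \<Longrightarrow> mu n \<sigma> x \<in> K n"
    and mu_zero: "\<sigma> \<in> ord_maps n 1 \<Longrightarrow> mu n \<sigma> \<zero>\<^bsub>G n\<^esub> = \<zero>\<^bsub>G n\<^esub>"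
    and mu_const0: "x \<in> K n \<Longrightarrow> mu n (\<lambda>j\<in>{..n}. 0) x = x"
    and mu_const1: "x \<in> K n \<Longrightarrow> mu n (\<lambda>j\<in>{..n}. 1) x = \<zero>\<^bsub>G n\<^esub>"
    and s_mu: "\<theta> \<in> ord_maps m n \<Longrightarrow> \<sigma> \<in> ord_maps n 1 \<Longrightarrow> x \<in> K n \<Longrightarrow>
      s m n \<theta> (mu n \<sigma> x) = mu m (compose {..m} \<sigma> \<theta>) (s m n \<theta> x)"
begin

lemma K_minus: "x \<in> K n \<Longrightarrow> y \<in> K n \<Longrightarrow> x \<ominus>\<^bsub>G n\<^esub> y \<in> K n"
  by (simp add: a_minus_def K_add K_uminus)

lemma KC: "x \<in> K n \<Longrightarrow> x \<in> carrier (G n)"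
  using K_carrier by blast

text \<open>These are the top simplices of the prism over \<open>x\<close>: degenerate along t in
  the simplex direction, with t + 1 vertices at the start of the interval. Faces t and t + 1 undo
  the degeneracy and are the walls between neighbouring pieces; any other face lies over a face of
  \<open>x\<close>, which is zero.\<close>

lemma d_prism:
  assumes x: "x \<in> K n" and faces: "\<And>m i. n = Suc m \<Longrightarrow> i \<le> n \<Longrightarrow> d m i x = \<zero>\<^bsub>G m\<^esub>"
    and t: "t \<le> n" and i: "i \<le> Suc n"
  shows "d n i (mu (Suc n) (step_map (Suc n) (Suc t)) (sg n t x)) =
    (if i = t \<or> i = Suc t then mu n (step_map n i) x else \<zero>\<^bsub>G n\<^esub>)"
proof -
  have "d n i (mu (Suc n) (step_map (Suc n) (Suc t)) (sg n t x)) =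
      mu n (compose {..n} (step_map (Suc n) (Suc t)) (coface n i)) (d n i (sg n t x))"
    using x t by (intro s_mu coface_ord_maps step_map_ord_maps K_s codegen_ord_maps)
  moreover have "d n i (sg n t x) = \<zero>\<^bsub>G n\<^esub>" if ne: "i \<noteq> t" "i \<noteq> Suc t"
  proof (cases n)
    case 0
    then show ?thesis using ne t i by simp
  next
    case (Suc m)
    have "i < t \<or> Suc t < i" using ne by linarith
    then show ?thesis
    proof
      assume "i < t"
      then show ?thesis using Suc t x faces[OF Suc, of i]
        by (simp add: d_sg_less KC s_zero codegen_ord_maps)
    next
      assume "Suc t < i"
      then show ?thesis using Suc i x faces[OF Suc, of "i - 1"]
        by (simp add: d_sg_greater KC s_zero codegen_ord_maps)
    qed
  qed
  moreover have "d n i (sg n t x) = x" if "i = t \<or> i = Suc t" 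
    using that t x by (simp add: d_sg_same KC)
  ultimately show ?thesis by (auto simp: step_map_coface mu_zero[OF step_map_ord_maps])
qed

text \<open>The homotopy from \<open>x\<close> to 0 is a prism whose sides vanish. Its pieces are
  glued with signs that cancel the inner walls, so that only the end at \<open>x\<close>
  survives.\<close>

lemma sphere_bounds:
  assumes x: "x \<in> K n" and faces: "\<And>m i. n = Suc m \<Longrightarrow> i \<le> n \<Longrightarrow> d m i x = \<zero>\<^bsub>G m\<^esub>"
  shows "\<exists>w\<in>K (Suc n). (\<forall>i\<le>n. d n i w = \<zero>\<^bsub>G n\<^esub>) \<and> d n (Suc n) w = x"
proof -
  interpret M: abelian_group "G n" by (rule ab)
  interpret N: abelian_group "G (Suc n)" by (rule ab)
  define z where "z t = mu (Suc n) (step_map (Suc n) (Suc t)) (sg n t x)" for t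
  define y where "y t = mu n (step_map n t) x" for t
  have zK: "z t \<in> K (Suc n)" if "t \<le> n" for t
    using that x by (auto simp: z_def intro!: mu_K K_s step_map_ord_maps codegen_ord_maps)
  have yK: "y t \<in> K n" for t using x by (auto simp: y_def intro!: mu_K step_map_ord_maps)
  have dz: "d n i (z t) = (if i = t \<or> i = Suc t then y i else \<zero>\<^bsub>G n\<^esub>)" if "t \<le> n" "i \<le> Suc n" for i t
    unfolding z_def y_def by (rule d_prism[OF x faces that])
  have yn: "y (Suc n) = x" using x by (simp add: y_def step_map_Suc mu_const0)
  have y0: "y 0 = \<zero>\<^bsub>G n\<^esub>" using x mu_const1[OF x] by (simp add: y_def step_map_zero)
  \<comment> \<open>The pieces are added from t = n downwards. What remains is the wall
    \<open>y t\<close> up to a sign that alternates; the disjunction avoids recording it. At t = 0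
    the wall is zero, so the sign no longer matters.\<close>
  have "\<exists>w\<in>K (Suc n). (\<forall>i\<le>n. i \<noteq> t \<longrightarrow> d n i w = \<zero>\<^bsub>G n\<^esub>) \<and> d n (Suc n) w = x
      \<and> (d n t w = y t \<or> d n t w = \<ominus>\<^bsub>G n\<^esub> y t)" if "t \<le> n" for t
    using that
  proof (induction t rule: inc_induct)
    case base
    show ?case using dz[of n] zK[of n] yn by (intro bexI[of _ "z n"]) auto
  next
    case (step t)
    then obtain w where w: "w \<in> K (Suc n)" "\<And>i. i \<le> n \<Longrightarrow> i \<noteq> Suc t \<Longrightarrow> d n i w = \<zero>\<^bsub>G n\<^esub>"
      "d n (Suc n) w = x" "d n (Suc t) w = y (Suc t) \<or> d n (Suc t) w = \<ominus>\<^bsub>G n\<^esub> y (Suc t)" by blast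
    have t: "t < n" using step by simp
    note cl = KC[OF w(1)] KC[OF zK[of t]] coface_ord_maps KC[OF yK] KC[OF x]
    show ?case
    proof (cases "d n (Suc t) w = y (Suc t)")
      case True
      then show ?thesis
        using w t cl dz[of t] zK[of t]
        by (intro bexI[of _ "w \<ominus>\<^bsub>G (Suc n)\<^esub> z t"] K_minus)
           (auto simp: s_minus M.minus_eq M.r_neg)
    next
      case False
      then show ?thesis
        using w t cl dz[of t] zK[of t]
        by (intro bexI[of _ "w \<oplus>\<^bsub>G (Suc n)\<^esub> z t"] K_add)
           (auto simp: s_add M.l_neg)
    qed
  qed
  from this[of 0] y0 show ?thesis by force
qed

text \<open>Horns fill in every simplicial group, by correcting one face after another with
  degenerate simplices. The contraction is what makes the last face fit as well. For n = 0 the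
  compatibility condition is vacuous and two arbitrary vertices get joined.\<close>

lemma boundary_extends:
  assumes b: "\<And>i. i \<le> Suc n \<Longrightarrow> b i \<in> K n"
    and compat: "\<And>m i j. n = Suc m \<Longrightarrow> i < j \<Longrightarrow> j \<le> Suc n \<Longrightarrow> d m i (b j) = d m (j - 1) (b i)"
  shows "\<exists>k\<in>K (Suc n). \<forall>i\<le>Suc n. d n i k = b i"
proof -
  interpret M: abelian_group "G n" by (rule ab)
  interpret N: abelian_group "G (Suc n)" by (rule ab)
  \<comment> \<open>Where face i is already right, the error at a later face j has trivial face i,
    because both sides of the error obey the same simplicial identity.\<close>
  have defect: "d m i (b j \<ominus>\<^bsub>G n\<^esub> d n j k) = \<zero>\<^bsub>G m\<^esub>"
    if "n = Suc m" "i < j" "j \<le> Suc n" "k \<in> K (Suc n)" "d n i k = b i" for m i j k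
  proof -
    interpret abelian_group "G m" by (rule ab)
    have "d m i (b j \<ominus>\<^bsub>G n\<^esub> d n j k) = d m i (b j) \<ominus>\<^bsub>G m\<^esub> d m i (d n j k)"
      using that b by (simp add: s_minus coface_ord_maps KC s_closed)
    also have "\<dots> = d m (j - 1) (b i) \<ominus>\<^bsub>G m\<^esub> d m (j - 1) (d n i k)"
      using that by (simp add: compat d_d KC)
    finally show ?thesis using that b[of i] by (simp add: minus_eq r_neg s_closed coface_ord_maps KC)
  qed
  have "\<exists>k\<in>K (Suc n). \<forall>i<j. d n i k = b i" if "j \<le> Suc n" for j
    using that
  proof (induction j)
    case 0
    show ?case using K_zero by auto
  next
    case (Suc j)
    then obtain k where k: "k \<in> K (Suc n)" "\<And>i. i < j \<Longrightarrow> d n i k = b i" by auto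
    define y where "y = b j \<ominus>\<^bsub>G n\<^esub> d n j k"
    have y: "y \<in> K n" using Suc.prems b k by (auto simp: y_def intro!: K_minus K_s coface_ord_maps)
    \<comment> \<open>Adding this degenerate simplex repairs face j. An earlier face i sees the
      degeneracy of face i of the error, which is zero by \<open>defect\<close>.\<close>
    have sy: "sg n j y \<in> K (Suc n)" using Suc.prems y by (intro K_s codegen_ord_maps) auto
    have "d n i (k \<oplus>\<^bsub>G (Suc n)\<^esub> sg n j y) = b i" if "i < Suc j" for i
    proof (cases "i = j")
      case True
      then have "d n i (sg n j y) = y" using Suc.prems y by (intro d_sg_same) (auto simp: KC)
      then show ?thesis using True k sy b[of j] Suc.prems KC
        by (simp add: s_add coface_ord_maps y_def s_closed M.minus_eq M.a_lcomm M.r_neg)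
    next
      case False
      then have ij: "i < j" using that by simp
      then obtain m where m: "n = Suc m" using Suc.prems by (cases n) auto
      have "d n i (sg n j y) = sg m (j - 1) (d m i y)"
        using ij Suc.prems y unfolding m by (intro d_sg_less) (auto simp: KC m)
      also have "d m i y = \<zero>\<^bsub>G m\<^esub>"
        unfolding y_def using ij Suc.prems k m by (intro defect) auto
      also have "sg m (j - 1) \<zero>\<^bsub>G m\<^esub> = \<zero>\<^bsub>G n\<^esub>"
        using Suc.prems m unfolding m by (intro s_zero codegen_ord_maps) auto
      finally show ?thesis using ij k sy b[of i] Suc.prems by (simp add: s_add coface_ord_maps KC)
    qed
    then show ?case using K_add[OF k(1) sy] by blast
  qed
  then obtain k where k: "k \<in> K (Suc n)" "\<And>i. i \<le> n \<Longrightarrow> d n i k = b i"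
    by (meson le_refl less_Suc_eq_le)
  \<comment> \<open>All faces but the last agree now, so the remaining error has only zero faces and
    bounds by \<open>sphere_bounds\<close>.\<close>
  define y where "y = b (Suc n) \<ominus>\<^bsub>G n\<^esub> d n (Suc n) k"
  have y: "y \<in> K n" using b k by (auto simp: y_def intro!: K_minus K_s coface_ord_maps)
  obtain w where w: "w \<in> K (Suc n)" "\<And>i. i \<le> n \<Longrightarrow> d n i w = \<zero>\<^bsub>G n\<^esub>" "d n (Suc n) w = y"
    using sphere_bounds[OF y] defect[of _ _ "Suc n" k] k unfolding y_def by fastforce
  have "d n i (k \<oplus>\<^bsub>G (Suc n)\<^esub> w) = b i" if "i \<le> Suc n" for i
  proof (cases "i = Suc n")
    case True
    then show ?thesis using k(1) w b[of "Suc n"]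
      by (simp add: s_add coface_ord_maps KC y_def s_closed M.minus_eq M.a_lcomm M.r_neg)
  next
    case False
    then show ?thesis using that k w b[of i] by (simp add: s_add coface_ord_maps KC)
  qed
  then show ?thesis using K_add[OF k(1) w(1)] by blast
qed

end

text \<open>A section of a surjection undoes the degeneracy that the surjection induces. So a domain
  closed under the action that contains a degeneracy of \<open>x\<close> contains
  \<open>x\<close>.\<close>

lemma (in simplicial_set) act_section:
  assumes \<theta>: "\<theta> \<in> ord_maps m n" "\<theta> ` {..m} = {..n}" and x: "x \<in> simplices X n"
  obtains \<delta> where "\<delta> \<in> ord_maps n m" "act X n m \<delta> (act X m n \<theta> x) = x"
proof -
  obtain \<delta> where \<delta>: "\<delta> \<in> ord_maps n m" "compose {..n} \<theta> \<delta> = (\<lambda>i\<in>{..n}. i)"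
    using ord_map_section[OF \<theta>, of 0] by blast
  then show thesis using that act_compose[OF \<delta>(1) \<theta>(1) x] act_id[OF x] by simp
qed

text \<open>The \<open>F n x\<close> are cosets of the contracted group \<open>K n\<close>. A maximal partial natural section is total:
  at a missing simplex of minimal dimension all faces are already chosen, and
  \<open>boundary_extends\<close> corrects an arbitrary choice to one that matches them.\<close>

theorem (in contracted) natural_section:
  fixes X :: "('x, 'n) sset_scheme"
  assumes sset: "simplicial_set X"
    and F_carrier: "\<And>n x. x \<in> simplices X n \<Longrightarrow> F n x \<subseteq> carrier (G n)"
    and F_nonempty: "\<And>n x. x \<in> simplices X n \<Longrightarrow> F n x \<noteq> {}"
    and F_minus: "\<And>n x m m'. x \<in> simplices X n \<Longrightarrow> m \<in> F n x \<Longrightarrow> m' \<in> F n x \<Longrightarrow> m \<ominus>\<^bsub>G n\<^esub> m' \<in> K n"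
    and F_minus_K: "\<And>n x m k. x \<in> simplices X n \<Longrightarrow> m \<in> F n x \<Longrightarrow> k \<in> K n \<Longrightarrow> m \<ominus>\<^bsub>G n\<^esub> k \<in> F n x"
    and F_s: "\<And>\<theta> n' n x m. \<theta> \<in> ord_maps n' n \<Longrightarrow> x \<in> simplices X n \<Longrightarrow> m \<in> F n x \<Longrightarrow>
      s n' n \<theta> m \<in> F n' (act X n' n \<theta> x)"
  obtains g where "\<And>n x. x \<in> simplices X n \<Longrightarrow> g n x \<in> F n x"
    "\<And>m n \<theta> x. \<theta> \<in> ord_maps m n \<Longrightarrow> x \<in> simplices X n \<Longrightarrow> g m (act X m n \<theta> x) = s m n \<theta> (g n x)"
proof -
  interpret X: simplicial_set X by (rule sset)
  \<comment> \<open>A partial section is kept as its graph, so that the order for Zorn's lemma is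
    inclusion and the union of a chain is again a candidate. Closure under the action makes the
    domain a simplicial subset.\<close>
  define natural :: "(nat \<times> 'x \<times> 'a) set \<Rightarrow> bool" where "natural \<Gamma> \<longleftrightarrow>
    (\<forall>n x m. (n, x, m) \<in> \<Gamma> \<longrightarrow> x \<in> simplices X n \<and> m \<in> F n x) \<and>
    (\<forall>n x m m'. (n, x, m) \<in> \<Gamma> \<longrightarrow> (n, x, m') \<in> \<Gamma> \<longrightarrow> m = m') \<and>
    (\<forall>n' n \<theta> x m. \<theta> \<in> ord_maps n' n \<longrightarrow> (n, x, m) \<in> \<Gamma> \<longrightarrow> (n', act X n' n \<theta> x, s n' n \<theta> m) \<in> \<Gamma>)" for \<Gamma>
  have "\<exists>\<Gamma>\<in>{\<Gamma>. natural \<Gamma>}. \<forall>\<Gamma>'\<in>{\<Gamma>. natural \<Gamma>}. \<Gamma> \<subseteq> \<Gamma>' \<longrightarrow> \<Gamma>' = \<Gamma>"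
  proof (rule Zorn_Lemma2, rule ballI)
    fix C assume C: "C \<in> chains {\<Gamma>. natural \<Gamma>}"
    have nat: "natural \<Gamma>" if "\<Gamma> \<in> C" for \<Gamma> using C that by (auto simp: chains_def)
    have "natural (\<Union>C)"
      unfolding natural_def
    proof (intro conjI allI impI)
      fix n x m m' assume "(n, x, m) \<in> \<Union>C" "(n, x, m') \<in> \<Union>C"
      then obtain \<Gamma> \<Gamma>' where "\<Gamma> \<in> C" "\<Gamma>' \<in> C" "(n, x, m) \<in> \<Gamma>" "(n, x, m') \<in> \<Gamma>'" by blast
      moreover from this have "\<Gamma> \<subseteq> \<Gamma>' \<or> \<Gamma>' \<subseteq> \<Gamma>" using C by (auto simp: chains_def chain_subset_def)
      ultimately show "m = m'" using nat unfolding natural_def by blast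
    qed (use nat in \<open>unfold natural_def, blast+\<close>)
    then show "\<exists>U\<in>{\<Gamma>. natural \<Gamma>}. \<forall>\<Gamma>\<in>C. \<Gamma> \<subseteq> U" by blast
  qed
  then obtain \<Gamma> where nat: "natural \<Gamma>" and max: "\<And>\<Gamma>'. natural \<Gamma>' \<Longrightarrow> \<Gamma> \<subseteq> \<Gamma>' \<Longrightarrow> \<Gamma>' = \<Gamma>" by blast
  have \<Gamma>_F: "\<And>n x m. (n, x, m) \<in> \<Gamma> \<Longrightarrow> x \<in> simplices X n \<and> m \<in> F n x"
    and \<Gamma>_fun: "\<And>n x m m'. (n, x, m) \<in> \<Gamma> \<Longrightarrow> (n, x, m') \<in> \<Gamma> \<Longrightarrow> m = m'"
    and \<Gamma>_s: "\<And>n' n \<theta> x m. \<theta> \<in> ord_maps n' n \<Longrightarrow> (n, x, m) \<in> \<Gamma> \<Longrightarrow> (n', act X n' n \<theta> x, s n' n \<theta> m) \<in> \<Gamma>"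
    using nat unfolding natural_def by blast+
  have dom: "\<exists>m. (n, x, m) \<in> \<Gamma>" if "x \<in> simplices X n" for n x
    using that
  proof (induction n arbitrary: x rule: less_induct)
    case (less n)
    note x = \<open>x \<in> simplices X n\<close>
    show ?case
    proof (rule ccontr)
      assume notin: "\<nexists>m. (n, x, m) \<in> \<Gamma>"
      interpret N: abelian_group "G n" by (rule ab)
      obtain m0 where m0: "m0 \<in> F n x" using F_nonempty[OF x] by blast
      \<comment> \<open>The faces of \<open>x\<close> have smaller dimension and carry values
        already. A value at \<open>x\<close> is wanted whose faces are these values.\<close>
      have "\<exists>m\<in>F n x. \<forall>n' i. n = Suc n' \<longrightarrow> i \<le> n \<longrightarrow> (n', act X n' n (coface n' i) x, d n' i m) \<in> \<Gamma>"
      proof (cases n)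
        case 0
        then show ?thesis using m0 by blast
      next
        case (Suc n')
        interpret N': abelian_group "G n'" by (rule ab)
        define y where "y i = act X n' n (coface n' i) x" for i
        have y: "y i \<in> simplices X n'" for i
          using x Suc coface_ord_maps by (auto simp: y_def intro!: X.act_closed)
        have "\<forall>i. \<exists>e. (n', y i, e) \<in> \<Gamma>" using less.IH[of n'] y Suc by blast
        then obtain e where e: "\<And>i. (n', y i, e i) \<in> \<Gamma>" by (auto dest!: choice)
        have eF: "e i \<in> F n' (y i)" for i using e \<Gamma>_F by blast
        have dF: "d n' i m0 \<in> F n' (y i)" for i
          using F_s[OF coface_ord_maps _ m0[unfolded Suc]] x by (simp add: Suc y_def)
        note car = subsetD[OF F_carrier[OF y] eF] subsetD[OF F_carrier[OF y] dF] subsetD[OF F_carrier[OF x] m0]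
        \<comment> \<open>The faces of an arbitrary \<open>m0\<close> differ from the prescribed
          ones by elements of \<open>K\<close>. A simplex of \<open>K\<close> with this boundary,
          subtracted from \<open>m0\<close>, corrects all faces at once.\<close>
        have "\<exists>k\<in>K (Suc n'). \<forall>i\<le>Suc n'. d n' i k = d n' i m0 \<ominus>\<^bsub>G n'\<^esub> e i"
        proof (rule boundary_extends)
          fix i show "d n' i m0 \<ominus>\<^bsub>G n'\<^esub> e i \<in> K n'" by (rule F_minus[OF y dF eF])
        next
          fix l i j assume l: "n' = Suc l" "i < j" "j \<le> Suc n'"
          \<comment> \<open>Two faces of \<open>x\<close> share a face of codimension two, and
            \<open>\<Gamma>\<close> has a single value there; this is the compatibility of the
            prescribed values.\<close>
          have "act X l n' (coface l i) (y j) = act X l n' (coface l (j - 1)) (y i)"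
            unfolding y_def l Suc
            by (subst (1 2) X.act_compose[symmetric]) (use l x Suc in \<open>auto simp: coface_ord_maps coface_coface\<close>)
          moreover have "(l, act X l n' (coface l i) (y j), d l i (e j)) \<in> \<Gamma>"
            "(l, act X l n' (coface l (j - 1)) (y i), d l (j - 1) (e i)) \<in> \<Gamma>"
            using \<Gamma>_s[OF coface_ord_maps e[unfolded l]] by (simp_all add: l)
          ultimately have "d l i (e j) = d l (j - 1) (e i)" using \<Gamma>_fun by metis
          moreover have "d l i (d n' j m0) = d l (j - 1) (d n' i m0)"
            using l car(3) Suc by (simp add: d_d)
          ultimately show "d l i (d n' j m0 \<ominus>\<^bsub>G n'\<^esub> e j) = d l (j - 1) (d n' i m0 \<ominus>\<^bsub>G n'\<^esub> e i)"
            using car by (simp add: l s_minus coface_ord_maps)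
        qed
        then obtain k where k: "k \<in> K n" "\<And>i. i \<le> n \<Longrightarrow> d n' i k = d n' i m0 \<ominus>\<^bsub>G n'\<^esub> e i"
          using Suc by auto
        have "d n' i (m0 \<ominus>\<^bsub>G n\<^esub> k) = e i" if "i \<le> n" for i
        proof -
          have "d n' i (m0 \<ominus>\<^bsub>G n\<^esub> k) = d n' i m0 \<ominus>\<^bsub>G n'\<^esub> (d n' i m0 \<ominus>\<^bsub>G n'\<^esub> e i)"
            using that k car KC Suc by (simp add: s_minus coface_ord_maps)
          then show ?thesis
            using car by (simp add: N'.minus_eq N'.minus_add N'.a_assoc[symmetric] N'.r_neg)
        qed
        then show ?thesis using F_minus_K[OF x m0 k(1)] e Suc by (force simp: y_def)
      qed
      then obtain m where m: "m \<in> F n x"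
        and faces: "\<And>n' i. n = Suc n' \<Longrightarrow> i \<le> n \<Longrightarrow> (n', act X n' n (coface n' i) x, d n' i m) \<in> \<Gamma>" by blast
      have mG: "m \<in> carrier (G n)" using m F_carrier[OF x] by blast
      \<comment> \<open>The simplicial subset generated by \<open>x\<close> is added to the domain.
        It must be checked that the new values are well defined and agree with the old ones on the
        overlap.\<close>
      define \<Gamma>' where "\<Gamma>' = \<Gamma> \<union> {(k, act X k n \<phi> x, s k n \<phi> m) | k \<phi>. \<phi> \<in> ord_maps k n}"
      \<comment> \<open>A map that misses a vertex factors through a coface, so here the new value
        is induced from a face of \<open>x\<close> and is already recorded.\<close>
      have nonsurj: "(k, act X k n \<phi> x, s k n \<phi> m) \<in> \<Gamma>"
        if \<phi>: "\<phi> \<in> ord_maps k n" and ns: "\<phi> ` {..k} \<noteq> {..n}" for k \<phi>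
      proof -
        obtain i where i: "i \<le> n" "i \<notin> \<phi> ` {..k}" using ns \<phi> ord_maps_le by blast
        then have "n \<noteq> 0" using ord_maps_le[OF \<phi>, of 0] by (intro notI) auto
        then obtain n' where n': "n = Suc n'" using not0_implies_Suc by blast
        obtain \<phi>' where \<phi>': "\<phi>' \<in> ord_maps k n'" "\<phi> = compose {..k} (coface n' i) \<phi>'"
          using ord_map_skips[of \<phi> k n' i] \<phi> i unfolding n' by blast
        show ?thesis using \<Gamma>_s[OF \<phi>'(1) faces[OF n' i(1)]] \<phi>' x mG coface_ord_maps
          by (simp add: n' X.act_compose s_compose)
      qed
      \<comment> \<open>A degeneracy of \<open>x\<close> in the old domain would bring
        \<open>x\<close> into it through a section.\<close>
      have surj: "\<phi> ` {..k} \<noteq> {..n}"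
        if \<phi>: "\<phi> \<in> ord_maps k n" and "(k, act X k n \<phi> x, m') \<in> \<Gamma>" for k \<phi> m'
        using that notin X.act_section[OF \<phi> _ x] \<Gamma>_s by metis
      \<comment> \<open>This is the uniqueness part of the Eilenberg-Zilber lemma for the
        nondegenerate simplex \<open>x\<close>. For each j take a section \<delta> of \<phi> through
        j. Then \<psi> after \<delta> fixes \<open>x\<close>; it must be surjective, since otherwise
        \<open>x\<close> would lie in the old domain, hence it is the identity, and \<psi> agrees
        with \<phi> at j.\<close>
      have uniq: "\<phi> = \<psi>"
        if \<phi>: "\<phi> \<in> ord_maps k n" "\<phi> ` {..k} = {..n}" and \<psi>: "\<psi> \<in> ord_maps k n"
          and eq: "act X k n \<phi> x = act X k n \<psi> x" for k \<phi> \<psi>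
      proof (rule ord_maps_eqI[OF \<phi>(1) \<psi>])
        fix j assume j: "j \<le> k"
        obtain \<delta> where \<delta>: "\<delta> \<in> ord_maps n k" "compose {..n} \<phi> \<delta> = (\<lambda>i\<in>{..n}. i)" "\<delta> (\<phi> j) = j"
          using ord_map_section[OF \<phi> j] by blast
        have cx: "act X n n (compose {..n} \<psi> \<delta>) x = x"
          using X.act_compose[OF \<delta>(1) \<psi> x] X.act_compose[OF \<delta>(1) \<phi>(1) x] eq \<delta> X.act_id[OF x] by simp
        have c: "compose {..n} \<psi> \<delta> \<in> ord_maps n n" by (rule compose_ord_maps[OF \<delta>(1) \<psi>])
        then have "compose {..n} \<psi> \<delta> ` {..n} = {..n}" using nonsurj[OF c] notin cx by metis
        then have "compose {..n} \<psi> \<delta> = (\<lambda>i\<in>{..n}. i)" by (rule ord_map_surj_endo[OF c])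
        then have "compose {..n} \<psi> \<delta> (\<phi> j) = \<phi> j" using ord_maps_le[OF \<phi>(1) j] by simp
        then show "\<phi> j = \<psi> j" using \<delta>(3) ord_maps_le[OF \<phi>(1) j] by (simp add: compose_def)
      qed
      have agree: "m1 = s k n \<phi> m"
        if \<phi>: "\<phi> \<in> ord_maps k n" and "(k, act X k n \<phi> x, m1) \<in> \<Gamma>'" for k \<phi> m1
      proof -
        from that(2) consider "(k, act X k n \<phi> x, m1) \<in> \<Gamma>"
          | \<psi> where "\<psi> \<in> ord_maps k n" "act X k n \<phi> x = act X k n \<psi> x" "m1 = s k n \<psi> m"
          by (auto simp: \<Gamma>'_def)
        then show ?thesis
        proof cases
          case 1
          then show ?thesis using nonsurj[OF \<phi> surj[OF \<phi> 1]] \<Gamma>_fun by blast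
        next
          case (2 \<psi>)
          show ?thesis
          proof (cases "\<phi> ` {..k} = {..n}")
            case True
            then show ?thesis using uniq[OF \<phi> True 2(1,2)] 2(3) by simp
          next
            case F: False
            have "\<psi> ` {..k} \<noteq> {..n}" using surj[OF 2(1)] nonsurj[OF \<phi> F] 2(2) by metis
            then show ?thesis using nonsurj[OF \<phi> F] nonsurj[OF 2(1)] 2 \<Gamma>_fun by metis
          qed
        qed
      qed
      have "natural \<Gamma>'"
        unfolding natural_def
      proof (intro conjI allI impI)
        fix k y l assume "(k, y, l) \<in> \<Gamma>'"
        then show "y \<in> simplices X k" "l \<in> F k y"
          using \<Gamma>_F x m F_s X.act_closed by (auto simp: \<Gamma>'_def)
      next
        fix k y l l' assume ll: "(k, y, l) \<in> \<Gamma>'" "(k, y, l') \<in> \<Gamma>'"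
        show "l = l'"
        proof (cases "\<exists>\<phi>\<in>ord_maps k n. y = act X k n \<phi> x")
          case True
          then show ?thesis using agree ll by metis
        next
          case False
          then show ?thesis using ll \<Gamma>_fun by (auto simp: \<Gamma>'_def)
        qed
      next
        fix k' k \<theta> y l assume \<theta>: "\<theta> \<in> ord_maps k' k" and "(k, y, l) \<in> \<Gamma>'"
        then consider "(k, y, l) \<in> \<Gamma>" | \<phi> where "\<phi> \<in> ord_maps k n" "y = act X k n \<phi> x" "l = s k n \<phi> m"
          by (auto simp: \<Gamma>'_def)
        then show "(k', act X k' k \<theta> y, s k' k \<theta> l) \<in> \<Gamma>'"
        proof cases
          case 1
          then show ?thesis using \<Gamma>_s[OF \<theta>] by (auto simp: \<Gamma>'_def)
        next
          case (2 \<phi>)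
          have "act X k' k \<theta> y = act X k' n (compose {..k'} \<phi> \<theta>) x" "s k' k \<theta> l = s k' n (compose {..k'} \<phi> \<theta>) m"
            using X.act_compose[OF \<theta> 2(1) x] s_compose[OF \<theta> 2(1) mG] 2 by auto
          then show ?thesis using compose_ord_maps[OF \<theta> 2(1)] by (auto simp: \<Gamma>'_def)
        qed
      qed
      then have "\<Gamma>' = \<Gamma>" by (rule max) (auto simp: \<Gamma>'_def)
      moreover have "(n, act X n n (\<lambda>i\<in>{..n}. i) x, s n n (\<lambda>i\<in>{..n}. i) m) \<in> \<Gamma>'"
        using id_ord_maps by (auto simp: \<Gamma>'_def)
      ultimately show False using notin X.act_id[OF x] by metis
    qed
  qed
  define g where "g n x = (THE m. (n, x, m) \<in> \<Gamma>)" for n x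
  have g: "(n, x, g n x) \<in> \<Gamma>" if "x \<in> simplices X n" for n x
    using dom[OF that] \<Gamma>_fun unfolding g_def by (metis theI)
  show thesis
  proof (rule that)
    fix n x assume "x \<in> simplices X n"
    then show "g n x \<in> F n x" using g \<Gamma>_F by blast
  next
    fix m n \<theta> x assume \<theta>: "\<theta> \<in> ord_maps m n" and x: "x \<in> simplices X n"
    show "g m (act X m n \<theta> x) = s m n \<theta> (g n x)"
      using \<Gamma>_fun[OF g[OF X.act_closed[OF \<theta> x]] \<Gamma>_s[OF \<theta> g[OF x]]] .
  qed
qed

section \<open>Linear maps and products of modules\<close>

lemma module_abelian: "module R M \<Longrightarrow> abelian_group M"
  by (simp add: module_def)

context abelian_group
begin

lemma signed_closed: "x \<in> carrier G \<Longrightarrow> signed G n x \<in> carrier G"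
  by (simp add: signed_def)

lemma signed_zero: "signed G n \<zero> = \<zero>"
  by (simp add: signed_def)

lemma signed_add: "x \<in> carrier G \<Longrightarrow> y \<in> carrier G \<Longrightarrow> signed G n (x \<oplus> y) = signed G n x \<oplus> signed G n y"
  by (simp add: signed_def minus_add)

lemma signed_signed: "x \<in> carrier G \<Longrightarrow> signed G k (signed G l x) = signed G (k + l) x"
  by (auto simp: signed_def)

end

lemma (in abelian_group) minus_zeroD: "x \<in> carrier G \<Longrightarrow> y \<in> carrier G \<Longrightarrow> x \<ominus> y = \<zero> \<Longrightarrow> x = y"
  using minus_equality[of x "\<ominus> y"] by (simp add: minus_eq)

lemma (in abelian_group) minus_minus_plus:
  assumes "x \<in> carrier G" "y \<in> carrier G" "z \<in> carrier G"
  shows "x \<ominus> y \<ominus> z \<oplus> y = x \<ominus> z"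
proof -
  have "x \<ominus> y \<ominus> z \<oplus> y = (x \<oplus> \<ominus> z) \<oplus> (\<ominus> y \<oplus> y)" using assms by (simp add: minus_eq a_ac)
  then show ?thesis using assms by (simp add: minus_eq l_neg)
qed

text \<open>This is the bookkeeping of the Leibniz rule for the cup product: \<open>z\<close> is the
  term that the coboundaries of both factors produce, with opposite signs.\<close>

lemma (in abelian_group) signed_cancel:
  assumes "x \<in> carrier G" "y \<in> carrier G" "z \<in> carrier G"
  shows "x \<oplus> signed G (Suc a) y = signed G (Suc a) z \<oplus> x \<oplus> signed G a (z \<ominus> y)"
proof (cases "even a")
  case True
  have "\<ominus> z \<oplus> x \<oplus> (z \<oplus> \<ominus> y) = (\<ominus> z \<oplus> z) \<oplus> (x \<oplus> \<ominus> y)" using assms by (simp add: a_ac)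
  then show ?thesis using True assms by (simp add: signed_def minus_eq l_neg)
next
  case False
  have "z \<oplus> x \<oplus> (\<ominus> z \<oplus> y) = (\<ominus> z \<oplus> z) \<oplus> (x \<oplus> y)" using assms by (simp add: a_ac)
  then show ?thesis using False assms by (simp add: signed_def minus_eq minus_add l_neg)
qed

lemma signed_parity: "even k = even l \<Longrightarrow> signed M k x = signed M l x"
  by (simp add: signed_def)

lemma linear_mapsI:
  assumes "\<And>x. x \<in> carrier M \<Longrightarrow> f x \<in> carrier N"
    "\<And>x y. x \<in> carrier M \<Longrightarrow> y \<in> carrier M \<Longrightarrow> f (x \<oplus>\<^bsub>M\<^esub> y) = f x \<oplus>\<^bsub>N\<^esub> f y"
    "\<And>r x. r \<in> carrier R \<Longrightarrow> x \<in> carrier M \<Longrightarrow> f (r \<odot>\<^bsub>M\<^esub> x) = r \<odot>\<^bsub>N\<^esub> f x"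
  shows "f \<in> linear_maps R M N"
  using assms by (simp add: linear_maps_def)

lemma linear_closed: "f \<in> linear_maps R M N \<Longrightarrow> x \<in> carrier M \<Longrightarrow> f x \<in> carrier N"
  by (auto simp: linear_maps_def)

lemma linear_add: "f \<in> linear_maps R M N \<Longrightarrow> x \<in> carrier M \<Longrightarrow> y \<in> carrier M \<Longrightarrow>
    f (x \<oplus>\<^bsub>M\<^esub> y) = f x \<oplus>\<^bsub>N\<^esub> f y"
  by (auto simp: linear_maps_def)

lemma linear_smult: "f \<in> linear_maps R M N \<Longrightarrow> r \<in> carrier R \<Longrightarrow> x \<in> carrier M \<Longrightarrow>
    f (r \<odot>\<^bsub>M\<^esub> x) = r \<odot>\<^bsub>N\<^esub> f x"
  by (auto simp: linear_maps_def)

lemma linear_zero: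
  assumes "module R M" "module R N" "f \<in> linear_maps R M N"
  shows "f \<zero>\<^bsub>M\<^esub> = \<zero>\<^bsub>N\<^esub>"
proof -
  interpret M: module R M by fact
  interpret N: module R N by fact
  have "f \<zero>\<^bsub>M\<^esub> = f \<zero>\<^bsub>M\<^esub> \<oplus>\<^bsub>N\<^esub> f \<zero>\<^bsub>M\<^esub>"
    using linear_add[OF assms(3), of "\<zero>\<^bsub>M\<^esub>" "\<zero>\<^bsub>M\<^esub>"] by simp
  then show ?thesis using linear_closed[OF assms(3), of "\<zero>\<^bsub>M\<^esub>"] N.add.r_cancel_one' by auto
qed

lemma linear_uminus:
  assumes "module R M" "module R N" "f \<in> linear_maps R M N" "x \<in> carrier M"
  shows "f (\<ominus>\<^bsub>M\<^esub> x) = \<ominus>\<^bsub>N\<^esub> f x"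
proof -
  interpret M: module R M by fact
  interpret N: module R N by fact
  have "f (\<ominus>\<^bsub>M\<^esub> x) \<oplus>\<^bsub>N\<^esub> f x = \<zero>\<^bsub>N\<^esub>"
    using linear_add[OF assms(3), of "\<ominus>\<^bsub>M\<^esub> x" x] assms by (simp add: M.l_neg linear_zero)
  then show ?thesis using linear_closed[OF assms(3)] assms(4) by (simp add: N.minus_equality)
qed

lemma linear_minus:
  assumes "module R M" "module R N" "f \<in> linear_maps R M N" "x \<in> carrier M" "y \<in> carrier M"
  shows "f (x \<ominus>\<^bsub>M\<^esub> y) = f x \<ominus>\<^bsub>N\<^esub> f y"
proof -
  interpret M: module R M by fact
  show ?thesis using assms by (simp add: a_minus_def linear_add linear_uminus)
qed

lemma linear_signed:
  assumes "module R M" "module R N" "f \<in> linear_maps R M N" "x \<in> carrier M"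
  shows "f (signed M n x) = signed N n (f x)"
  using assms by (simp add: signed_def linear_uminus)

lemma linear_finsum:
  assumes "module R M" "module R N" "f \<in> linear_maps R M N" "finite A" "g \<in> A \<rightarrow> carrier M"
  shows "f (\<Oplus>\<^bsub>M\<^esub>a\<in>A. g a) = (\<Oplus>\<^bsub>N\<^esub>a\<in>A. f (g a))"
proof -
  interpret M: module R M by fact
  interpret N: module R N by fact
  show ?thesis using assms(4,5)
  proof (induction A rule: finite_induct)
    case empty
    show ?case using assms by (simp add: linear_zero)
  next
    case (insert a A)
    have "(\<lambda>a. f (g a)) \<in> A \<rightarrow> carrier N" using insert.prems linear_closed[OF assms(3)] by auto
    then show ?case using insert linear_closed[OF assms(3)] linear_add[OF assms(3)] by (simp add: Pi_def)
  qed
qed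

lemma linear_ident: "(\<lambda>x. x) \<in> linear_maps R M M"
  by (simp add: linear_maps_def)

lemma linear_comp:
  "f \<in> linear_maps R M N \<Longrightarrow> g \<in> linear_maps R N P \<Longrightarrow> (\<lambda>x. g (f x)) \<in> linear_maps R M P"
  by (auto simp: linear_maps_def Pi_iff)

lemma linear_const_zero:
  assumes "module R N" shows "(\<lambda>x. \<zero>\<^bsub>N\<^esub>) \<in> linear_maps R M N"
proof -
  interpret N: module R N by fact
  show ?thesis by (rule linear_mapsI) (auto simp: N.smult_r_null)
qed

lemma linear_if:
  "module R N \<Longrightarrow> (b \<Longrightarrow> f \<in> linear_maps R M N) \<Longrightarrow>
    (\<lambda>x. if b then f x else \<zero>\<^bsub>N\<^esub>) \<in> linear_maps R M N"
  by (cases b) (simp_all add: linear_const_zero)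

lemma linear_plus:
  assumes "module R N" and f: "f \<in> linear_maps R M N" and g: "g \<in> linear_maps R M N"
  shows "(\<lambda>x. f x \<oplus>\<^bsub>N\<^esub> g x) \<in> linear_maps R M N"
proof -
  interpret N: module R N by fact
  show ?thesis
    by (rule linear_mapsI)
      (auto simp: linear_add[OF f] linear_add[OF g] linear_smult[OF f] linear_smult[OF g]
        linear_closed[OF f] linear_closed[OF g] N.smult_r_distr N.add.m_ac)
qed

lemma linear_signedI:
  assumes "module R N" and f: "f \<in> linear_maps R M N"
  shows "(\<lambda>x. signed N n (f x)) \<in> linear_maps R M N"
proof -
  interpret N: module R N by fact
  show ?thesis
    by (rule linear_mapsI)
      (auto simp: signed_def linear_add[OF f] linear_smult[OF f]
        linear_closed[OF f] N.smult_r_minus N.minus_add)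
qed

lemma linear_sum:
  assumes "module R N" "finite A" "\<And>a. a \<in> A \<Longrightarrow> f a \<in> linear_maps R M N"
  shows "(\<lambda>x. \<Oplus>\<^bsub>N\<^esub>a\<in>A. f a x) \<in> linear_maps R M N"
proof -
  interpret N: module R N by fact
  note f = linear_closed[OF assms(3)] linear_add[OF assms(3)] linear_smult[OF assms(3)]
  show ?thesis
  proof (rule linear_mapsI)
    fix x assume "x \<in> carrier M"
    then show "(\<Oplus>\<^bsub>N\<^esub>a\<in>A. f a x) \<in> carrier N" using f by (intro N.finsum_closed) auto
  next
    fix x y assume xy: "x \<in> carrier M" "y \<in> carrier M"
    then have "(\<Oplus>\<^bsub>N\<^esub>a\<in>A. f a (x \<oplus>\<^bsub>M\<^esub> y)) = (\<Oplus>\<^bsub>N\<^esub>a\<in>A. f a x \<oplus>\<^bsub>N\<^esub> f a y)"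
      using f by (intro N.finsum_cong') auto
    then show "(\<Oplus>\<^bsub>N\<^esub>a\<in>A. f a (x \<oplus>\<^bsub>M\<^esub> y)) = (\<Oplus>\<^bsub>N\<^esub>a\<in>A. f a x) \<oplus>\<^bsub>N\<^esub> (\<Oplus>\<^bsub>N\<^esub>a\<in>A. f a y)"
      using xy f by (simp add: N.finsum_addf Pi_iff)
  next
    fix r x assume r: "r \<in> carrier R" "x \<in> carrier M"
    then have "(\<Oplus>\<^bsub>N\<^esub>a\<in>A. f a (r \<odot>\<^bsub>M\<^esub> x)) = (\<Oplus>\<^bsub>N\<^esub>a\<in>A. r \<odot>\<^bsub>N\<^esub> f a x)"
      using f by (intro N.finsum_cong') auto
    then show "(\<Oplus>\<^bsub>N\<^esub>a\<in>A. f a (r \<odot>\<^bsub>M\<^esub> x)) = r \<odot>\<^bsub>N\<^esub> (\<Oplus>\<^bsub>N\<^esub>a\<in>A. f a x)"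
      using r f assms(2) by (simp add: N.finsum_smult_ldistr Pi_iff)
  qed
qed

text \<open>With a constant family this is the module of cochains on a set; with a varying family it
  is the direct sum of the finitely many bidegrees of one total degree.\<close>

definition pi_module :: "'i set \<Rightarrow> ('i \<Rightarrow> ('r, 'a, 'n) module_scheme) \<Rightarrow> ('r, 'i \<Rightarrow> 'a) module"
  where "pi_module I M =
    \<lparr>carrier = (\<Pi>\<^sub>E i\<in>I. carrier (M i)), mult = undefined, one = undefined,
     zero = (\<lambda>i\<in>I. \<zero>\<^bsub>M i\<^esub>), add = (\<lambda>f g. \<lambda>i\<in>I. f i \<oplus>\<^bsub>M i\<^esub> g i),
     smult = (\<lambda>r f. \<lambda>i\<in>I. r \<odot>\<^bsub>M i\<^esub> f i)\<rparr>"

lemma pi_module_simps: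
  "carrier (pi_module I M) = (\<Pi>\<^sub>E i\<in>I. carrier (M i))"
  "\<zero>\<^bsub>pi_module I M\<^esub> = (\<lambda>i\<in>I. \<zero>\<^bsub>M i\<^esub>)"
  "f \<oplus>\<^bsub>pi_module I M\<^esub> g = (\<lambda>i\<in>I. f i \<oplus>\<^bsub>M i\<^esub> g i)"
  "r \<odot>\<^bsub>pi_module I M\<^esub> f = (\<lambda>i\<in>I. r \<odot>\<^bsub>M i\<^esub> f i)"
  by (simp_all add: pi_module_def)

lemma pi_module_eqI:
  assumes "f \<in> carrier (pi_module I M)" "g \<in> carrier (pi_module I M)" "\<And>i. i \<in> I \<Longrightarrow> f i = g i"
  shows "f = g"
  using assms by (auto simp: pi_module_simps intro: PiE_ext)

lemma module_pi_module:
  assumes R: "cring R" and M: "\<And>i. i \<in> I \<Longrightarrow> module R (M i)"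
  shows "module R (pi_module I M)"
proof (rule moduleI)
  interpret R: cring R by (rule R)
  note ax = M[THEN module.axioms(2)] 
  note gr = abelian_group.axioms(1)[OF ax]
  show "cring R" by (rule R)
  show "abelian_group (pi_module I M)"
  proof (rule abelian_groupI)
    fix f assume f: "f \<in> carrier (pi_module I M)"
    show "\<exists>g\<in>carrier (pi_module I M). g \<oplus>\<^bsub>pi_module I M\<^esub> f = \<zero>\<^bsub>pi_module I M\<^esub>"
      using f ax by (intro bexI[of _ "\<lambda>i\<in>I. \<ominus>\<^bsub>M i\<^esub> f i"])
        (auto simp: pi_module_simps fun_eq_iff PiE_iff abelian_group.l_neg abelian_group.a_inv_closed)
  qed (auto simp: pi_module_simps fun_eq_iff PiE_iff extensional_def abelian_monoid.a_closed[OF gr]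
      abelian_monoid.zero_closed[OF gr] abelian_monoid.a_assoc[OF gr] abelian_monoid.a_comm[OF gr]
      abelian_monoid.a_lcomm[OF gr] abelian_monoid.l_zero[OF gr] abelian_monoid.r_zero[OF gr])
qed (auto simp: pi_module_simps fun_eq_iff PiE_iff extensional_def M module.smult_closed[OF M]
   module.smult_l_distr[OF M] module.smult_r_distr[OF M] module.smult_assoc1[OF M] module.smult_one[OF M])

context
  fixes R :: "('r, 'm) ring_scheme" and I :: "'i set" and M :: "'i \<Rightarrow> ('r, 'a, 'n) module_scheme"
  assumes R: "cring R" and M: "\<And>i. i \<in> I \<Longrightarrow> module R (M i)"
begin

lemma linear_proj: "i \<in> I \<Longrightarrow> (\<lambda>f. f i) \<in> linear_maps R (pi_module I M) (M i)"
  by (rule linear_mapsI) (auto simp: pi_module_simps)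

lemma linear_into_pi:
  assumes F: "\<And>i. i \<in> I \<Longrightarrow> (\<lambda>x. F x i) \<in> linear_maps R N (M i)"
  shows "(\<lambda>x. \<lambda>i\<in>I. F x i) \<in> linear_maps R N (pi_module I M)"
  using linear_closed[OF F] linear_add[OF F] linear_smult[OF F]
  by (intro linear_mapsI) (auto simp: pi_module_simps fun_eq_iff)

lemma pi_uminus: "f \<in> carrier (pi_module I M) \<Longrightarrow> i \<in> I \<Longrightarrow> (\<ominus>\<^bsub>pi_module I M\<^esub> f) i = \<ominus>\<^bsub>M i\<^esub> f i"
  using linear_uminus[OF module_pi_module[OF R M] M linear_proj] by simp

lemma pi_signed: "f \<in> carrier (pi_module I M) \<Longrightarrow> i \<in> I \<Longrightarrow>
    (signed (pi_module I M) n f) i = signed (M i) n (f i)"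
  by (simp add: signed_def pi_uminus)

end

section \<open>Bigraded algebras and their total algebras\<close>

record ('r, 'k) bigraded =
  comp :: "nat \<Rightarrow> nat \<Rightarrow> ('r, 'k) module"
  del :: "nat \<Rightarrow> nat \<Rightarrow> 'k \<Rightarrow> 'k"
  der :: "nat \<Rightarrow> nat \<Rightarrow> 'k \<Rightarrow> 'k"
  cup :: "nat \<Rightarrow> nat \<Rightarrow> nat \<Rightarrow> nat \<Rightarrow> 'k \<Rightarrow> 'k \<Rightarrow> 'k"
  unit :: 'k

text \<open>The two differentials commute strictly, and each obeys a Leibniz rule with the sign of
  its own degree only. All mixed signs are left to the total algebra.\<close>

locale bigraded_algebra = cring R for R :: "('r, 'm) ring_scheme" (structure) +
  fixes K :: "('r, 'k, 'n) bigraded_scheme"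
  assumes comp_module: "module R (comp K a q)"
    and del_linear: "del K a q \<in> linear_maps R (comp K a q) (comp K (Suc a) q)"
    and der_linear: "der K a q \<in> linear_maps R (comp K a q) (comp K a (Suc q))"
    and del_del: "x \<in> carrier (comp K a q) \<Longrightarrow> del K (Suc a) q (del K a q x) = \<zero>\<^bsub>comp K (Suc (Suc a)) q\<^esub>"
    and der_der: "x \<in> carrier (comp K a q) \<Longrightarrow> der K a (Suc q) (der K a q x) = \<zero>\<^bsub>comp K a (Suc (Suc q))\<^esub>"
    and del_der: "x \<in> carrier (comp K a q) \<Longrightarrow> del K a (Suc q) (der K a q x) = der K (Suc a) q (del K a q x)"
    and cup_right: "x \<in> carrier (comp K a q) \<Longrightarrow>
      cup K a q b r x \<in> linear_maps R (comp K b r) (comp K (a + b) (q + r))"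
    and cup_left: "y \<in> carrier (comp K b r) \<Longrightarrow>
      (\<lambda>x. cup K a q b r x y) \<in> linear_maps R (comp K a q) (comp K (a + b) (q + r))"
    and cup_assoc: "x \<in> carrier (comp K a q) \<Longrightarrow> y \<in> carrier (comp K b r) \<Longrightarrow> z \<in> carrier (comp K c s) \<Longrightarrow>
      cup K (a + b) (q + r) c s (cup K a q b r x y) z = cup K a q (b + c) (r + s) x (cup K b r c s y z)"
    and unit_closed: "unit K \<in> carrier (comp K 0 0)"
    and cup_unit_left: "x \<in> carrier (comp K a q) \<Longrightarrow> cup K 0 0 a q (unit K) x = x"
    and cup_unit_right: "x \<in> carrier (comp K a q) \<Longrightarrow> cup K a q 0 0 x (unit K) = x"
    and del_cup: "x \<in> carrier (comp K a q) \<Longrightarrow> y \<in> carrier (comp K b r) \<Longrightarrow>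
      del K (a + b) (q + r) (cup K a q b r x y) = cup K (Suc a) q b r (del K a q x) y
        \<oplus>\<^bsub>comp K (Suc (a + b)) (q + r)\<^esub>
          signed (comp K (Suc (a + b)) (q + r)) a (cup K a q (Suc b) r x (del K b r y))"
    and der_cup: "x \<in> carrier (comp K a q) \<Longrightarrow> y \<in> carrier (comp K b r) \<Longrightarrow>
      der K (a + b) (q + r) (cup K a q b r x y) = cup K a (Suc q) b r (der K a q x) y
        \<oplus>\<^bsub>comp K (a + b) (Suc (q + r))\<^esub>
          signed (comp K (a + b) (Suc (q + r))) q (cup K a q b (Suc r) x (der K b r y))"

definition tot_module :: "('r, 'k, 'n) bigraded_scheme \<Rightarrow> nat \<Rightarrow> ('r, nat \<Rightarrow> 'k) module"
  where "tot_module K m = pi_module {..m} (\<lambda>a. comp K a (m - a))"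

text \<open>The sign (-1)^c on \<open>der\<close> turns commuting differentials into anticommuting
  ones. The edge components are special: no \<open>del\<close> arrives at c = 0 and no
  \<open>der\<close> at c = m + 1.\<close>

definition tot_diff :: "('r, 'k, 'n) bigraded_scheme \<Rightarrow> nat \<Rightarrow> (nat \<Rightarrow> 'k) \<Rightarrow> (nat \<Rightarrow> 'k)"
  where "tot_diff K m f = (\<lambda>c\<in>{..Suc m}.
    (if c = 0 then \<zero>\<^bsub>comp K c (Suc m - c)\<^esub> else del K (c - 1) (m - (c - 1)) (f (c - 1)))
      \<oplus>\<^bsub>comp K c (Suc m - c)\<^esub>
    (if c \<le> m then signed (comp K c (Suc m - c)) c (der K c (m - c) (f c)) else \<zero>\<^bsub>comp K c (Suc m - c)\<^esub>))"

text \<open>The sign is that of the tensor product of graded algebras: the factor of bidegree \<open>(a, m - a)\<close>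
  moves its second degree past the first degree \<open>c - a\<close> of the other factor.\<close>

definition tot_mult :: "('r, 'k, 'n) bigraded_scheme \<Rightarrow> nat \<Rightarrow> nat \<Rightarrow> (nat \<Rightarrow> 'k) \<Rightarrow> (nat \<Rightarrow> 'k) \<Rightarrow> (nat \<Rightarrow> 'k)"
  where "tot_mult K m n f g = (\<lambda>c\<in>{..m + n}. \<Oplus>\<^bsub>comp K c (m + n - c)\<^esub>a\<in>{..m}.
    if a \<le> c \<and> c \<le> a + n
    then signed (comp K c (m + n - c)) ((m - a) * (c - a)) (cup K a (m - a) (c - a) (n - (c - a)) (f a) (g (c - a)))
    else \<zero>\<^bsub>comp K c (m + n - c)\<^esub>)"

text \<open>The homogeneous elements, on which all identities of the total algebra are
  verified.\<close>

definition single :: "('r, 'k, 'n) bigraded_scheme \<Rightarrow> nat \<Rightarrow> nat \<Rightarrow> 'k \<Rightarrow> nat \<Rightarrow> 'k"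
  where "single K m a v = (\<lambda>c\<in>{..m}. if c = a then v else \<zero>\<^bsub>comp K c (m - c)\<^esub>)"

definition tot :: "('r, 'k, 'n) bigraded_scheme \<Rightarrow> ('r, nat \<Rightarrow> 'k) dga"
  where "tot K = \<lparr>gr = tot_module K, diff = tot_diff K, gmult = tot_mult K, gone = single K 0 0 (unit K)\<rparr>"

context bigraded_algebra
begin

lemma comp_group: "abelian_group (comp K a q)"
  by (rule module_abelian[OF comp_module])

lemma comp_simps [simp]:
  "x \<in> carrier (comp K a q) \<Longrightarrow> x \<oplus>\<^bsub>comp K a q\<^esub> \<zero>\<^bsub>comp K a q\<^esub> = x"
  "x \<in> carrier (comp K a q) \<Longrightarrow> \<zero>\<^bsub>comp K a q\<^esub> \<oplus>\<^bsub>comp K a q\<^esub> x = x"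
  "signed (comp K a q) n \<zero>\<^bsub>comp K a q\<^esub> = \<zero>\<^bsub>comp K a q\<^esub>"
  "\<zero>\<^bsub>comp K a q\<^esub> \<in> carrier (comp K a q)"
  "x \<in> carrier (comp K a q) \<Longrightarrow> signed (comp K a q) n x \<in> carrier (comp K a q)"
proof -
  interpret C: abelian_group "comp K a q" by (rule comp_group)
  show "x \<in> carrier (comp K a q) \<Longrightarrow> x \<oplus>\<^bsub>comp K a q\<^esub> \<zero>\<^bsub>comp K a q\<^esub> = x"
  "x \<in> carrier (comp K a q) \<Longrightarrow> \<zero>\<^bsub>comp K a q\<^esub> \<oplus>\<^bsub>comp K a q\<^esub> x = x"
  "signed (comp K a q) n \<zero>\<^bsub>comp K a q\<^esub> = \<zero>\<^bsub>comp K a q\<^esub>"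
  "\<zero>\<^bsub>comp K a q\<^esub> \<in> carrier (comp K a q)"
  "x \<in> carrier (comp K a q) \<Longrightarrow> signed (comp K a q) n x \<in> carrier (comp K a q)"
    by (simp_all add: C.signed_zero C.signed_closed)
qed

lemma tot_module_module: "module R (tot_module K m)"
  unfolding tot_module_def using comp_module is_cring by (rule module_pi_module[rotated])

lemma tot_group: "abelian_group (tot_module K m)"
  by (rule module_abelian[OF tot_module_module])

lemma tot_component: "f \<in> carrier (tot_module K m) \<Longrightarrow> a \<le> m \<Longrightarrow> f a \<in> carrier (comp K a (m - a))"
  by (auto simp: tot_module_def pi_module_simps)

lemma linear_component: "a \<le> m \<Longrightarrow> (\<lambda>f. f a) \<in> linear_maps R (tot_module K m) (comp K a (m - a))"
  unfolding tot_module_def using linear_proj[OF is_cring comp_module, of a "{..m}"] by simp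

lemma linear_into_tot:
  "(\<And>c. c \<le> m \<Longrightarrow> (\<lambda>x. F x c) \<in> linear_maps R N (comp K c (m - c))) \<Longrightarrow>
    (\<lambda>x. \<lambda>c\<in>{..m}. F x c) \<in> linear_maps R N (tot_module K m)"
  unfolding tot_module_def using is_cring comp_module by (intro linear_into_pi) auto

lemma linear_single:
  "m = a + q \<Longrightarrow> single K m a \<in> linear_maps R (comp K a q) (tot_module K m)"
  unfolding single_def
proof (rule linear_into_tot)
  fix c assume "m = a + q"
  then show "(\<lambda>v. if c = a then v else \<zero>\<^bsub>comp K c (m - c)\<^esub>) \<in> linear_maps R (comp K a q) (comp K c (m - c))"
    by (cases "c = a") (simp_all add: linear_ident linear_const_zero comp_module)
qed

lemma single_closed: "v \<in> carrier (comp K a q) \<Longrightarrow> m = a + q \<Longrightarrow> single K m a v \<in> carrier (tot_module K m)"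
  by (rule linear_closed[OF linear_single])

lemma single_add: "m = a + q \<Longrightarrow> v \<in> carrier (comp K a q) \<Longrightarrow> w \<in> carrier (comp K a q) \<Longrightarrow>
    single K m a (v \<oplus>\<^bsub>comp K a q\<^esub> w) = single K m a v \<oplus>\<^bsub>tot_module K m\<^esub> single K m a w"
  by (rule linear_add[OF linear_single])

lemma single_signed: "m = a + q \<Longrightarrow> v \<in> carrier (comp K a q) \<Longrightarrow>
    single K m a (signed (comp K a q) n v) = signed (tot_module K m) n (single K m a v)"
  by (rule linear_signed[OF comp_module tot_module_module linear_single])

lemma single_zero: "m = a + q \<Longrightarrow> single K m a \<zero>\<^bsub>comp K a q\<^esub> = \<zero>\<^bsub>tot_module K m\<^esub>"
  by (rule linear_zero[OF comp_module tot_module_module linear_single])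

lemma tot_eqI:
  "f \<in> carrier (tot_module K m) \<Longrightarrow> g \<in> carrier (tot_module K m) \<Longrightarrow> (\<And>a. a \<le> m \<Longrightarrow> f a = g a) \<Longrightarrow> f = g"
  unfolding tot_module_def by (rule pi_module_eqI) auto

lemma tot_add_component:
  "a \<le> m \<Longrightarrow> (f \<oplus>\<^bsub>tot_module K m\<^esub> g) a = f a \<oplus>\<^bsub>comp K a (m - a)\<^esub> g a"
  by (simp add: tot_module_def pi_module_simps)

lemma tot_zero_component: "a \<le> m \<Longrightarrow> \<zero>\<^bsub>tot_module K m\<^esub> a = \<zero>\<^bsub>comp K a (m - a)\<^esub>"
  by (simp add: tot_module_def pi_module_simps)

text \<open>A total degree has finitely many components, so every element is a finite sum of
  homogeneous ones.\<close>

lemma tot_induct [consumes 1, case_names zero add single]: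
  assumes f: "f \<in> carrier (tot_module K m)"
    and "P \<zero>\<^bsub>tot_module K m\<^esub>"
    and "\<And>f g. f \<in> carrier (tot_module K m) \<Longrightarrow> g \<in> carrier (tot_module K m) \<Longrightarrow> P f \<Longrightarrow> P g \<Longrightarrow>
      P (f \<oplus>\<^bsub>tot_module K m\<^esub> g)"
    and "\<And>a q v. m = a + q \<Longrightarrow> v \<in> carrier (comp K a q) \<Longrightarrow> P (single K m a v)"
  shows "P f"
proof -
  \<comment> \<open>The number k bounds the components that may be nonzero; the last of them is
    split off as a homogeneous summand.\<close>
  have "P f" if "f \<in> carrier (tot_module K m)" "\<And>a. k \<le> a \<Longrightarrow> a \<le> m \<Longrightarrow> f a = \<zero>\<^bsub>comp K a (m - a)\<^esub>" for k f
    using that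
  proof (induction k arbitrary: f)
    case 0
    have "f = \<zero>\<^bsub>tot_module K m\<^esub>"
      using 0 abelian_monoid.zero_closed[OF abelian_group.axioms(1)[OF tot_group]]
      by (intro tot_eqI) (auto simp: tot_zero_component)
    then show ?case using assms(2) by simp
  next
    case (Suc k)
    show ?case
    proof (cases "k \<le> m")
      case False
      then show ?thesis using Suc by auto
    next
      case True
      define g where "g = (\<lambda>a\<in>{..m}. if a = k then \<zero>\<^bsub>comp K a (m - a)\<^esub> else f a)"
      have fa: "f a \<in> carrier (comp K a (m - a))" if "a \<le> m" for a
        using tot_component[OF Suc.prems(1) that] .
      have g: "g \<in> carrier (tot_module K m)"
        using fa by (auto simp: g_def tot_module_def pi_module_simps)
      have g0: "g a = \<zero>\<^bsub>comp K a (m - a)\<^esub>" if "k \<le> a" "a \<le> m" for a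
        using that Suc.prems(2)[of a] by (auto simp: g_def)
      have s: "single K m k (f k) \<in> carrier (tot_module K m)"
        using True fa[OF True] by (intro single_closed[of _ _ "m - k"]) auto
      have "f = g \<oplus>\<^bsub>tot_module K m\<^esub> single K m k (f k)"
      proof (rule tot_eqI[OF Suc.prems(1)])
        show "g \<oplus>\<^bsub>tot_module K m\<^esub> single K m k (f k) \<in> carrier (tot_module K m)"
          by (rule abelian_monoid.a_closed[OF abelian_group.axioms(1)[OF tot_group] g s])
        fix a assume a: "a \<le> m"
        show "f a = (g \<oplus>\<^bsub>tot_module K m\<^esub> single K m k (f k)) a"
          using a fa[OF a] by (auto simp: tot_add_component g_def single_def)
      qed
      moreover have "P g" by (rule Suc.IH[OF g g0])
      moreover have "P (single K m k (f k))" using assms(4)[of k "m - k"] True fa[OF True] by simp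
      ultimately show ?thesis using assms(3)[OF g s] by simp
    qed
  qed
  from this[OF f, of "Suc m"] show ?thesis by simp
qed

text \<open>Applied to one variable at a time, this reduces every multilinear identity of the total
  algebra to homogeneous elements, where it becomes an identity of the bigraded algebra and of sign
  exponents.\<close>

lemma tot_linear_eqI:
  assumes f: "f \<in> carrier (tot_module K m)"
    and N: "module R N" and F: "F \<in> linear_maps R (tot_module K m) N" and G: "G \<in> linear_maps R (tot_module K m) N"
    and eq: "\<And>a q v. m = a + q \<Longrightarrow> v \<in> carrier (comp K a q) \<Longrightarrow> F (single K m a v) = G (single K m a v)"
  shows "F f = G f"
  using f
proof (induction rule: tot_induct)
  case zero
  then show ?case using linear_zero[OF tot_module_module N F] linear_zero[OF tot_module_module N G] by simp
next
  case (add f g)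
  then show ?case using linear_add[OF F] linear_add[OF G] by simp
qed (rule eq)

lemma tot_diff_linear: "tot_diff K m \<in> linear_maps R (tot_module K m) (tot_module K (Suc m))"
proof -
  have "(\<lambda>f. \<lambda>c\<in>{..Suc m}. (if c = 0 then \<zero>\<^bsub>comp K c (Suc m - c)\<^esub> else del K (c - 1) (m - (c - 1)) (f (c - 1)))
      \<oplus>\<^bsub>comp K c (Suc m - c)\<^esub>
    (if c \<le> m then signed (comp K c (Suc m - c)) c (der K c (m - c) (f c)) else \<zero>\<^bsub>comp K c (Suc m - c)\<^esub>))
    \<in> linear_maps R (tot_module K m) (tot_module K (Suc m))"
  proof (rule linear_into_tot)
    fix c assume c: "c \<le> Suc m"
    have 1: "(\<lambda>f. if c = 0 then \<zero>\<^bsub>comp K c (Suc m - c)\<^esub> else del K (c - 1) (m - (c - 1)) (f (c - 1)))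
        \<in> linear_maps R (tot_module K m) (comp K c (Suc m - c))"
    proof (cases c)
      case 0
      then show ?thesis by (simp add: linear_const_zero comp_module)
    next
      case (Suc b)
      then show ?thesis using c linear_comp[OF linear_component del_linear, of b m] by simp
    qed
    have 2: "(\<lambda>f. if c \<le> m then signed (comp K c (Suc m - c)) c (der K c (m - c) (f c)) else \<zero>\<^bsub>comp K c (Suc m - c)\<^esub>)
        \<in> linear_maps R (tot_module K m) (comp K c (Suc m - c))"
      using linear_signedI[OF comp_module linear_comp[OF linear_component der_linear, of c m], of c]
      by (cases "c \<le> m") (simp_all add: Suc_diff_le linear_const_zero comp_module)
    show "(\<lambda>f. (if c = 0 then \<zero>\<^bsub>comp K c (Suc m - c)\<^esub> else del K (c - 1) (m - (c - 1)) (f (c - 1)))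
      \<oplus>\<^bsub>comp K c (Suc m - c)\<^esub>
    (if c \<le> m then signed (comp K c (Suc m - c)) c (der K c (m - c) (f c)) else \<zero>\<^bsub>comp K c (Suc m - c)\<^esub>))
      \<in> linear_maps R (tot_module K m) (comp K c (Suc m - c))"
      by (rule linear_plus[OF comp_module 1 2])
  qed
  then show ?thesis by (simp add: tot_diff_def[abs_def])
qed

lemma tot_diff_single:
  assumes v: "v \<in> carrier (comp K a q)" and m: "m = a + q"
  shows "tot_diff K m (single K m a v) = single K (Suc m) (Suc a) (del K a q v)
    \<oplus>\<^bsub>tot_module K (Suc m)\<^esub> signed (tot_module K (Suc m)) a (single K (Suc m) a (der K a q v))"
    (is "?l = ?r")
proof -
  have dv: "del K a q v \<in> carrier (comp K (Suc a) q)" "der K a q v \<in> carrier (comp K a (Suc q))"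
    using linear_closed[OF del_linear v] linear_closed[OF der_linear v] by auto
  interpret T: abelian_group "tot_module K (Suc m)" by (rule tot_group)
  have s: "single K (Suc m) (Suc a) (del K a q v) \<in> carrier (tot_module K (Suc m))"
      "single K (Suc m) a (signed (comp K a (Suc q)) a (der K a q v)) \<in> carrier (tot_module K (Suc m))"
    using dv m by (auto intro!: single_closed)
  have "?l = single K (Suc m) (Suc a) (del K a q v)
      \<oplus>\<^bsub>tot_module K (Suc m)\<^esub> single K (Suc m) a (signed (comp K a (Suc q)) a (der K a q v))"
  proof (rule tot_eqI)
    show "?l \<in> carrier (tot_module K (Suc m))"
      by (rule linear_closed[OF tot_diff_linear single_closed[OF v m]])
    fix c assume c: "c \<le> Suc m"
    have del0: "del K b (m - b) \<zero>\<^bsub>comp K b (m - b)\<^esub> = \<zero>\<^bsub>comp K (Suc b) (m - b)\<^esub>" for b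
      by (rule linear_zero[OF comp_module comp_module del_linear])
    have der0: "der K b (m - b) \<zero>\<^bsub>comp K b (m - b)\<^esub> = \<zero>\<^bsub>comp K b (Suc m - b)\<^esub>" if "b \<le> m" for b
      using linear_zero[OF comp_module comp_module der_linear, of b "m - b"] that by (simp add: Suc_diff_le)
    show "?l c = (single K (Suc m) (Suc a) (del K a q v)
      \<oplus>\<^bsub>tot_module K (Suc m)\<^esub> single K (Suc m) a (signed (comp K a (Suc q)) a (der K a q v))) c"
      using c dv m del0[of "c - 1"] der0[of c]
      by (cases c) (auto simp: tot_add_component tot_diff_def single_def Suc_diff_le)
  qed (use s in auto)
  then show ?thesis using single_signed[of "Suc m" a "Suc q"] dv m by simp
qed

lemma tot_mult_term_left:
  assumes g: "g \<in> carrier (tot_module K n)" and a: "a \<le> m" "a \<le> c" "c \<le> a + n"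
  shows "(\<lambda>f. signed (comp K c (m + n - c)) k (cup K a (m - a) (c - a) (n - (c - a)) (f a) (g (c - a))))
    \<in> linear_maps R (tot_module K m) (comp K c (m + n - c))"
proof (rule linear_signedI[OF comp_module])
  have gc: "g (c - a) \<in> carrier (comp K (c - a) (n - (c - a)))" using tot_component[OF g, of "c - a"] a by auto
  have "a + (c - a) = c" "m - a + (n - (c - a)) = m + n - c" using a by auto
  then show "(\<lambda>f. cup K a (m - a) (c - a) (n - (c - a)) (f a) (g (c - a)))
      \<in> linear_maps R (tot_module K m) (comp K c (m + n - c))"
    using linear_comp[OF linear_component cup_left[OF gc], of a m] a by simp
qed

lemma tot_mult_term_right:
  assumes f: "f \<in> carrier (tot_module K m)" and a: "a \<le> m" "a \<le> c" "c \<le> a + n"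
  shows "(\<lambda>g. signed (comp K c (m + n - c)) k (cup K a (m - a) (c - a) (n - (c - a)) (f a) (g (c - a))))
    \<in> linear_maps R (tot_module K n) (comp K c (m + n - c))"
proof (rule linear_signedI[OF comp_module])
  have fc: "f a \<in> carrier (comp K a (m - a))" using tot_component[OF f, of a] a by auto
  have "a + (c - a) = c" "m - a + (n - (c - a)) = m + n - c" "c - a \<le> n" using a by auto
  then show "(\<lambda>g. cup K a (m - a) (c - a) (n - (c - a)) (f a) (g (c - a)))
      \<in> linear_maps R (tot_module K n) (comp K c (m + n - c))"
    using linear_comp[OF linear_component cup_right[OF fc], of "c - a" n] a by simp
qed

lemma tot_mult_left:
  assumes g: "g \<in> carrier (tot_module K n)"
  shows "(\<lambda>f. tot_mult K m n f g) \<in> linear_maps R (tot_module K m) (tot_module K (m + n))"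
  unfolding tot_mult_def
proof (rule linear_into_tot, rule linear_sum[OF comp_module])
  fix c a assume a: "a \<in> {..m}"
  show "(\<lambda>f. if a \<le> c \<and> c \<le> a + n
      then signed (comp K c (m + n - c)) ((m - a) * (c - a)) (cup K a (m - a) (c - a) (n - (c - a)) (f a) (g (c - a)))
      else \<zero>\<^bsub>comp K c (m + n - c)\<^esub>) \<in> linear_maps R (tot_module K m) (comp K c (m + n - c))"
    using tot_mult_term_left[OF g] a by (intro linear_if comp_module) auto
qed simp

lemma tot_mult_right:
  assumes f: "f \<in> carrier (tot_module K m)"
  shows "tot_mult K m n f \<in> linear_maps R (tot_module K n) (tot_module K (m + n))"
proof -
  have "(\<lambda>g. tot_mult K m n f g) \<in> linear_maps R (tot_module K n) (tot_module K (m + n))"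
    unfolding tot_mult_def
  proof (rule linear_into_tot, rule linear_sum[OF comp_module])
    fix c a assume a: "a \<in> {..m}"
    show "(\<lambda>g. if a \<le> c \<and> c \<le> a + n
      then signed (comp K c (m + n - c)) ((m - a) * (c - a)) (cup K a (m - a) (c - a) (n - (c - a)) (f a) (g (c - a)))
      else \<zero>\<^bsub>comp K c (m + n - c)\<^esub>) \<in> linear_maps R (tot_module K n) (comp K c (m + n - c))"
      using tot_mult_term_right[OF f] a by (intro linear_if comp_module) auto
  qed simp
  then show ?thesis by simp
qed

text \<open>Bidegrees add, so only component a + b can be nonzero, and in its sum only the summand
  of index a. The sign moves the second degree q of the left factor past the first degree b of the
  right factor.\<close>

lemma tot_mult_single:
  assumes v: "v \<in> carrier (comp K a q)" and w: "w \<in> carrier (comp K b r)" and m: "m = a + q" and n: "n = b + r"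
  shows "tot_mult K m n (single K m a v) (single K n b w) =
    single K (m + n) (a + b) (signed (comp K (a + b) (q + r)) (q * b) (cup K a q b r v w))" (is "?l = ?r")
proof (rule tot_eqI)
  have vw: "cup K a q b r v w \<in> carrier (comp K (a + b) (q + r))"
    by (rule linear_closed[OF cup_right[OF v] w])
  show "?l \<in> carrier (tot_module K (m + n))"
    by (rule linear_closed[OF tot_mult_right]) (use v w m n in \<open>auto intro: single_closed\<close>)
  show "?r \<in> carrier (tot_module K (m + n))"
    by (rule single_closed) (use vw m n in auto)
  fix c assume c: "c \<le> m + n"
  interpret C: abelian_group "comp K c (m + n - c)" by (rule comp_group)
  \<comment> \<open>The value of the only summand that can survive, extended by zero to the other
    components so that one formula covers all c.\<close>
  define t where "t = (if c = a + b then signed (comp K (a + b) (q + r)) (q * b) (cup K a q b r v w)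
    else \<zero>\<^bsub>comp K c (m + n - c)\<^esub>)"
  have t: "t \<in> carrier (comp K c (m + n - c))" using vw by (auto simp: t_def m n)
  have zero_left: "cup K a' q' b' r' \<zero>\<^bsub>comp K a' q'\<^esub> y = \<zero>\<^bsub>comp K (a' + b') (q' + r')\<^esub>"
    if "y \<in> carrier (comp K b' r')" for a' q' b' r' y
    by (rule linear_zero[OF comp_module comp_module cup_left[OF that]])
  have zero_right: "cup K a' q' b' r' x \<zero>\<^bsub>comp K b' r'\<^esub> = \<zero>\<^bsub>comp K (a' + b') (q' + r')\<^esub>"
    if "x \<in> carrier (comp K a' q')" for a' q' b' r' x
    by (rule linear_zero[OF comp_module comp_module cup_right[OF that]])
  have "(if i \<le> c \<and> c \<le> i + n
      then signed (comp K c (m + n - c)) ((m - i) * (c - i))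
        (cup K i (m - i) (c - i) (n - (c - i)) (single K m a v i) (single K n b w (c - i)))
      else \<zero>\<^bsub>comp K c (m + n - c)\<^esub>) = (if a = i then t else \<zero>\<^bsub>comp K c (m + n - c)\<^esub>)"
    if i: "i \<le> m" for i
  proof (cases "i \<le> c \<and> c \<le> i + n")
    case True
    have e: "i + (c - i) = c" "m - i + (n - (c - i)) = m + n - c" "c - i \<le> n" using True i by auto
    have cl: "single K m a v i \<in> carrier (comp K i (m - i))"
      "single K n b w (c - i) \<in> carrier (comp K (c - i) (n - (c - i)))"
      using tot_component[OF single_closed[OF v m] i] tot_component[OF single_closed[OF w n] e(3)] by auto
    show ?thesis
    proof (cases "i = a \<and> c - i = b")
      case t: True
      then have "c = a + b" using True by auto
      then show ?thesis using t by (simp add: t_def single_def m n)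
    next
      case F: False
      have "cup K i (m - i) (c - i) (n - (c - i)) (single K m a v i) (single K n b w (c - i)) =
          \<zero>\<^bsub>comp K c (m + n - c)\<^esub>"
      proof (cases "i = a")
        case True
        then have "single K n b w (c - i) = \<zero>\<^bsub>comp K (c - i) (n - (c - i))\<^esub>"
          using F e by (auto simp: single_def)
        then show ?thesis using zero_right[OF cl(1), of "c - i" "n - (c - i)"] e by simp
      next
        case False
        then have "single K m a v i = \<zero>\<^bsub>comp K i (m - i)\<^esub>"
          using i by (auto simp: single_def)
        then show ?thesis using zero_left[OF cl(2), of i "m - i"] e by simp
      qed
      moreover have "(if a = i then t else \<zero>\<^bsub>comp K c (m + n - c)\<^esub>) = \<zero>\<^bsub>comp K c (m + n - c)\<^esub>"
        using F by (auto simp: t_def)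
      ultimately show ?thesis by (simp only: True simp_thms if_True comp_simps)
    qed
  next
    case False
    moreover have "c \<noteq> i + b" using False n by auto
    ultimately show ?thesis by (auto simp: t_def)
  qed
  then have "?l c = (\<Oplus>\<^bsub>comp K c (m + n - c)\<^esub>i\<in>{..m}. if a = i then t else \<zero>\<^bsub>comp K c (m + n - c)\<^esub>)"
    using c t by (auto simp: tot_mult_def intro!: C.finsum_cong')
  also have "\<dots> = t"
    using C.finsum_singleton[of a "{..m}" "\<lambda>_. t"] t m by simp
  also have "t = ?r c" using c by (simp add: t_def single_def)
  finally show "?l c = ?r c" .
qed

text \<open>By linearity only homogeneous elements matter. Associativity then compares the exponents
  (q + r) c + q b and q (b + c) + r c, which are equal; the Leibniz rule compares exponents that
  agree modulo 2.\<close>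

theorem dg_algebra_tot: "dg_algebra R (tot K)"
proof (intro dg_algebra.intro cochain_complex.intro cochain_complex_axioms.intro dg_algebra_axioms.intro)
  fix q
  show "cring R" by (rule is_cring)
  show "module R (gr (tot K) q)" by (simp add: tot_def tot_module_module)
  show "diff (tot K) q \<in> linear_maps R (gr (tot K) q) (gr (tot K) (Suc q))"
    by (simp add: tot_def tot_diff_linear)
  show "gone (tot K) \<in> carrier (gr (tot K) 0)"
    by (simp add: tot_def single_closed[OF unit_closed])
next
  fix x m assume "x \<in> carrier (gr (tot K) m)"
  then have x: "x \<in> carrier (tot_module K m)" by (simp add: tot_def)
  let ?Z = "\<zero>\<^bsub>tot_module K (Suc (Suc m))\<^esub>"
  interpret T: abelian_group "tot_module K (Suc (Suc m))" by (rule tot_group)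
  have "tot_diff K (Suc m) (tot_diff K m x) = (\<lambda>_. ?Z) x"
  proof (rule tot_linear_eqI[OF x tot_module_module linear_comp[OF tot_diff_linear tot_diff_linear]
        linear_const_zero[OF tot_module_module]])
    fix a q v assume m: "m = a + q" and v: "v \<in> carrier (comp K a q)"
    have dv: "del K a q v \<in> carrier (comp K (Suc a) q)" "der K a q v \<in> carrier (comp K a (Suc q))"
      "der K (Suc a) q (del K a q v) \<in> carrier (comp K (Suc a) (Suc q))"
      using linear_closed[OF del_linear v] linear_closed[OF der_linear v]
       linear_closed[OF der_linear linear_closed[OF del_linear v]] by auto
    \<comment> \<open>The mixed term. It arrives through \<open>del\<close> first with exponent a +
      1 and through \<open>der\<close> first with exponent a, so the two occurrences cancel.\<close>
    let ?S = "\<lambda>k. signed (tot_module K (Suc (Suc m))) k (single K (Suc (Suc m)) (Suc a) (der K (Suc a) q (del K a q v)))"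
    have s: "single K (Suc m) (Suc a) (del K a q v) \<in> carrier (tot_module K (Suc m))"
      "single K (Suc m) a (der K a q v) \<in> carrier (tot_module K (Suc m))"
      using m dv by (auto intro: single_closed)
    have S: "?S k \<in> carrier (tot_module K (Suc (Suc m)))" for k
      using m dv by (intro T.signed_closed single_closed) auto
    have "tot_diff K (Suc m) (tot_diff K m (single K m a v)) =
      tot_diff K (Suc m) (single K (Suc m) (Suc a) (del K a q v)) \<oplus>\<^bsub>tot_module K (Suc (Suc m))\<^esub>
      signed (tot_module K (Suc (Suc m))) a (tot_diff K (Suc m) (single K (Suc m) a (der K a q v)))"
      using s by (simp add: tot_diff_single[OF v m] linear_add[OF tot_diff_linear]
          linear_signed[OF tot_module_module tot_module_module tot_diff_linear]
          abelian_group.signed_closed[OF tot_group])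
    also have "tot_diff K (Suc m) (single K (Suc m) (Suc a) (del K a q v)) = ?Z \<oplus>\<^bsub>tot_module K (Suc (Suc m))\<^esub> ?S (Suc a)"
      using m by (simp add: tot_diff_single[OF dv(1)] del_del[OF v] single_zero[of _ _ q])
    also have "tot_diff K (Suc m) (single K (Suc m) a (der K a q v)) = ?S 0 \<oplus>\<^bsub>tot_module K (Suc (Suc m))\<^esub> ?Z"
    proof -
      have "single K (Suc (Suc m)) a \<zero>\<^bsub>comp K a (Suc (Suc q))\<^esub> = ?Z" by (rule single_zero) (simp add: m)
      moreover have "signed (tot_module K (Suc (Suc m))) 0 y = y" for y by (simp add: signed_def)
      moreover have "Suc m = a + Suc q" by (simp add: m)
      note tot_diff_single[OF dv(2) this]
      ultimately show ?thesis by (simp only: der_der[OF v] del_der[OF v] T.signed_zero)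
    qed
    also have "?Z \<oplus>\<^bsub>tot_module K (Suc (Suc m))\<^esub> ?S (Suc a) \<oplus>\<^bsub>tot_module K (Suc (Suc m))\<^esub>
      signed (tot_module K (Suc (Suc m))) a (?S 0 \<oplus>\<^bsub>tot_module K (Suc (Suc m))\<^esub> ?Z) = ?Z"
      using S[of 0] by (auto simp: signed_def T.l_neg T.r_neg)
    finally show "tot_diff K (Suc m) (tot_diff K m (single K m a v)) = ?Z" .
  qed
  then show "diff (tot K) (Suc m) (diff (tot K) m x) = \<zero>\<^bsub>gr (tot K) (Suc (Suc m))\<^esub>" by (simp add: tot_def)
next
  fix x m n assume "x \<in> carrier (gr (tot K) m)"
  then show "gmult (tot K) m n x \<in> linear_maps R (gr (tot K) n) (gr (tot K) (m + n))"
    by (simp add: tot_def tot_mult_right)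
next
  fix y m n assume "y \<in> carrier (gr (tot K) n)"
  then show "(\<lambda>x. gmult (tot K) m n x y) \<in> linear_maps R (gr (tot K) m) (gr (tot K) (m + n))"
    by (simp add: tot_def tot_mult_left)
next
  fix x m assume "x \<in> carrier (gr (tot K) m)"
  then have x: "x \<in> carrier (tot_module K m)" by (simp add: tot_def)
  have o: "single K 0 0 (unit K) \<in> carrier (tot_module K 0)" by (auto intro!: single_closed unit_closed)
  have "tot_mult K 0 m (single K 0 0 (unit K)) x = (\<lambda>x. x) x"
  proof (rule tot_linear_eqI[OF x tot_module_module _ linear_ident])
    show "tot_mult K 0 m (single K 0 0 (unit K)) \<in> linear_maps R (tot_module K m) (tot_module K m)"
      using tot_mult_right[OF o, of m] by simp
    fix a q v assume "m = a + q" "v \<in> carrier (comp K a q)"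
    then show "tot_mult K 0 m (single K 0 0 (unit K)) (single K m a v) = single K m a v"
      using tot_mult_single[OF unit_closed, of v a q 0 m] by (simp add: cup_unit_left signed_def)
  qed
  then show "gmult (tot K) 0 m (gone (tot K)) x = x" by (simp add: tot_def)
  have "(\<lambda>x. tot_mult K m 0 x (single K 0 0 (unit K))) x = (\<lambda>x. x) x"
  proof (rule tot_linear_eqI[OF x tot_module_module _ linear_ident])
    show "(\<lambda>x. tot_mult K m 0 x (single K 0 0 (unit K))) \<in> linear_maps R (tot_module K m) (tot_module K m)"
      using tot_mult_left[OF o, of m] by simp
    fix a q v assume "m = a + q" "v \<in> carrier (comp K a q)"
    then show "tot_mult K m 0 (single K m a v) (single K 0 0 (unit K)) = single K m a v"
      using tot_mult_single[OF _ unit_closed, of v a q m 0] by (simp add: cup_unit_right signed_def)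
  qed
  then show "gmult (tot K) m 0 x (gone (tot K)) = x" by (simp add: tot_def)
next
  fix x y z m n l
  assume "x \<in> carrier (gr (tot K) m)" "y \<in> carrier (gr (tot K) n)" "z \<in> carrier (gr (tot K) l)"
  then have x: "x \<in> carrier (tot_module K m)" and y: "y \<in> carrier (tot_module K n)" and z: "z \<in> carrier (tot_module K l)"
    by (simp_all add: tot_def)
  have mult_closed: "tot_mult K m n x y \<in> carrier (tot_module K (m + n))"
    if "x \<in> carrier (tot_module K m)" "y \<in> carrier (tot_module K n)" for x y m n
    using linear_closed[OF tot_mult_right] that by blast
  have singles: "tot_mult K (m + n) l (tot_mult K m n (single K m a u) (single K n b v)) (single K l c w) =
      tot_mult K m (n + l) (single K m a u) (tot_mult K n l (single K n b v) (single K l c w))"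
    if mnl: "m = a + q" "n = b + r" "l = c + s"
      and u: "u \<in> carrier (comp K a q)" and v: "v \<in> carrier (comp K b r)" and w: "w \<in> carrier (comp K c s)"
    for a b c q r s u v w
  proof -
    have uv: "cup K a q b r u v \<in> carrier (comp K (a + b) (q + r))"
      and vw: "cup K b r c s v w \<in> carrier (comp K (b + c) (r + s))"
      using linear_closed[OF cup_right] u v w by blast+
    let ?C = "comp K (a + b + c) (q + r + s)"
    interpret C: abelian_group ?C by (rule comp_group)
    let ?x = "cup K a q (b + c) (r + s) u (cup K b r c s v w)"
    have xc: "?x \<in> carrier ?C" using linear_closed[OF cup_right[OF u] vw] by (simp add: add.assoc)
    have 1: "cup K (a + b) (q + r) c s (signed (comp K (a + b) (q + r)) (q * b) (cup K a q b r u v)) w = signed ?C (q * b) ?x"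
      using linear_signed[OF comp_module comp_module cup_left[OF w] uv] cup_assoc[OF u v w] by simp
    have 2: "cup K a q (b + c) (r + s) u (signed (comp K (b + c) (r + s)) (r * c) (cup K b r c s v w)) = signed ?C (r * c) ?x"
      using linear_signed[OF comp_module comp_module cup_right[OF u] vw] by (simp add: add.assoc)
    have "tot_mult K (m + n) l (tot_mult K m n (single K m a u) (single K n b v)) (single K l c w) =
      single K (m + n + l) (a + b + c) (signed ?C ((q + r) * c) (signed ?C (q * b) ?x))"
      using uv w mnl tot_mult_single[OF u v mnl(1,2)]
        tot_mult_single[of "signed (comp K (a + b) (q + r)) (q * b) (cup K a q b r u v)" "a + b" "q + r" w c s "m + n" l]
      by (simp add: 1)
    moreover have "tot_mult K m (n + l) (single K m a u) (tot_mult K n l (single K n b v) (single K l c w)) =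
      single K (m + n + l) (a + b + c) (signed ?C (q * (b + c)) (signed ?C (r * c) ?x))"
      using u vw mnl tot_mult_single[OF v w mnl(2,3)]
        tot_mult_single[of u a q "signed (comp K (b + c) (r + s)) (r * c) (cup K b r c s v w)" "b + c" "r + s" m "n + l"]
      by (simp add: 2) (simp add: add.assoc)
    moreover have "signed ?C ((q + r) * c) (signed ?C (q * b) ?x) = signed ?C (q * (b + c)) (signed ?C (r * c) ?x)"
      unfolding C.signed_signed[OF xc] by (simp add: algebra_simps)
    ultimately show ?thesis by simp
  qed
  have single_single: "tot_mult K (m + n) l (tot_mult K m n (single K m a u) (single K n b v)) z =
      tot_mult K m (n + l) (single K m a u) (tot_mult K n l (single K n b v) z)"
    if mn: "m = a + q" "n = b + r" and u: "u \<in> carrier (comp K a q)" and v: "v \<in> carrier (comp K b r)" for a b q r u v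
  proof (rule tot_linear_eqI[OF z tot_module_module])
    have su: "single K m a u \<in> carrier (tot_module K m)" and sv: "single K n b v \<in> carrier (tot_module K n)"
      using single_closed u v mn by auto
    show "tot_mult K (m + n) l (tot_mult K m n (single K m a u) (single K n b v))
      \<in> linear_maps R (tot_module K l) (tot_module K (m + n + l))"
      by (rule tot_mult_right[OF mult_closed[OF su sv]])
    show "(\<lambda>z. tot_mult K m (n + l) (single K m a u) (tot_mult K n l (single K n b v) z))
      \<in> linear_maps R (tot_module K l) (tot_module K (m + n + l))"
      unfolding add.assoc by (rule linear_comp[OF tot_mult_right[OF sv] tot_mult_right[OF su]])
  qed (rule singles[OF mn _ u v])
  have single_left: "tot_mult K (m + n) l (tot_mult K m n (single K m a u) y) z =
      tot_mult K m (n + l) (single K m a u) (tot_mult K n l y z)"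
    if m: "m = a + q" and u: "u \<in> carrier (comp K a q)" for a q u
  proof -
    have su: "single K m a u \<in> carrier (tot_module K m)" using single_closed u m by auto
    have "(\<lambda>y. tot_mult K (m + n) l (tot_mult K m n (single K m a u) y) z) y =
        (\<lambda>y. tot_mult K m (n + l) (single K m a u) (tot_mult K n l y z)) y"
    proof (rule tot_linear_eqI[OF y tot_module_module])
      show "(\<lambda>y. tot_mult K (m + n) l (tot_mult K m n (single K m a u) y) z)
        \<in> linear_maps R (tot_module K n) (tot_module K (m + n + l))"
        by (rule linear_comp[OF tot_mult_right[OF su] tot_mult_left[OF z]])
      show "(\<lambda>y. tot_mult K m (n + l) (single K m a u) (tot_mult K n l y z))
        \<in> linear_maps R (tot_module K n) (tot_module K (m + n + l))"
        unfolding add.assoc by (rule linear_comp[OF tot_mult_left[OF z] tot_mult_right[OF su]])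
    qed (rule single_single[OF m _ u])
    then show ?thesis .
  qed
  have "(\<lambda>x. tot_mult K (m + n) l (tot_mult K m n x y) z) x = (\<lambda>x. tot_mult K m (n + l) x (tot_mult K n l y z)) x"
  proof (rule tot_linear_eqI[OF x tot_module_module])
    show "(\<lambda>x. tot_mult K (m + n) l (tot_mult K m n x y) z) \<in> linear_maps R (tot_module K m) (tot_module K (m + n + l))"
      by (rule linear_comp[OF tot_mult_left[OF y] tot_mult_left[OF z]])
    show "(\<lambda>x. tot_mult K m (n + l) x (tot_mult K n l y z)) \<in> linear_maps R (tot_module K m) (tot_module K (m + n + l))"
      unfolding add.assoc by (rule tot_mult_left[OF mult_closed[OF y z]])
  qed (rule single_left)
  then show "gmult (tot K) (m + n) l (gmult (tot K) m n x y) z = gmult (tot K) m (n + l) x (gmult (tot K) n l y z)"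
    by (simp add: tot_def)
next
  fix x y m n
  assume "x \<in> carrier (gr (tot K) m)" "y \<in> carrier (gr (tot K) n)"
  then have x: "x \<in> carrier (tot_module K m)" and y: "y \<in> carrier (tot_module K n)" by (simp_all add: tot_def)
  let ?T = "tot_module K (Suc (m + n))"
  interpret T: abelian_group ?T by (rule tot_group)
  \<comment> \<open>Both sides consist of four terms: either factor is differentiated, either by
    \<open>del\<close> or by \<open>der\<close>. The terms \<open>A1\<close> to \<open>A4\<close>
    name them without sign, and only their exponents remain to be compared.\<close>
  have singles: "tot_diff K (m + n) (tot_mult K m n (single K m a v) (single K n b w)) =
      tot_mult K (Suc m) n (tot_diff K m (single K m a v)) (single K n b w)
      \<oplus>\<^bsub>?T\<^esub> signed ?T m (tot_mult K m (Suc n) (single K m a v) (tot_diff K n (single K n b w)))"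
    if m: "m = a + q" and n: "n = b + r" and v: "v \<in> carrier (comp K a q)" and w: "w \<in> carrier (comp K b r)"
    for a b q r v w
  proof -
    define A1 where "A1 = cup K (Suc a) q b r (del K a q v) w"
    define A2 where "A2 = cup K a q (Suc b) r v (del K b r w)"
    define A3 where "A3 = cup K a (Suc q) b r (der K a q v) w"
    define A4 where "A4 = cup K a q b (Suc r) v (der K b r w)"
    define S0 where "S0 = single K (Suc (m + n)) (a + b)"
    define S1 where "S1 = single K (Suc (m + n)) (Suc (a + b))"
    let ?C0 = "comp K (a + b) (Suc (q + r))" and ?C1 = "comp K (Suc (a + b)) (q + r)"
    have dv: "del K a q v \<in> carrier (comp K (Suc a) q)" "der K a q v \<in> carrier (comp K a (Suc q))"
      and dw: "del K b r w \<in> carrier (comp K (Suc b) r)" "der K b r w \<in> carrier (comp K b (Suc r))"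
      using linear_closed[OF del_linear] linear_closed[OF der_linear] v w by auto
    have vw: "cup K a q b r v w \<in> carrier (comp K (a + b) (q + r))" using linear_closed[OF cup_right[OF v] w] .
    have A: "A1 \<in> carrier ?C1" "A2 \<in> carrier ?C1" "A3 \<in> carrier ?C0" "A4 \<in> carrier ?C0"
      using linear_closed[OF cup_right[OF dv(1)] w] linear_closed[OF cup_right[OF dv(2)] w]
        linear_closed[OF cup_right[OF v] dw(1)] linear_closed[OF cup_right[OF v] dw(2)]
      by (simp_all add: A1_def A2_def A3_def A4_def)
    have lin: "S0 \<in> linear_maps R ?C0 ?T" "S1 \<in> linear_maps R ?C1 ?T"
      unfolding S0_def S1_def using m n by (auto intro!: linear_single)
    note S = linear_add[OF lin(1)] linear_add[OF lin(2)]
      linear_signed[OF comp_module tot_module_module lin(1)] linear_signed[OF comp_module tot_module_module lin(2)]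
      linear_closed[OF lin(1)] linear_closed[OF lin(2)]
    interpret C0: abelian_group ?C0 by (rule comp_group)
    interpret C1: abelian_group ?C1 by (rule comp_group)
    have "tot_diff K (m + n) (tot_mult K m n (single K m a v) (single K n b w)) =
      S1 (del K (a + b) (q + r) (signed (comp K (a + b) (q + r)) (q * b) (cup K a q b r v w))) \<oplus>\<^bsub>?T\<^esub>
      signed ?T (a + b) (S0 (der K (a + b) (q + r) (signed (comp K (a + b) (q + r)) (q * b) (cup K a q b r v w))))"
      unfolding tot_mult_single[OF v w m n] S0_def S1_def
      by (rule tot_diff_single) (use m n vw in auto)
    also have "\<dots> = S1 (signed ?C1 (q * b) (A1 \<oplus>\<^bsub>?C1\<^esub> signed ?C1 a A2)) \<oplus>\<^bsub>?T\<^esub>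
       signed ?T (a + b) (S0 (signed ?C0 (q * b) (A3 \<oplus>\<^bsub>?C0\<^esub> signed ?C0 q A4)))"
      using linear_signed[OF comp_module comp_module del_linear vw, of "q * b"]
        linear_signed[OF comp_module comp_module der_linear vw, of "q * b"]
      by (simp add: del_cup[OF v w] der_cup[OF v w] A1_def A2_def A3_def A4_def)
    also have "\<dots> = (signed ?T (q * b) (S1 A1) \<oplus>\<^bsub>?T\<^esub> signed ?T (q * b + a) (S1 A2)) \<oplus>\<^bsub>?T\<^esub>
       (signed ?T (a + b + q * b) (S0 A3) \<oplus>\<^bsub>?T\<^esub> signed ?T (a + b + q * b + q) (S0 A4))"
      using A by (simp add: S T.signed_add T.signed_signed T.signed_closed C0.signed_closed C1.signed_closed add.assoc)
    finally have lhs: "tot_diff K (m + n) (tot_mult K m n (single K m a v) (single K n b w)) = \<dots>" .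
    have sv: "single K m a v \<in> carrier (tot_module K m)" and sw: "single K n b w \<in> carrier (tot_module K n)"
      using v w m n single_closed by auto
    have sdv: "single K (Suc m) (Suc a) (del K a q v) \<in> carrier (tot_module K (Suc m))"
      "single K (Suc m) a (der K a q v) \<in> carrier (tot_module K (Suc m))"
      using dv m by (auto intro: single_closed)
    have sdw: "single K (Suc n) (Suc b) (del K b r w) \<in> carrier (tot_module K (Suc n))"
      "single K (Suc n) b (der K b r w) \<in> carrier (tot_module K (Suc n))"
      using dw n by (auto intro: single_closed)
    have "tot_mult K (Suc m) n (tot_diff K m (single K m a v)) (single K n b w) =
      tot_mult K (Suc m) n (single K (Suc m) (Suc a) (del K a q v)) (single K n b w) \<oplus>\<^bsub>?T\<^esub>
      signed ?T a (tot_mult K (Suc m) n (single K (Suc m) a (der K a q v)) (single K n b w))"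
      using linear_add[OF tot_mult_left[OF sw] sdv(1) abelian_group.signed_closed[OF tot_group sdv(2), of a]]
        linear_signed[OF tot_module_module tot_module_module tot_mult_left[OF sw] sdv(2), of a]
      by (simp add: tot_diff_single[OF v m])
    also have "tot_mult K (Suc m) n (single K (Suc m) (Suc a) (del K a q v)) (single K n b w) = S1 (signed ?C1 (q * b) A1)"
      using tot_mult_single[OF dv(1) w, of "Suc m" n] m n by (simp add: S1_def A1_def)
    also have "tot_mult K (Suc m) n (single K (Suc m) a (der K a q v)) (single K n b w) = S0 (signed ?C0 (Suc q * b) A3)"
      using tot_mult_single[OF dv(2) w, of "Suc m" n] m n by (simp add: S0_def A3_def)
    finally have rhs1: "tot_mult K (Suc m) n (tot_diff K m (single K m a v)) (single K n b w) =
      signed ?T (q * b) (S1 A1) \<oplus>\<^bsub>?T\<^esub> signed ?T (a + Suc q * b) (S0 A3)"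
      using A by (simp only: S T.signed_signed)
    have "tot_mult K m (Suc n) (single K m a v) (tot_diff K n (single K n b w)) =
      tot_mult K m (Suc n) (single K m a v) (single K (Suc n) (Suc b) (del K b r w)) \<oplus>\<^bsub>?T\<^esub>
      signed ?T b (tot_mult K m (Suc n) (single K m a v) (single K (Suc n) b (der K b r w)))"
      using linear_add[OF tot_mult_right[OF sv] sdw(1) abelian_group.signed_closed[OF tot_group sdw(2), of b]]
        linear_signed[OF tot_module_module tot_module_module tot_mult_right[OF sv] sdw(2), of b]
      by (simp add: tot_diff_single[OF w n])
    also have "tot_mult K m (Suc n) (single K m a v) (single K (Suc n) (Suc b) (del K b r w)) = S1 (signed ?C1 (q * Suc b) A2)"
      using tot_mult_single[OF v dw(1), of m "Suc n"] m n by (simp add: S1_def A2_def)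
    also have "tot_mult K m (Suc n) (single K m a v) (single K (Suc n) b (der K b r w)) = S0 (signed ?C0 (q * b) A4)"
      using tot_mult_single[OF v dw(2), of m "Suc n"] m n by (simp add: S0_def A4_def)
    finally have "signed ?T m (tot_mult K m (Suc n) (single K m a v) (tot_diff K n (single K n b w))) =
      signed ?T (m + q * Suc b) (S1 A2) \<oplus>\<^bsub>?T\<^esub> signed ?T (m + (b + q * b)) (S0 A4)"
      using A by (simp only: S T.signed_signed T.signed_add T.signed_closed)
    \<comment> \<open>Here m = a + q, so the two exponents differ by 2 q.\<close>
    also have "signed ?T (m + q * Suc b) (S1 A2) = signed ?T (q * b + a) (S1 A2)"
      by (rule signed_parity) (auto simp: m)
    also have "signed ?T (m + (b + q * b)) (S0 A4) = signed ?T (a + b + q * b + q) (S0 A4)"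
      by (rule arg_cong[of _ _ "\<lambda>k. signed ?T k (S0 A4)"]) (simp add: m)
    finally have rhs2: "signed ?T m (tot_mult K m (Suc n) (single K m a v) (tot_diff K n (single K n b w))) =
      signed ?T (q * b + a) (S1 A2) \<oplus>\<^bsub>?T\<^esub> signed ?T (a + b + q * b + q) (S0 A4)" .
    have e: "a + Suc q * b = a + b + q * b" by simp
    show ?thesis
      unfolding lhs rhs1 rhs2 e using A by (simp add: S T.signed_closed T.a_ac)
  qed
  have single_left: "tot_diff K (m + n) (tot_mult K m n (single K m a v) y) =
      tot_mult K (Suc m) n (tot_diff K m (single K m a v)) y
      \<oplus>\<^bsub>?T\<^esub> signed ?T m (tot_mult K m (Suc n) (single K m a v) (tot_diff K n y))"
    if m: "m = a + q" and v: "v \<in> carrier (comp K a q)" for a q v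
  proof (rule tot_linear_eqI[OF y tot_module_module[of "Suc (m + n)"]])
    have sv: "single K m a v \<in> carrier (tot_module K m)" using v m single_closed by auto
    show "(\<lambda>y. tot_diff K (m + n) (tot_mult K m n (single K m a v) y)) \<in> linear_maps R (tot_module K n) ?T"
      by (rule linear_comp[OF tot_mult_right[OF sv] tot_diff_linear])
    show "(\<lambda>y. tot_mult K (Suc m) n (tot_diff K m (single K m a v)) y
      \<oplus>\<^bsub>?T\<^esub> signed ?T m (tot_mult K m (Suc n) (single K m a v) (tot_diff K n y))) \<in> linear_maps R (tot_module K n) ?T"
      using tot_mult_right[OF linear_closed[OF tot_diff_linear sv], of n]
        linear_comp[OF tot_diff_linear tot_mult_right[OF sv], of n]
      by (intro linear_plus linear_signedI tot_module_module) auto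
  qed (rule singles[OF m _ v])
  have "(\<lambda>x. tot_diff K (m + n) (tot_mult K m n x y)) x = (\<lambda>x. tot_mult K (Suc m) n (tot_diff K m x) y
      \<oplus>\<^bsub>?T\<^esub> signed ?T m (tot_mult K m (Suc n) x (tot_diff K n y))) x"
  proof (rule tot_linear_eqI[OF x tot_module_module[of "Suc (m + n)"]])
    show "(\<lambda>x. tot_diff K (m + n) (tot_mult K m n x y)) \<in> linear_maps R (tot_module K m) ?T"
      by (rule linear_comp[OF tot_mult_left[OF y] tot_diff_linear])
    show "(\<lambda>x. tot_mult K (Suc m) n (tot_diff K m x) y
      \<oplus>\<^bsub>?T\<^esub> signed ?T m (tot_mult K m (Suc n) x (tot_diff K n y))) \<in> linear_maps R (tot_module K m) ?T"
      using linear_comp[OF tot_diff_linear tot_mult_left[OF y], of m]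
        tot_mult_left[OF linear_closed[OF tot_diff_linear y], of m]
      by (intro linear_plus linear_signedI tot_module_module) auto
  qed (rule single_left)
  then show "diff (tot K) (m + n) (gmult (tot K) m n x y) = gmult (tot K) (Suc m) n (diff (tot K) m x) y
      \<oplus>\<^bsub>gr (tot K) (Suc (m + n))\<^esub> signed (gr (tot K) (Suc (m + n))) m (gmult (tot K) m (Suc n) x (diff (tot K) n y))"
    by (simp add: tot_def)
qed

end

locale bigraded_hom = K: bigraded_algebra R K + L: bigraded_algebra R L
  for R :: "('r, 'm) ring_scheme" and K :: "('r, 'k, 'n) bigraded_scheme" and L :: "('r, 'l, 'o) bigraded_scheme" +
  fixes f :: "nat \<Rightarrow> nat \<Rightarrow> 'k \<Rightarrow> 'l"
  assumes f_linear: "f a q \<in> linear_maps R (comp K a q) (comp L a q)"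
    and f_del: "x \<in> carrier (comp K a q) \<Longrightarrow> f (Suc a) q (del K a q x) = del L a q (f a q x)"
    and f_der: "x \<in> carrier (comp K a q) \<Longrightarrow> f a (Suc q) (der K a q x) = der L a q (f a q x)"
    and f_cup: "x \<in> carrier (comp K a q) \<Longrightarrow> y \<in> carrier (comp K b r) \<Longrightarrow>
      f (a + b) (q + r) (cup K a q b r x y) = cup L a q b r (f a q x) (f b r y)"
    and f_unit: "f 0 0 (unit K) = unit L"

definition tot_map :: "(nat \<Rightarrow> nat \<Rightarrow> 'k \<Rightarrow> 'l) \<Rightarrow> nat \<Rightarrow> (nat \<Rightarrow> 'k) \<Rightarrow> (nat \<Rightarrow> 'l)"
  where "tot_map f m F = (\<lambda>a\<in>{..m}. f a (m - a) (F a))"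

context bigraded_hom
begin

lemma tot_map_linear: "tot_map f m \<in> linear_maps R (tot_module K m) (tot_module L m)"
  unfolding tot_map_def[abs_def]
  by (rule L.linear_into_tot, rule linear_comp[OF K.linear_component f_linear])

lemma tot_map_single:
  assumes "m = a + q"
  shows "tot_map f m (single K m a v) = single L m a (f a q v)"
  using assms linear_zero[OF K.comp_module L.comp_module f_linear]
  by (auto simp: tot_map_def single_def fun_eq_iff)

theorem dga_hom_tot_map: "dga_hom R (tot K) (tot L) (tot_map f)"
  unfolding dga_hom_def cochain_map_def
proof (intro conjI allI ballI)
  show "dg_algebra R (tot K)" "dg_algebra R (tot L)" by (rule K.dg_algebra_tot L.dg_algebra_tot)+
  show "tot_map f m \<in> linear_maps R (gr (tot K) m) (gr (tot L) m)" for m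
    by (simp add: tot_def tot_map_linear)
  show "tot_map f 0 (gone (tot K)) = gone (tot L)"
    by (simp add: tot_def tot_map_single[of 0 0 0] f_unit)
next
  fix m x assume "x \<in> carrier (gr (tot K) m)"
  then have x: "x \<in> carrier (tot_module K m)" by (simp add: tot_def)
  have "(\<lambda>x. tot_map f (Suc m) (tot_diff K m x)) x = (\<lambda>x. tot_diff L m (tot_map f m x)) x"
  proof (rule K.tot_linear_eqI[OF x L.tot_module_module linear_comp[OF K.tot_diff_linear tot_map_linear]
        linear_comp[OF tot_map_linear L.tot_diff_linear]])
    fix a q v assume m: "m = a + q" and v: "v \<in> carrier (comp K a q)"
    have s: "single K (Suc m) (Suc a) (del K a q v) \<in> carrier (tot_module K (Suc m))"
      "single K (Suc m) a (der K a q v) \<in> carrier (tot_module K (Suc m))"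
      using m linear_closed[OF K.del_linear v] linear_closed[OF K.der_linear v] by (auto intro!: K.single_closed)
    have e: "Suc m = Suc a + q" "Suc m = a + Suc q" using m by auto
    show "tot_map f (Suc m) (tot_diff K m (single K m a v)) = tot_diff L m (tot_map f m (single K m a v))"
      unfolding K.tot_diff_single[OF v m] tot_map_single[OF m] L.tot_diff_single[OF linear_closed[OF f_linear v] m]
        linear_add[OF tot_map_linear s(1) abelian_group.signed_closed[OF K.tot_group s(2)]]
        linear_signed[OF K.tot_module_module L.tot_module_module tot_map_linear s(2)]
        tot_map_single[OF e(1)] tot_map_single[OF e(2)] f_del[OF v] f_der[OF v] ..
  qed
  then show "tot_map f (Suc m) (diff (tot K) m x) = diff (tot L) m (tot_map f m x)" by (simp add: tot_def)
next
  fix m n x y assume "x \<in> carrier (gr (tot K) m)" "y \<in> carrier (gr (tot K) n)"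
  then have x: "x \<in> carrier (tot_module K m)" and y: "y \<in> carrier (tot_module K n)" by (simp_all add: tot_def)
  note cl = linear_closed[OF tot_map_linear]
  have singles: "tot_map f (m + n) (tot_mult K m n (single K m a v) (single K n b w)) =
      tot_mult L m n (tot_map f m (single K m a v)) (tot_map f n (single K n b w))"
    if m: "m = a + q" and n: "n = b + r" and v: "v \<in> carrier (comp K a q)" and w: "w \<in> carrier (comp K b r)"
    for a b q r v w
  proof -
    have e: "m + n = (a + b) + (q + r)" using m n by simp
    have vw: "cup K a q b r v w \<in> carrier (comp K (a + b) (q + r))" using linear_closed[OF K.cup_right[OF v] w] .
    show ?thesis
      unfolding K.tot_mult_single[OF v w m n] tot_map_single[OF m] tot_map_single[OF n] tot_map_single[OF e]
        L.tot_mult_single[OF linear_closed[OF f_linear v] linear_closed[OF f_linear w] m n]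
        linear_signed[OF K.comp_module L.comp_module f_linear vw] f_cup[OF v w] ..
  qed
  have single_left: "tot_map f (m + n) (tot_mult K m n (single K m a v) y) =
      tot_mult L m n (tot_map f m (single K m a v)) (tot_map f n y)"
    if m: "m = a + q" and v: "v \<in> carrier (comp K a q)" for a q v
  proof (rule K.tot_linear_eqI[OF y L.tot_module_module])
    have sv: "single K m a v \<in> carrier (tot_module K m)" using K.single_closed v m by auto
    show "(\<lambda>y. tot_map f (m + n) (tot_mult K m n (single K m a v) y)) \<in> linear_maps R (tot_module K n) (tot_module L (m + n))"
      by (rule linear_comp[OF K.tot_mult_right[OF sv] tot_map_linear])
    show "(\<lambda>y. tot_mult L m n (tot_map f m (single K m a v)) (tot_map f n y))
      \<in> linear_maps R (tot_module K n) (tot_module L (m + n))"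
      by (rule linear_comp[OF tot_map_linear L.tot_mult_right[OF cl[OF sv]]])
  qed (rule singles[OF m _ v])
  have "(\<lambda>x. tot_map f (m + n) (tot_mult K m n x y)) x = (\<lambda>x. tot_mult L m n (tot_map f m x) (tot_map f n y)) x"
    by (rule K.tot_linear_eqI[OF x L.tot_module_module linear_comp[OF K.tot_mult_left[OF y] tot_map_linear]
        linear_comp[OF tot_map_linear L.tot_mult_left[OF cl[OF y]]] single_left])
  then show "tot_map f (m + n) (gmult (tot K) m n x y) = gmult (tot L) m n (tot_map f m x) (tot_map f n y)"
    by (simp add: tot_def)
qed

end

section \<open>Alternating sums\<close>

definition altsum :: "('a, 'm) ring_scheme \<Rightarrow> nat \<Rightarrow> (nat \<Rightarrow> 'a) \<Rightarrow> 'a"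
  where "altsum G n g = (\<Oplus>\<^bsub>G\<^esub>i\<in>{..n}. signed G i (g i))"

context abelian_group
begin

lemma signed_Suc: "x \<in> carrier G \<Longrightarrow> signed G (Suc n) x = \<ominus> signed G n x"
  by (simp add: signed_def)

lemma altsum_closed: "(\<And>i. i \<le> n \<Longrightarrow> g i \<in> carrier G) \<Longrightarrow> altsum G n g \<in> carrier G"
  unfolding altsum_def by (rule finsum_closed) (auto intro: signed_closed)

lemma altsum_cong:
  "(\<And>i. i \<le> n \<Longrightarrow> g i \<in> carrier G) \<Longrightarrow> (\<And>i. i \<le> n \<Longrightarrow> f i = g i) \<Longrightarrow> altsum G n f = altsum G n g"
  unfolding altsum_def by (rule finsum_cong') (auto intro: signed_closed)

lemma altsum_0: "g 0 \<in> carrier G \<Longrightarrow> altsum G 0 g = g 0"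
  by (simp add: altsum_def signed_def)

lemma altsum_last:
  "(\<And>i. i \<le> Suc n \<Longrightarrow> g i \<in> carrier G) \<Longrightarrow> altsum G (Suc n) g = signed G (Suc n) (g (Suc n)) \<oplus> altsum G n g"
  unfolding altsum_def by (subst finsum_Suc) (auto intro: signed_closed)

lemma altsum_add:
  "(\<And>i. i \<le> n \<Longrightarrow> f i \<in> carrier G) \<Longrightarrow> (\<And>i. i \<le> n \<Longrightarrow> g i \<in> carrier G) \<Longrightarrow>
    altsum G n (\<lambda>i. f i \<oplus> g i) = altsum G n f \<oplus> altsum G n g"
proof (induction n)
  case 0
  then show ?case by (simp add: altsum_0)
next
  case (Suc n)
  then show ?case by (simp add: altsum_last altsum_closed signed_add signed_closed a_ac)
qed

text \<open>The second block starts at index a + 1, which accounts for its sign. In the coboundary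
  of a cup product the blocks are the faces that alter the front factor and those that alter the
  back factor.\<close>

lemma altsum_split:
  "(\<And>i. i \<le> Suc (a + b) \<Longrightarrow> g i \<in> carrier G) \<Longrightarrow>
    altsum G (Suc (a + b)) g = altsum G a g \<oplus> signed G (Suc a) (altsum G b (\<lambda>j. g (Suc (a + j))))"
proof (induction b)
  case 0
  then show ?case by (simp add: altsum_0 altsum_last altsum_closed signed_closed a_comm)
next
  case (Suc b)
  have g: "g i \<in> carrier G" if "i \<le> Suc (Suc (a + b))" for i using Suc.prems that by simp
  have "altsum G (Suc (a + Suc b)) g = signed G (Suc (Suc (a + b))) (g (Suc (Suc (a + b)))) \<oplus>
      (altsum G a g \<oplus> signed G (Suc a) (altsum G b (\<lambda>j. g (Suc (a + j)))))"
    using Suc.IH g by (simp add: altsum_last)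
  also have "\<dots> = altsum G a g \<oplus> signed G (Suc a) (altsum G (Suc b) (\<lambda>j. g (Suc (a + j))))"
    using g by (simp add: altsum_last altsum_closed signed_add signed_closed signed_signed a_lcomm)
  finally show ?case .
qed

lemma altsum_first:
  assumes "\<And>i. i \<le> Suc n \<Longrightarrow> g i \<in> carrier G"
  shows "altsum G (Suc n) g = g 0 \<ominus> altsum G n (\<lambda>i. g (Suc i))"
  using altsum_split[of 0 n g] assms by (simp add: altsum_0 signed_Suc altsum_closed signed_def[of _ 0] minus_eq)

text \<open>The combinatorial core of \<delta>\<delta> = 0: entries (i, j) and (j + 1, i) are equal
  and carry opposite signs. Removing row 0 and column 0, which the symmetry identifies with each
  other, leaves an array of the same kind and one size smaller.\<close>

lemma altsum_altsum:
  "(\<And>i j. i \<le> Suc n \<Longrightarrow> j \<le> n \<Longrightarrow> t i j \<in> carrier G) \<Longrightarrow> (\<And>i j. i \<le> j \<Longrightarrow> j \<le> n \<Longrightarrow> t i j = t (Suc j) i) \<Longrightarrow>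
    altsum G (Suc n) (\<lambda>i. altsum G n (t i)) = \<zero>"
proof (induction n arbitrary: t)
  case 0
  then show ?case using "0.prems"(2)[of 0 0] by (simp add: altsum_first altsum_0 minus_eq r_neg)
next
  case (Suc n)
  note t = Suc.prems(1)
  have 1: "altsum G (Suc n) (\<lambda>i. t (Suc i) 0) = altsum G (Suc n) (t 0)"
    using t Suc.prems(2)[of 0] by (intro altsum_cong) auto
  have 2: "altsum G (Suc n) (\<lambda>i. altsum G n (\<lambda>j. t (Suc i) (Suc j))) = \<zero>"
    using t Suc.prems(2) by (intro Suc.IH) auto
  have "altsum G (Suc n) (t 0) = altsum G (Suc n) (\<lambda>i. altsum G (Suc n) (t (Suc i)) \<oplus> altsum G n (\<lambda>j. t (Suc i) (Suc j)))"
    unfolding 1[symmetric] using t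
    by (intro altsum_cong) (auto simp: altsum_first altsum_closed minus_eq a_assoc l_neg intro!: a_closed a_inv_closed altsum_closed)
  also have "\<dots> = altsum G (Suc n) (\<lambda>i. altsum G (Suc n) (t (Suc i)))"
    using t by (subst altsum_add) (auto simp: 2 altsum_closed)
  finally show ?case
    using t by (simp add: altsum_first[of "Suc n"] altsum_closed minus_eq r_neg)
qed

end

lemma linear_altsum_eq:
  assumes M: "module R M" "module R N" and f: "f \<in> linear_maps R M N" and g: "\<And>i. i \<le> n \<Longrightarrow> g i \<in> carrier M"
  shows "f (altsum M n g) = altsum N n (\<lambda>i. f (g i))"
proof -
  interpret M: module R M by fact
  interpret N: module R N by fact
  have "f (altsum M n g) = (\<Oplus>\<^bsub>N\<^esub>i\<in>{..n}. f (signed M i (g i)))"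
    unfolding altsum_def using g by (intro linear_finsum[OF M f]) (auto intro: M.signed_closed)
  also have "\<dots> = altsum N n (\<lambda>i. f (g i))"
    unfolding altsum_def using g
    by (intro N.finsum_cong') (auto simp: linear_signed[OF M f] intro!: N.signed_closed linear_closed[OF f])
  finally show ?thesis .
qed

lemma linear_altsum:
  assumes "module R N" "\<And>i. i \<le> n \<Longrightarrow> f i \<in> linear_maps R M N"
  shows "(\<lambda>x. altsum N n (\<lambda>i. f i x)) \<in> linear_maps R M N"
  unfolding altsum_def using assms by (intro linear_sum linear_signedI) auto

lemma (in module) altsum_smult:
  assumes v: "v \<in> carrier M" and g: "\<And>i. i \<le> n \<Longrightarrow> g i \<in> carrier R"
  shows "altsum R n g \<odot>\<^bsub>M\<^esub> v = altsum M n (\<lambda>i. g i \<odot>\<^bsub>M\<^esub> v)"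
proof -
  have signed_smult: "signed R i r \<odot>\<^bsub>M\<^esub> v = signed M i (r \<odot>\<^bsub>M\<^esub> v)" if "r \<in> carrier R" for i r
    using that v by (simp add: signed_def smult_l_minus)
  show ?thesis
    using g
  proof (induction n)
    case 0
    then show ?case using v by (simp add: R.altsum_0 M.altsum_0)
  next
    case (Suc n)
    then show ?case
      using v by (simp add: R.altsum_last M.altsum_last R.altsum_closed R.signed_closed smult_l_distr signed_smult)
  qed
qed

section \<open>Cochains on a standard simplex with coefficients\<close>

definition front_map :: "nat \<Rightarrow> nat \<Rightarrow> nat"
  where "front_map a = (\<lambda>j\<in>{..a}. j)"

definition back_map :: "nat \<Rightarrow> nat \<Rightarrow> nat \<Rightarrow> nat"
  where "back_map a b = (\<lambda>j\<in>{..b}. a + j)"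

lemma front_map_ord_maps: "front_map a \<in> ord_maps a (a + b)"
  by (rule ord_mapsI) (auto simp: front_map_def)

lemma back_map_ord_maps: "back_map a b \<in> ord_maps b (a + b)"
  by (rule ord_mapsI) (auto simp: back_map_def)

text \<open>Cochains are functions on all monotone maps, degenerate ones included; this matches the
  unnormalized cochains of X and lets a cone over any simplex be formed. The product is the
  Alexander-Whitney product with values multiplied in \<open>D\<close>, without a sign, because the
  total algebra supplies it.\<close>

definition simplex_cochains :: "('r, 'a, 'o) dga_scheme \<Rightarrow> nat \<Rightarrow> ('r, (nat \<Rightarrow> nat) \<Rightarrow> 'a) bigraded"
  where "simplex_cochains D n =
    \<lparr>comp = (\<lambda>a q. pi_module (ord_maps a n) (\<lambda>_. gr D q)),
     del = (\<lambda>a q f. \<lambda>\<theta>\<in>ord_maps (Suc a) n. altsum (gr D q) (Suc a) (\<lambda>i. f (compose {..a} \<theta> (coface a i)))),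
     der = (\<lambda>a q f. \<lambda>\<theta>\<in>ord_maps a n. diff D q (f \<theta>)),
     cup = (\<lambda>a q b r f g. \<lambda>\<theta>\<in>ord_maps (a + b) n.
       gmult D q r (f (compose {..a} \<theta> (front_map a))) (g (compose {..b} \<theta> (back_map a b)))),
     unit = (\<lambda>\<theta>\<in>ord_maps 0 n. gone D)\<rparr>"

lemma simplex_cochains_simps:
  "comp (simplex_cochains D n) a q = pi_module (ord_maps a n) (\<lambda>_. gr D q)"
  "del (simplex_cochains D n) a q f =
    (\<lambda>\<theta>\<in>ord_maps (Suc a) n. altsum (gr D q) (Suc a) (\<lambda>i. f (compose {..a} \<theta> (coface a i))))"
  "der (simplex_cochains D n) a q f = (\<lambda>\<theta>\<in>ord_maps a n. diff D q (f \<theta>))"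
  "cup (simplex_cochains D n) a q b r f g = (\<lambda>\<theta>\<in>ord_maps (a + b) n.
    gmult D q r (f (compose {..a} \<theta> (front_map a))) (g (compose {..b} \<theta> (back_map a b))))"
  "unit (simplex_cochains D n) = (\<lambda>\<theta>\<in>ord_maps 0 n. gone D)"
  by (simp_all add: simplex_cochains_def)

lemma compose_coface_ord_maps: "\<theta> \<in> ord_maps (Suc a) n \<Longrightarrow> compose {..a} \<theta> (coface a i) \<in> ord_maps a n"
  by (rule compose_ord_maps[OF coface_ord_maps])

lemma compose_front_map: "\<theta> \<in> ord_maps (a + b) n \<Longrightarrow> compose {..a} \<theta> (front_map a) \<in> ord_maps a n"
  by (rule compose_ord_maps[OF front_map_ord_maps])

lemma compose_back_map: "\<theta> \<in> ord_maps (a + b) n \<Longrightarrow> compose {..b} \<theta> (back_map a b) \<in> ord_maps b n"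
  by (rule compose_ord_maps[OF back_map_ord_maps])

text \<open>This and the next five identities sort the faces of a product simplex. Faces up to a
  change only the front part, later ones only the back part; the last face of the longer front part
  and the first face of the longer back part lead to the same pair.\<close>

lemma front_coface_low: "i \<le> a \<Longrightarrow> compose {..a} (compose {..a + b} \<theta> (coface (a + b) i)) (front_map a) =
    compose {..a} (compose {..Suc a} \<theta> (front_map (Suc a))) (coface a i)"
  by (auto simp: compose_def front_map_def coface_def fun_eq_iff)

lemma back_coface_low: "i \<le> a \<Longrightarrow> compose {..b} (compose {..a + b} \<theta> (coface (a + b) i)) (back_map a b) =
    compose {..b} \<theta> (back_map (Suc a) b)"
  by (auto simp: compose_def back_map_def coface_def fun_eq_iff)

lemma front_coface_high: "compose {..a} (compose {..a + b} \<theta> (coface (a + b) (Suc (a + i)))) (front_map a) =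
    compose {..a} \<theta> (front_map a)"
  by (auto simp: compose_def front_map_def coface_def fun_eq_iff)

lemma back_coface_high: "compose {..b} (compose {..a + b} \<theta> (coface (a + b) (Suc (a + i)))) (back_map a b) =
    compose {..b} (compose {..Suc b} \<theta> (back_map a (Suc b))) (coface b (Suc i))"
  by (auto simp: compose_def back_map_def coface_def fun_eq_iff)

lemma front_coface_last: "compose {..a} (compose {..Suc a} \<theta> (front_map (Suc a))) (coface a (Suc a)) = compose {..a} \<theta> (front_map a)"
  by (auto simp: compose_def front_map_def coface_def fun_eq_iff)

lemma back_coface_first: "compose {..b} (compose {..Suc b} \<theta> (back_map a (Suc b))) (coface b 0) = compose {..b} \<theta> (back_map (Suc a) b)"
  by (auto simp: compose_def back_map_def coface_def fun_eq_iff)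

text \<open>Most axioms hold value by value, inherited from the coefficient algebra. The exceptions
  are the vanishing of the square of \<open>del\<close>, which is \<open>altsum_altsum\<close>, and
  its Leibniz rule, where the faces have to be sorted.\<close>

theorem (in dg_algebra) bigraded_algebra_simplex_cochains: "bigraded_algebra R (simplex_cochains A n)"
proof (intro bigraded_algebra.intro bigraded_algebra_axioms.intro)
  let ?K = "simplex_cochains A n"
  show "cring R" by (rule is_cring)
  have module: "module R (comp ?K a q)" for a q
    unfolding simplex_cochains_simps by (rule module_pi_module[OF is_cring gr_module])
  then show "module R (comp ?K a q)" for a q .
  have ev: "(\<lambda>f. f \<theta>) \<in> linear_maps R (comp ?K a q) (gr A q)" if "\<theta> \<in> ord_maps a n" for \<theta> a q
    unfolding simplex_cochains_simps by (rule linear_proj[OF is_cring gr_module that])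
  have into: "(\<lambda>x. \<lambda>\<theta>\<in>ord_maps a n. F x \<theta>) \<in> linear_maps R N (comp ?K a q)"
    if "\<And>\<theta>. \<theta> \<in> ord_maps a n \<Longrightarrow> (\<lambda>x. F x \<theta>) \<in> linear_maps R N (gr A q)" for F and N :: "('r, (nat \<Rightarrow> nat) \<Rightarrow> 'a) module" and a q
    unfolding simplex_cochains_simps by (rule linear_into_pi[OF is_cring gr_module that])
  have val: "f \<theta> \<in> carrier (gr A q)" if "f \<in> carrier (comp ?K a q)" "\<theta> \<in> ord_maps a n" for f \<theta> a q
    using linear_closed[OF ev[OF that(2)] that(1)] .
  have eqI: "f = g" if "f \<in> carrier (comp ?K a q)" "g \<in> carrier (comp ?K a q)"
    "\<And>\<theta>. \<theta> \<in> ord_maps a n \<Longrightarrow> f \<theta> = g \<theta>" for f g a q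
    using that unfolding simplex_cochains_simps by (rule pi_module_eqI)
  have add_val: "(f \<oplus>\<^bsub>comp ?K a q\<^esub> g) \<theta> = f \<theta> \<oplus>\<^bsub>gr A q\<^esub> g \<theta>" if "\<theta> \<in> ord_maps a n" for f g \<theta> a q
    using that by (simp add: simplex_cochains_simps pi_module_simps)
  have signed_val: "(signed (comp ?K a q) k f) \<theta> = signed (gr A q) k (f \<theta>)"
    if "f \<in> carrier (comp ?K a q)" "\<theta> \<in> ord_maps a n" for f k \<theta> a q
    using that unfolding simplex_cochains_simps by (rule pi_signed[OF is_cring gr_module])
  have zero_val: "\<zero>\<^bsub>comp ?K a q\<^esub> \<theta> = \<zero>\<^bsub>gr A q\<^esub>" if "\<theta> \<in> ord_maps a n" for \<theta> a q
    using that by (simp add: simplex_cochains_simps pi_module_simps)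
  have zero_cl: "\<zero>\<^bsub>comp ?K a q\<^esub> \<in> carrier (comp ?K a q)" for a q
    using abelian_monoid.zero_closed[OF abelian_group.axioms(1)[OF module_abelian[OF module]]] .
  have plus_cl: "f \<oplus>\<^bsub>comp ?K a q\<^esub> g \<in> carrier (comp ?K a q)"
    if "f \<in> carrier (comp ?K a q)" "g \<in> carrier (comp ?K a q)" for f g a q
    using abelian_monoid.a_closed[OF abelian_group.axioms(1)[OF module_abelian[OF module]] that] .
  have signed_cl: "signed (comp ?K a q) k f \<in> carrier (comp ?K a q)" if "f \<in> carrier (comp ?K a q)" for f k a q
    using abelian_group.signed_closed[OF module_abelian[OF module] that] .
  have del_lin: "del ?K a q \<in> linear_maps R (comp ?K a q) (comp ?K (Suc a) q)" for a q
    unfolding simplex_cochains_simps(2)[abs_def]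
    by (rule into, rule linear_altsum[OF gr_module], rule ev, rule compose_coface_ord_maps)
  then show "del ?K a q \<in> linear_maps R (comp ?K a q) (comp ?K (Suc a) q)" for a q .
  note del_cl = linear_closed[OF del_lin]
  have der_lin: "der ?K a q \<in> linear_maps R (comp ?K a q) (comp ?K a (Suc q))" for a q
    unfolding simplex_cochains_simps(3)[abs_def]
    by (rule into, rule linear_comp[OF ev diff_linear])
  then show "der ?K a q \<in> linear_maps R (comp ?K a q) (comp ?K a (Suc q))" for a q .
  note der_cl = linear_closed[OF der_lin]
  have cup_lin_right: "cup ?K a q b r x \<in> linear_maps R (comp ?K b r) (comp ?K (a + b) (q + r))"
    if "x \<in> carrier (comp ?K a q)" for a q b r x
    unfolding simplex_cochains_simps(4)[abs_def]
  proof (rule into)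
    fix \<theta> assume \<theta>: "\<theta> \<in> ord_maps (a + b) n"
    show "(\<lambda>y. gmult A q r (x (compose {..a} \<theta> (front_map a))) (y (compose {..b} \<theta> (back_map a b))))
        \<in> linear_maps R (comp ?K b r) (gr A (q + r))"
      by (rule linear_comp[OF ev[OF compose_back_map[OF \<theta>]] gmult_linear_right[OF val[OF that compose_front_map[OF \<theta>]]]])
  qed
  then show "cup ?K a q b r x \<in> linear_maps R (comp ?K b r) (comp ?K (a + b) (q + r))"
    if "x \<in> carrier (comp ?K a q)" for a q b r x using that .
  note cup_cl = linear_closed[OF cup_lin_right]
  show "(\<lambda>x. cup ?K a q b r x y) \<in> linear_maps R (comp ?K a q) (comp ?K (a + b) (q + r))"
    if "y \<in> carrier (comp ?K b r)" for a q b r y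
    unfolding simplex_cochains_simps(4)[abs_def]
  proof (rule into)
    fix \<theta> assume \<theta>: "\<theta> \<in> ord_maps (a + b) n"
    show "(\<lambda>x. gmult A q r (x (compose {..a} \<theta> (front_map a))) (y (compose {..b} \<theta> (back_map a b))))
        \<in> linear_maps R (comp ?K a q) (gr A (q + r))"
      by (rule linear_comp[OF ev[OF compose_front_map[OF \<theta>]] gmult_linear_left[OF val[OF that compose_back_map[OF \<theta>]]]])
  qed
  have del_val: "del ?K a q f \<theta> = altsum (gr A q) (Suc a) (\<lambda>i. f (compose {..a} \<theta> (coface a i)))"
    if "\<theta> \<in> ord_maps (Suc a) n" for a q f \<theta>
    using that by (simp add: simplex_cochains_simps)
  have der_val: "der ?K a q f \<theta> = diff A q (f \<theta>)" if "\<theta> \<in> ord_maps a n" for a q f \<theta>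
    using that by (simp add: simplex_cochains_simps)
  have cup_val: "cup ?K a q b r f g \<theta> =
      gmult A q r (f (compose {..a} \<theta> (front_map a))) (g (compose {..b} \<theta> (back_map a b)))"
    if "\<theta> \<in> ord_maps (a + b) n" for a q b r f g \<theta>
    using that by (simp add: simplex_cochains_simps)
  show "del ?K (Suc a) q (del ?K a q x) = \<zero>\<^bsub>comp ?K (Suc (Suc a)) q\<^esub>"
    if x: "x \<in> carrier (comp ?K a q)" for x a q
  proof (rule eqI[OF del_cl[OF del_cl[OF x]] zero_cl])
    fix \<theta> assume \<theta>: "\<theta> \<in> ord_maps (Suc (Suc a)) n"
    interpret M: module R "gr A q" by (rule gr_module)
    note co = compose_coface_ord_maps[OF compose_coface_ord_maps[OF \<theta>]]
    have "del ?K (Suc a) q (del ?K a q x) \<theta> = altsum (gr A q) (Suc (Suc a)) (\<lambda>i.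
        altsum (gr A q) (Suc a) (\<lambda>j. x (compose {..a} (compose {..Suc a} \<theta> (coface (Suc a) i)) (coface a j))))"
      using \<theta> by (simp add: del_val compose_coface_ord_maps)
    also have "\<dots> = \<zero>\<^bsub>gr A q\<^esub>"
    proof (rule M.altsum_altsum)
      fix i j :: nat assume "i \<le> j"
      then have "compose {..a} (coface (Suc a) i) (coface a j) = compose {..a} (coface (Suc a) (Suc j)) (coface a i)"
        using coface_coface[of i "Suc j" a] by simp
      then show "x (compose {..a} (compose {..Suc a} \<theta> (coface (Suc a) i)) (coface a j)) =
          x (compose {..a} (compose {..Suc a} \<theta> (coface (Suc a) (Suc j))) (coface a i))"
        by (simp add: compose_assoc_ord_maps[OF coface_ord_maps])
    qed (rule val[OF x co])
    finally show "del ?K (Suc a) q (del ?K a q x) \<theta> = \<zero>\<^bsub>comp ?K (Suc (Suc a)) q\<^esub> \<theta>"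
      using \<theta> by (simp add: zero_val)
  qed
  show "der ?K a (Suc q) (der ?K a q x) = \<zero>\<^bsub>comp ?K a (Suc (Suc q))\<^esub>"
    if x: "x \<in> carrier (comp ?K a q)" for x a q
    by (rule eqI[OF der_cl[OF der_cl[OF x]] zero_cl]) (simp add: der_val zero_val diff_diff val[OF x])
  show "del ?K a (Suc q) (der ?K a q x) = der ?K (Suc a) q (del ?K a q x)"
    if x: "x \<in> carrier (comp ?K a q)" for x a q
  proof (rule eqI[OF del_cl[OF der_cl[OF x]] der_cl[OF del_cl[OF x]]])
    fix \<theta> assume \<theta>: "\<theta> \<in> ord_maps (Suc a) n"
    then show "del ?K a (Suc q) (der ?K a q x) \<theta> = der ?K (Suc a) q (del ?K a q x) \<theta>"
      by (simp add: del_val der_val compose_coface_ord_maps val[OF x]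
          linear_altsum_eq[OF gr_module gr_module diff_linear])
  qed
  show "cup ?K (a + b) (q + r) c s (cup ?K a q b r x y) z = cup ?K a q (b + c) (r + s) x (cup ?K b r c s y z)"
    if x: "x \<in> carrier (comp ?K a q)" and y: "y \<in> carrier (comp ?K b r)" and z: "z \<in> carrier (comp ?K c s)"
    for x y z a q b r c s
  proof (rule eqI)
    show "cup ?K (a + b) (q + r) c s (cup ?K a q b r x y) z \<in> carrier (comp ?K (a + b + c) (q + r + s))"
      by (rule cup_cl[OF cup_cl[OF x y] z])
    show "cup ?K a q (b + c) (r + s) x (cup ?K b r c s y z) \<in> carrier (comp ?K (a + b + c) (q + r + s))"
      using cup_cl[OF x cup_cl[OF y z]] by (simp add: add.assoc)
    fix \<theta> assume \<theta>: "\<theta> \<in> ord_maps (a + b + c) n"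
    then have \<theta>': "\<theta> \<in> ord_maps (a + (b + c)) n" by (simp add: add.assoc)
    have e: "compose {..a} (compose {..a + b} \<theta> (front_map (a + b))) (front_map a) = compose {..a} \<theta> (front_map a)"
      "compose {..b} (compose {..a + b} \<theta> (front_map (a + b))) (back_map a b) =
        compose {..b} (compose {..b + c} \<theta> (back_map a (b + c))) (front_map b)"
      "compose {..c} (compose {..b + c} \<theta> (back_map a (b + c))) (back_map b c) = compose {..c} \<theta> (back_map (a + b) c)"
      by (auto simp: compose_def front_map_def back_map_def fun_eq_iff add.assoc)
    have f1: "compose {..a + b} \<theta> (front_map (a + b)) \<in> ord_maps (a + b) n" by (rule compose_front_map[OF \<theta>])
    have b1: "compose {..b + c} \<theta> (back_map a (b + c)) \<in> ord_maps (b + c) n" by (rule compose_back_map[OF \<theta>'])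
    show "cup ?K (a + b) (q + r) c s (cup ?K a q b r x y) z \<theta> = cup ?K a q (b + c) (r + s) x (cup ?K b r c s y z) \<theta>"
      unfolding cup_val[OF \<theta>] cup_val[OF \<theta>'] cup_val[OF f1] cup_val[OF b1] e
      by (intro gmult_assoc val[OF x] val[OF y] val[OF z] compose_front_map[OF b1]
          compose_front_map[OF \<theta>'] compose_back_map[OF \<theta>])
  qed
  show "unit ?K \<in> carrier (comp ?K 0 0)"
    using gone_closed by (auto simp: simplex_cochains_simps pi_module_simps)
  have fr: "compose {..a} \<theta> (front_map a) = \<theta>" if "\<theta> \<in> ord_maps a n" for \<theta> a
    using compose_ord_maps_id[OF that] by (simp add: front_map_def)
  have bk: "compose {..a} \<theta> (back_map 0 a) = \<theta>" if "\<theta> \<in> ord_maps a n" for \<theta> a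
    using compose_ord_maps_id[OF that] by (simp add: back_map_def)
  show "cup ?K 0 0 a q (unit ?K) x = x" if x: "x \<in> carrier (comp ?K a q)" for x a q
  proof (rule eqI[OF _ x])
    show "cup ?K 0 0 a q (unit ?K) x \<in> carrier (comp ?K a q)"
      using cup_cl[OF \<open>unit ?K \<in> carrier (comp ?K 0 0)\<close> x] by simp
    fix \<theta> assume \<theta>: "\<theta> \<in> ord_maps a n"
    have "compose {..0} \<theta> (front_map 0) \<in> ord_maps 0 n" using compose_front_map[of \<theta> 0 a n] \<theta> by simp
    then show "cup ?K 0 0 a q (unit ?K) x \<theta> = x \<theta>"
      using \<theta> cup_val[of \<theta> 0 a 0 q "unit ?K" x] gmult_one_left[OF val[OF x \<theta>]]
      by (simp add: bk) (simp add: simplex_cochains_simps)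
  qed
  show "cup ?K a q 0 0 x (unit ?K) = x" if x: "x \<in> carrier (comp ?K a q)" for x a q
  proof (rule eqI[OF _ x])
    show "cup ?K a q 0 0 x (unit ?K) \<in> carrier (comp ?K a q)"
      using cup_cl[OF x \<open>unit ?K \<in> carrier (comp ?K 0 0)\<close>] by simp
    fix \<theta> assume \<theta>: "\<theta> \<in> ord_maps a n"
    have "compose {..0} \<theta> (back_map a 0) \<in> ord_maps 0 n" using compose_back_map[of \<theta> a 0 n] \<theta> by simp
    then show "cup ?K a q 0 0 x (unit ?K) \<theta> = x \<theta>"
      using \<theta> cup_val[of \<theta> a 0 q 0 x "unit ?K"] gmult_one_right[OF val[OF x \<theta>]]
      by (simp add: fr) (simp add: simplex_cochains_simps)
  qed
  show "del ?K (a + b) (q + r) (cup ?K a q b r x y) = cup ?K (Suc a) q b r (del ?K a q x) y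
        \<oplus>\<^bsub>comp ?K (Suc (a + b)) (q + r)\<^esub>
          signed (comp ?K (Suc (a + b)) (q + r)) a (cup ?K a q (Suc b) r x (del ?K b r y))"
    if x: "x \<in> carrier (comp ?K a q)" and y: "y \<in> carrier (comp ?K b r)" for x y a q b r
  proof (rule eqI)
    have 1: "cup ?K (Suc a) q b r (del ?K a q x) y \<in> carrier (comp ?K (Suc (a + b)) (q + r))"
      using cup_cl[OF del_cl[OF x] y] by simp
    have 2: "cup ?K a q (Suc b) r x (del ?K b r y) \<in> carrier (comp ?K (Suc (a + b)) (q + r))"
      using cup_cl[OF x del_cl[OF y]] by simp
    show "del ?K (a + b) (q + r) (cup ?K a q b r x y) \<in> carrier (comp ?K (Suc (a + b)) (q + r))"
      by (rule del_cl[OF cup_cl[OF x y]])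
    show "cup ?K (Suc a) q b r (del ?K a q x) y
        \<oplus>\<^bsub>comp ?K (Suc (a + b)) (q + r)\<^esub>
          signed (comp ?K (Suc (a + b)) (q + r)) a (cup ?K a q (Suc b) r x (del ?K b r y))
        \<in> carrier (comp ?K (Suc (a + b)) (q + r))"
      by (rule plus_cl[OF 1 signed_cl[OF 2]])
    fix \<theta> assume \<theta>: "\<theta> \<in> ord_maps (Suc (a + b)) n"
    then have \<theta>1: "\<theta> \<in> ord_maps (Suc a + b) n" and \<theta>2: "\<theta> \<in> ord_maps (a + Suc b) n" by simp_all
    interpret M: module R "gr A (q + r)" by (rule gr_module)
    define h where "h i = cup ?K a q b r x y (compose {..a + b} \<theta> (coface (a + b) i))" for i
    have h: "h i \<in> carrier (gr A (q + r))" for i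
      unfolding h_def by (rule val[OF cup_cl[OF x y] compose_coface_ord_maps[OF \<theta>]])
    have h_eq: "h i = gmult A q r (x (compose {..a} (compose {..a + b} \<theta> (coface (a + b) i)) (front_map a)))
        (y (compose {..b} (compose {..a + b} \<theta> (coface (a + b) i)) (back_map a b)))" for i
      unfolding h_def by (rule cup_val[OF compose_coface_ord_maps[OF \<theta>]])
    \<comment> \<open>The front a-face times the complementary back b-face: the summand that both
      terms on the right of the Leibniz rule have in addition to the faces \<open>h i\<close> of the
      product, and that cancels by \<open>signed_cancel\<close>.\<close>
    define z where "z = gmult A q r (x (compose {..a} \<theta> (front_map a))) (y (compose {..b} \<theta> (back_map (Suc a) b)))"
    have xf: "x (compose {..a} \<theta> (front_map a)) \<in> carrier (gr A q)" by (rule val[OF x compose_front_map[OF \<theta>2]])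
    have yb: "y (compose {..b} \<theta> (back_map (Suc a) b)) \<in> carrier (gr A r)" by (rule val[OF y compose_back_map[OF \<theta>1]])
    have z: "z \<in> carrier (gr A (q + r))"
      unfolding z_def by (rule linear_closed[OF gmult_linear_right[OF xf] yb])
    have xi: "x (compose {..a} (compose {..Suc a} \<theta> (front_map (Suc a))) (coface a i)) \<in> carrier (gr A q)" for i
      by (rule val[OF x compose_coface_ord_maps[OF compose_front_map[OF \<theta>1]]])
    have yi: "y (compose {..b} (compose {..Suc b} \<theta> (back_map a (Suc b))) (coface b i)) \<in> carrier (gr A r)" for i
      by (rule val[OF y compose_coface_ord_maps[OF compose_back_map[OF \<theta>2]]])
    have "cup ?K (Suc a) q b r (del ?K a q x) y \<theta> = altsum (gr A (q + r)) (Suc a) (\<lambda>i.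
        gmult A q r (x (compose {..a} (compose {..Suc a} \<theta> (front_map (Suc a))) (coface a i))) (y (compose {..b} \<theta> (back_map (Suc a) b))))"
      unfolding cup_val[OF \<theta>1] del_val[OF compose_front_map[OF \<theta>1]]
      by (rule linear_altsum_eq[OF gr_module gr_module gmult_linear_left[OF yb] xi])
    also have "\<dots> = altsum (gr A (q + r)) (Suc a) (\<lambda>i. if i \<le> a then h i else z)"
    proof (rule M.altsum_cong)
      fix i show "(if i \<le> a then h i else z) \<in> carrier (gr A (q + r))" using h z by simp
    qed (auto simp: h_eq z_def front_coface_low back_coface_low le_Suc_eq front_coface_last)
    also have "\<dots> = signed (gr A (q + r)) (Suc a) z \<oplus>\<^bsub>gr A (q + r)\<^esub> altsum (gr A (q + r)) a (\<lambda>i. if i \<le> a then h i else z)"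
      using h z by (subst M.altsum_last) auto
    also have "altsum (gr A (q + r)) a (\<lambda>i. if i \<le> a then h i else z) = altsum (gr A (q + r)) a h"
      using h by (intro M.altsum_cong) auto
    finally have left: "cup ?K (Suc a) q b r (del ?K a q x) y \<theta> =
      signed (gr A (q + r)) (Suc a) z \<oplus>\<^bsub>gr A (q + r)\<^esub> altsum (gr A (q + r)) a h" .
    have "cup ?K a q (Suc b) r x (del ?K b r y) \<theta> = altsum (gr A (q + r)) (Suc b) (\<lambda>i.
        gmult A q r (x (compose {..a} \<theta> (front_map a))) (y (compose {..b} (compose {..Suc b} \<theta> (back_map a (Suc b))) (coface b i))))"
      unfolding cup_val[OF \<theta>2] del_val[OF compose_back_map[OF \<theta>2]]
      by (rule linear_altsum_eq[OF gr_module gr_module gmult_linear_right[OF xf] yi])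
    also have "\<dots> = z \<ominus>\<^bsub>gr A (q + r)\<^esub> altsum (gr A (q + r)) b (\<lambda>i. h (Suc (a + i)))"
      using linear_closed[OF gmult_linear_right[OF xf] yi]
      by (subst M.altsum_first) (simp_all add: z_def h_eq back_coface_first front_coface_high back_coface_high)
    finally have right: "cup ?K a q (Suc b) r x (del ?K b r y) \<theta> =
      z \<ominus>\<^bsub>gr A (q + r)\<^esub> altsum (gr A (q + r)) b (\<lambda>i. h (Suc (a + i)))" .
    have "del ?K (a + b) (q + r) (cup ?K a q b r x y) \<theta> = altsum (gr A (q + r)) (Suc (a + b)) h"
      unfolding h_def by (rule del_val[OF \<theta>])
    also have "\<dots> = altsum (gr A (q + r)) a h \<oplus>\<^bsub>gr A (q + r)\<^esub>
        signed (gr A (q + r)) (Suc a) (altsum (gr A (q + r)) b (\<lambda>i. h (Suc (a + i))))"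
      using h by (intro M.altsum_split)
    also have "\<dots> = cup ?K (Suc a) q b r (del ?K a q x) y \<theta> \<oplus>\<^bsub>gr A (q + r)\<^esub>
        signed (gr A (q + r)) a (cup ?K a q (Suc b) r x (del ?K b r y) \<theta>)"
      unfolding left right using h z by (intro M.signed_cancel M.altsum_closed)
    finally show "del ?K (a + b) (q + r) (cup ?K a q b r x y) \<theta> = (cup ?K (Suc a) q b r (del ?K a q x) y
        \<oplus>\<^bsub>comp ?K (Suc (a + b)) (q + r)\<^esub>
          signed (comp ?K (Suc (a + b)) (q + r)) a (cup ?K a q (Suc b) r x (del ?K b r y))) \<theta>"
      using add_val[OF \<theta>] signed_val[OF 2 \<theta>] by simp
  qed
  show "der ?K (a + b) (q + r) (cup ?K a q b r x y) = cup ?K a (Suc q) b r (der ?K a q x) y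
        \<oplus>\<^bsub>comp ?K (a + b) (Suc (q + r))\<^esub>
          signed (comp ?K (a + b) (Suc (q + r))) q (cup ?K a q b (Suc r) x (der ?K b r y))"
    if x: "x \<in> carrier (comp ?K a q)" and y: "y \<in> carrier (comp ?K b r)" for x y a q b r
  proof (rule eqI)
    have 1: "cup ?K a (Suc q) b r (der ?K a q x) y \<in> carrier (comp ?K (a + b) (Suc (q + r)))"
      using cup_cl[OF der_cl[OF x] y] by simp
    have 2: "cup ?K a q b (Suc r) x (der ?K b r y) \<in> carrier (comp ?K (a + b) (Suc (q + r)))"
      using cup_cl[OF x der_cl[OF y]] by simp
    show "der ?K (a + b) (q + r) (cup ?K a q b r x y) \<in> carrier (comp ?K (a + b) (Suc (q + r)))"
      by (rule der_cl[OF cup_cl[OF x y]])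
    show "cup ?K a (Suc q) b r (der ?K a q x) y
        \<oplus>\<^bsub>comp ?K (a + b) (Suc (q + r))\<^esub>
          signed (comp ?K (a + b) (Suc (q + r))) q (cup ?K a q b (Suc r) x (der ?K b r y))
        \<in> carrier (comp ?K (a + b) (Suc (q + r)))"
      by (rule plus_cl[OF 1 signed_cl[OF 2]])
    fix \<theta> assume \<theta>: "\<theta> \<in> ord_maps (a + b) n"
    note fb = compose_front_map[OF \<theta>] compose_back_map[OF \<theta>]
    show "der ?K (a + b) (q + r) (cup ?K a q b r x y) \<theta> = (cup ?K a (Suc q) b r (der ?K a q x) y
        \<oplus>\<^bsub>comp ?K (a + b) (Suc (q + r))\<^esub>
          signed (comp ?K (a + b) (Suc (q + r))) q (cup ?K a q b (Suc r) x (der ?K b r y))) \<theta>"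
      unfolding add_val[OF \<theta>] signed_val[OF 2 \<theta>] der_val[OF \<theta>] cup_val[OF \<theta>] der_val[OF fb(1)] der_val[OF fb(2)]
      by (rule leibniz[OF val[OF x fb(1)] val[OF y fb(2)]])
  qed
qed

section \<open>Simplex cochains as simplex and coefficients vary together\<close>

lemma dga_hom_linear: "dga_hom R A B f \<Longrightarrow> f q \<in> linear_maps R (gr A q) (gr B q)"
  by (simp add: dga_hom_def cochain_map_def)

lemma dga_hom_diff: "dga_hom R A B f \<Longrightarrow> x \<in> carrier (gr A q) \<Longrightarrow> f (Suc q) (diff A q x) = diff B q (f q x)"
  by (simp add: dga_hom_def cochain_map_def)

lemma dga_hom_mult: "dga_hom R A B f \<Longrightarrow> x \<in> carrier (gr A p) \<Longrightarrow> y \<in> carrier (gr A q) \<Longrightarrow>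
    f (p + q) (gmult A p q x y) = gmult B p q (f p x) (f q y)"
  by (simp add: dga_hom_def)

lemma dga_hom_one: "dga_hom R A B f \<Longrightarrow> f 0 (gone A) = gone B"
  by (simp add: dga_hom_def)

context simplicial_dga
begin

lemma level_module: "module R (gr (level A n) q)"
  using level_dga by (simp add: dg_algebra_def cochain_complex_def cochain_complex_axioms_def)

lemma level_diff_linear: "diff (level A n) q \<in> linear_maps R (gr (level A n) q) (gr (level A n) (Suc q))"
  using level_dga by (simp add: dg_algebra_def cochain_complex_def cochain_complex_axioms_def)

lemmas dact_linear = dga_hom_linear[OF dact_hom]
lemmas dact_closed = linear_closed[OF dact_linear]

end

text \<open>The dimension enters twice, as index of the coefficients and of the standard simplex.
  Cochains on the simplex depend contravariantly on it, as the coefficients do, so both pullbacks go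
  in the same direction.\<close>

definition simplex_pull :: "('r, 'a, 'o) sdga_scheme \<Rightarrow> nat \<Rightarrow> nat \<Rightarrow> (nat \<Rightarrow> nat) \<Rightarrow> nat \<Rightarrow> nat
    \<Rightarrow> ((nat \<Rightarrow> nat) \<Rightarrow> 'a) \<Rightarrow> (nat \<Rightarrow> nat) \<Rightarrow> 'a"
  where "simplex_pull A m n \<phi> a q f = (\<lambda>\<theta>\<in>ord_maps a m. dact A m n \<phi> q (f (compose {..a} \<phi> \<theta>)))"

text \<open>Since this is again a simplicial differential graded algebra, the construction
  \<open>forms\<close> applies to it, and \<open>forms (cochain_sdga A) X\<close> is the
  intermediate algebra of the zigzag.\<close>

definition cochain_sdga :: "('r, 'a, 'o) sdga_scheme \<Rightarrow> ('r, nat \<Rightarrow> (nat \<Rightarrow> nat) \<Rightarrow> 'a) sdga"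
  where "cochain_sdga A =
    \<lparr>level = (\<lambda>n. tot (simplex_cochains (level A n) n)),
     dact = (\<lambda>m n \<phi>. tot_map (simplex_pull A m n \<phi>))\<rparr>"

context simplicial_dga
begin

lemma simplex_cochains_bigraded: "bigraded_algebra R (simplex_cochains (level A n) n')"
  by (rule dg_algebra.bigraded_algebra_simplex_cochains[OF level_dga])

abbreviation simplex_module :: "nat \<Rightarrow> nat \<Rightarrow> nat \<Rightarrow> ('r, (nat \<Rightarrow> nat) \<Rightarrow> 'a) module"
  where "simplex_module n a q \<equiv> comp (simplex_cochains (level A n) n) a q"

lemma simplex_module_module: "module R (simplex_module n a q)"
  by (rule bigraded_algebra.comp_module[OF simplex_cochains_bigraded])

lemma simplex_value_linear:
  "\<theta> \<in> ord_maps a n \<Longrightarrow> (\<lambda>f. f \<theta>) \<in> linear_maps R (simplex_module n a q) (gr (level A n) q)"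
  unfolding simplex_cochains_simps by (rule linear_proj[OF is_cring level_module])

lemmas simplex_value = linear_closed[OF simplex_value_linear]

lemma simplex_eqI:
  "f \<in> carrier (simplex_module n a q) \<Longrightarrow> g \<in> carrier (simplex_module n a q) \<Longrightarrow>
    (\<And>\<theta>. \<theta> \<in> ord_maps a n \<Longrightarrow> f \<theta> = g \<theta>) \<Longrightarrow> f = g"
  unfolding simplex_cochains_simps by (rule pi_module_eqI)

lemma simplex_pull_linear:
  assumes \<phi>: "\<phi> \<in> ord_maps m n"
  shows "simplex_pull A m n \<phi> a q \<in> linear_maps R (simplex_module n a q) (simplex_module m a q)"
  unfolding simplex_pull_def[abs_def] simplex_cochains_simps(1)[of "level A m"]
  by (rule linear_into_pi[OF is_cring level_module], rule linear_comp[OF simplex_value_linear dact_linear[OF \<phi>]],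
      rule compose_ord_maps[OF _ \<phi>])

lemma simplex_pull_value: "\<theta> \<in> ord_maps a m \<Longrightarrow>
    simplex_pull A m n \<phi> a q f \<theta> = dact A m n \<phi> q (f (compose {..a} \<phi> \<theta>))"
  by (simp add: simplex_pull_def)

lemma simplex_pull_id:
  assumes f: "f \<in> carrier (simplex_module n a q)"
  shows "simplex_pull A n n (\<lambda>i\<in>{..n}. i) a q f = f"
  using simplex_value[OF _ f]
  by (intro simplex_eqI[OF linear_closed[OF simplex_pull_linear[OF id_ord_maps] f] f])
    (simp add: simplex_pull_value compose_id_ord_maps dact_id)

lemma simplex_pull_compose:
  assumes \<theta>: "\<theta> \<in> ord_maps l m" and \<phi>: "\<phi> \<in> ord_maps m n" and f: "f \<in> carrier (simplex_module n a q)"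
  shows "simplex_pull A l n (compose {..l} \<phi> \<theta>) a q f = simplex_pull A l m \<theta> a q (simplex_pull A m n \<phi> a q f)"
proof (rule simplex_eqI[OF linear_closed[OF simplex_pull_linear[OF compose_ord_maps[OF \<theta> \<phi>]] f]
      linear_closed[OF simplex_pull_linear[OF \<theta>] linear_closed[OF simplex_pull_linear[OF \<phi>] f]]])
  fix \<psi> assume \<psi>: "\<psi> \<in> ord_maps a l"
  have "compose {..a} \<phi> (compose {..a} \<theta> \<psi>) \<in> ord_maps a n"
    by (rule compose_ord_maps[OF compose_ord_maps[OF \<psi> \<theta>] \<phi>])
  then show "simplex_pull A l n (compose {..l} \<phi> \<theta>) a q f \<psi> = simplex_pull A l m \<theta> a q (simplex_pull A m n \<phi> a q f) \<psi>"
    using simplex_value[OF _ f]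
    by (simp add: simplex_pull_value[OF \<psi>] simplex_pull_value[OF compose_ord_maps[OF \<psi> \<theta>]]
        compose_assoc_ord_maps[OF \<psi>] dact_compose[OF \<theta> \<phi>])
qed

lemma bigraded_hom_simplex_pull:
  assumes \<phi>: "\<phi> \<in> ord_maps m n"
  shows "bigraded_hom R (simplex_cochains (level A n) n) (simplex_cochains (level A m) m) (simplex_pull A m n \<phi>)"
proof (intro bigraded_hom.intro bigraded_hom_axioms.intro simplex_cochains_bigraded)
  interpret K: bigraded_algebra R "simplex_cochains (level A n) n" by (rule simplex_cochains_bigraded)
  interpret L: bigraded_algebra R "simplex_cochains (level A m) m" by (rule simplex_cochains_bigraded)
  note hom = dact_hom[OF \<phi>]
  have cmp: "compose {..a} \<phi> \<theta> \<in> ord_maps a n" if "\<theta> \<in> ord_maps a m" for a \<theta>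
    by (rule compose_ord_maps[OF that \<phi>])
  show lin: "simplex_pull A m n \<phi> a q \<in> linear_maps R (simplex_module n a q) (simplex_module m a q)" for a q
    by (rule simplex_pull_linear[OF \<phi>])
  note cl = linear_closed[OF lin]
  show "simplex_pull A m n \<phi> (Suc a) q (del (simplex_cochains (level A n) n) a q x) =
      del (simplex_cochains (level A m) m) a q (simplex_pull A m n \<phi> a q x)"
    if x: "x \<in> carrier (simplex_module n a q)" for a q x
  proof (rule simplex_eqI[OF cl[OF linear_closed[OF K.del_linear x]] linear_closed[OF L.del_linear cl[OF x]]])
    fix \<theta> assume \<theta>: "\<theta> \<in> ord_maps (Suc a) m"
    note co = compose_coface_ord_maps[OF \<theta>]
    have "compose {..a} (compose {..Suc a} \<phi> \<theta>) (coface a i) = compose {..a} \<phi> (compose {..a} \<theta> (coface a i))" for i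
      by (rule compose_assoc_ord_maps[OF coface_ord_maps])
    then show "simplex_pull A m n \<phi> (Suc a) q (del (simplex_cochains (level A n) n) a q x) \<theta> =
      del (simplex_cochains (level A m) m) a q (simplex_pull A m n \<phi> a q x) \<theta>"
      using linear_altsum_eq[OF level_module level_module dact_linear[OF \<phi>], of "Suc a"
          "\<lambda>i. x (compose {..a} \<phi> (compose {..a} \<theta> (coface a i)))"] simplex_value[OF cmp[OF co] x]
      by (simp add: simplex_pull_value \<theta> cmp co simplex_cochains_simps(2))
  qed
  show "simplex_pull A m n \<phi> a (Suc q) (der (simplex_cochains (level A n) n) a q x) =
      der (simplex_cochains (level A m) m) a q (simplex_pull A m n \<phi> a q x)"
    if x: "x \<in> carrier (simplex_module n a q)" for a q x
    using simplex_value[OF cmp x]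
    by (intro simplex_eqI[OF cl[OF linear_closed[OF K.der_linear x]] linear_closed[OF L.der_linear cl[OF x]]])
      (simp add: simplex_pull_value cmp simplex_cochains_simps(3) dga_hom_diff[OF hom])
  show "simplex_pull A m n \<phi> (a + b) (q + r) (cup (simplex_cochains (level A n) n) a q b r x y) =
      cup (simplex_cochains (level A m) m) a q b r (simplex_pull A m n \<phi> a q x) (simplex_pull A m n \<phi> b r y)"
    if x: "x \<in> carrier (simplex_module n a q)" and y: "y \<in> carrier (simplex_module n b r)" for a q b r x y
  proof (rule simplex_eqI[OF cl[OF linear_closed[OF K.cup_right[OF x] y]]
        linear_closed[OF L.cup_right[OF cl[OF x]] cl[OF y]]])
    fix \<theta> assume \<theta>: "\<theta> \<in> ord_maps (a + b) m"
    note fb = compose_front_map[OF \<theta>] compose_back_map[OF \<theta>]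
    have e: "compose {..a} (compose {..a + b} \<phi> \<theta>) (front_map a) = compose {..a} \<phi> (compose {..a} \<theta> (front_map a))"
      "compose {..b} (compose {..a + b} \<phi> \<theta>) (back_map a b) = compose {..b} \<phi> (compose {..b} \<theta> (back_map a b))"
      using compose_assoc_ord_maps[OF front_map_ord_maps] compose_assoc_ord_maps[OF back_map_ord_maps] by blast+
    show "simplex_pull A m n \<phi> (a + b) (q + r) (cup (simplex_cochains (level A n) n) a q b r x y) \<theta> =
      cup (simplex_cochains (level A m) m) a q b r (simplex_pull A m n \<phi> a q x) (simplex_pull A m n \<phi> b r y) \<theta>"
      using dga_hom_mult[OF hom simplex_value[OF cmp[OF fb(1)] x] simplex_value[OF cmp[OF fb(2)] y]]
      by (simp add: simplex_pull_value \<theta> cmp fb simplex_cochains_simps(4) e)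
  qed
  show "simplex_pull A m n \<phi> 0 0 (unit (simplex_cochains (level A n) n)) = unit (simplex_cochains (level A m) m)"
    using cmp[of _ 0] by (auto simp: simplex_pull_def simplex_cochains_simps(5) fun_eq_iff dga_hom_one[OF hom])
qed

theorem simplicial_dga_cochain_sdga: "simplicial_dga R (cochain_sdga A)"
proof (intro simplicial_dga.intro simplicial_dga_axioms.intro)
  show "cring R" by (rule is_cring)
  show "dg_algebra R (level (cochain_sdga A) n)" for n
    using bigraded_algebra.dg_algebra_tot[OF simplex_cochains_bigraded] by (simp add: cochain_sdga_def)
  show "dga_hom R (level (cochain_sdga A) n) (level (cochain_sdga A) m) (dact (cochain_sdga A) m n \<phi>)"
    if "\<phi> \<in> ord_maps m n" for m n \<phi>
    using bigraded_hom.dga_hom_tot_map[OF bigraded_hom_simplex_pull[OF that]] by (simp add: cochain_sdga_def)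
  have comp: "F a \<in> carrier (simplex_module n a (q - a))" if "F \<in> carrier (gr (level (cochain_sdga A) n) q)" "a \<le> q" for F a n q
    using bigraded_algebra.tot_component[OF simplex_cochains_bigraded _ that(2)] that(1) by (simp add: cochain_sdga_def tot_def)
  have ext: "F a = undefined" if "F \<in> carrier (gr (level (cochain_sdga A) n) q)" "\<not> a \<le> q" for F a n q
    using that by (auto simp: cochain_sdga_def tot_def tot_module_def pi_module_simps PiE_iff extensional_def)
  show "dact (cochain_sdga A) n n (\<lambda>i\<in>{..n}. i) q x = x" if "x \<in> carrier (gr (level (cochain_sdga A) n) q)" for n q x
    using comp[OF that] ext[OF that] by (auto simp: cochain_sdga_def tot_map_def fun_eq_iff simplex_pull_id)
  show "dact (cochain_sdga A) l n (compose {..l} \<phi> \<theta>) q x = dact (cochain_sdga A) l m \<theta> q (dact (cochain_sdga A) m n \<phi> q x)"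
    if "\<theta> \<in> ord_maps l m" "\<phi> \<in> ord_maps m n" "x \<in> carrier (gr (level (cochain_sdga A) n) q)" for \<theta> l m \<phi> n x q
    using comp[OF that(3)] by (auto simp: cochain_sdga_def tot_map_def fun_eq_iff simplex_pull_compose[OF that(1,2)])
qed

end

section \<open>The algebra of forms\<close>

locale forms_algebra = simplicial_dga R A + X: simplicial_set X
  for R :: "('r, 'm) ring_scheme" (structure) and A :: "('r, 'a, 'n) sdga_scheme" and X :: "('x, 'k) sset_scheme"
begin

lemma forms_closed: "\<alpha> \<in> carrier (gr (forms A X) q) \<Longrightarrow> x \<in> simplices X n \<Longrightarrow> \<alpha> n x \<in> carrier (gr (level A n) q)"
  by (auto simp: forms_def simplicial_maps_def degree_part_def)

lemma forms_natural: "\<alpha> \<in> carrier (gr (forms A X) q) \<Longrightarrow> \<theta> \<in> ord_maps m n \<Longrightarrow> x \<in> simplices X n \<Longrightarrow>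
    \<alpha> m (act X m n \<theta> x) = dact A m n \<theta> q (\<alpha> n x)"
  by (auto simp: forms_def simplicial_maps_def degree_part_def)

lemma forms_memI:
  assumes "\<And>n x. x \<in> simplices X n \<Longrightarrow> F n x \<in> carrier (gr (level A n) q)"
    "\<And>m n \<theta> x. \<theta> \<in> ord_maps m n \<Longrightarrow> x \<in> simplices X n \<Longrightarrow> F m (act X m n \<theta> x) = dact A m n \<theta> q (F n x)"
  shows "(\<lambda>n. \<lambda>x\<in>simplices X n. F n x) \<in> carrier (gr (forms A X) q)"
  using assms X.act_closed by (auto simp: forms_def simplicial_maps_def degree_part_def)

lemma forms_eqI:
  assumes "\<alpha> \<in> carrier (gr (forms A X) q)" "\<beta> \<in> carrier (gr (forms A X) q)"
    "\<And>n x. x \<in> simplices X n \<Longrightarrow> \<alpha> n x = \<beta> n x"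
  shows "\<alpha> = \<beta>"
proof
  fix n show "\<alpha> n = \<beta> n"
    using assms by (intro PiE_ext[of _ "simplices X n" "\<lambda>_. carrier (gr (level A n) q)"])
      (auto simp: forms_def simplicial_maps_def degree_part_def)
qed

lemma forms_ops:
  "\<alpha> \<oplus>\<^bsub>gr (forms A X) q\<^esub> \<beta> = (\<lambda>n. \<lambda>x\<in>simplices X n. \<alpha> n x \<oplus>\<^bsub>gr (level A n) q\<^esub> \<beta> n x)"
  "\<zero>\<^bsub>gr (forms A X) q\<^esub> = (\<lambda>n. \<lambda>x\<in>simplices X n. \<zero>\<^bsub>gr (level A n) q\<^esub>)"
  "r \<odot>\<^bsub>gr (forms A X) q\<^esub> \<alpha> = (\<lambda>n. \<lambda>x\<in>simplices X n. r \<odot>\<^bsub>gr (level A n) q\<^esub> \<alpha> n x)"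
  "diff (forms A X) q \<alpha> = (\<lambda>n. \<lambda>x\<in>simplices X n. diff (level A n) q (\<alpha> n x))"
  "gmult (forms A X) p q \<alpha> \<beta> = (\<lambda>n. \<lambda>x\<in>simplices X n. gmult (level A n) p q (\<alpha> n x) (\<beta> n x))"
  "gone (forms A X) = (\<lambda>n. \<lambda>x\<in>simplices X n. gone (level A n))"
  by (simp_all add: forms_def)

lemma forms_add_closed: "\<alpha> \<in> carrier (gr (forms A X) q) \<Longrightarrow> \<beta> \<in> carrier (gr (forms A X) q) \<Longrightarrow>
    \<alpha> \<oplus>\<^bsub>gr (forms A X) q\<^esub> \<beta> \<in> carrier (gr (forms A X) q)"
  unfolding forms_ops
  by (rule forms_memI) (auto simp: forms_natural linear_add[OF dact_linear] forms_closed
      intro!: abelian_monoid.a_closed abelian_group.axioms(1) module_abelian level_module)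

lemma forms_zero_closed: "\<zero>\<^bsub>gr (forms A X) q\<^esub> \<in> carrier (gr (forms A X) q)"
  unfolding forms_ops
  by (rule forms_memI) (auto simp: linear_zero[OF level_module level_module dact_linear]
      intro!: abelian_monoid.zero_closed abelian_group.axioms(1) module_abelian level_module)

lemma forms_smult_closed: "r \<in> carrier R \<Longrightarrow> \<alpha> \<in> carrier (gr (forms A X) q) \<Longrightarrow>
    r \<odot>\<^bsub>gr (forms A X) q\<^esub> \<alpha> \<in> carrier (gr (forms A X) q)"
  unfolding forms_ops
  by (rule forms_memI) (auto simp: forms_natural linear_smult[OF dact_linear] forms_closed
      intro!: module.smult_closed level_module)

lemma forms_diff_closed: "\<alpha> \<in> carrier (gr (forms A X) q) \<Longrightarrow> diff (forms A X) q \<alpha> \<in> carrier (gr (forms A X) (Suc q))"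
  unfolding forms_ops
  by (rule forms_memI) (auto simp: forms_natural dga_hom_diff[OF dact_hom] forms_closed
      intro!: linear_closed[OF level_diff_linear])

lemma forms_gmult_closed:
  assumes a: "\<alpha> \<in> carrier (gr (forms A X) p)" and b: "\<beta> \<in> carrier (gr (forms A X) q)"
  shows "gmult (forms A X) p q \<alpha> \<beta> \<in> carrier (gr (forms A X) (p + q))"
  unfolding forms_ops
  by (rule forms_memI) (auto simp: forms_natural[OF a] forms_natural[OF b] dga_hom_mult[OF dact_hom] forms_closed[OF a] forms_closed[OF b]
      intro!: linear_closed[OF dg_algebra.gmult_linear_right[OF level_dga]])

lemma forms_gone_closed: "gone (forms A X) \<in> carrier (gr (forms A X) 0)"
  unfolding forms_ops
  by (rule forms_memI) (auto simp: dga_hom_one[OF dact_hom] dg_algebra.gone_closed[OF level_dga])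

lemmas forms_cl = forms_add_closed forms_zero_closed forms_smult_closed forms_diff_closed forms_gmult_closed forms_gone_closed

lemma forms_module: "module R (gr (forms A X) q)"
proof (rule moduleI)
  note ax = level_module[THEN module_abelian]
  note mon = abelian_group.axioms(1)[OF ax]
  note mc = module.smult_closed[OF level_module]
  show "cring R" by (rule is_cring)
  show "abelian_group (gr (forms A X) q)"
  proof (rule abelian_groupI)
    fix \<alpha> assume \<alpha>: "\<alpha> \<in> carrier (gr (forms A X) q)"
    have "(\<lambda>n. \<lambda>x\<in>simplices X n. \<ominus>\<^bsub>gr (level A n) q\<^esub> \<alpha> n x) \<in> carrier (gr (forms A X) q)"
      using \<alpha> by (intro forms_memI)
        (auto simp: forms_natural forms_closed linear_uminus[OF level_module level_module dact_linear] abelian_group.a_inv_closed[OF ax])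
    moreover have "(\<lambda>n. \<lambda>x\<in>simplices X n. \<ominus>\<^bsub>gr (level A n) q\<^esub> \<alpha> n x) \<oplus>\<^bsub>gr (forms A X) q\<^esub> \<alpha> = \<zero>\<^bsub>gr (forms A X) q\<^esub>"
      using \<alpha> by (auto simp: forms_ops fun_eq_iff forms_closed abelian_group.l_neg[OF ax])
    ultimately show "\<exists>\<beta>\<in>carrier (gr (forms A X) q). \<beta> \<oplus>\<^bsub>gr (forms A X) q\<^esub> \<alpha> = \<zero>\<^bsub>gr (forms A X) q\<^esub>" by blast
  next
    fix \<alpha> assume \<alpha>: "\<alpha> \<in> carrier (gr (forms A X) q)"
    show "\<zero>\<^bsub>gr (forms A X) q\<^esub> \<oplus>\<^bsub>gr (forms A X) q\<^esub> \<alpha> = \<alpha>"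
      by (rule forms_eqI[OF forms_add_closed[OF forms_zero_closed \<alpha>] \<alpha>])
        (simp add: forms_ops abelian_monoid.l_zero[OF mon] forms_closed[OF \<alpha>])
  qed (auto intro!: forms_cl simp: forms_ops fun_eq_iff forms_closed abelian_monoid.a_assoc[OF mon] abelian_monoid.a_comm[OF mon]
      forms_add_closed[unfolded forms_ops] forms_zero_closed[unfolded forms_ops])
next
  fix \<alpha> assume \<alpha>: "\<alpha> \<in> carrier (gr (forms A X) q)"
  show "\<one> \<odot>\<^bsub>gr (forms A X) q\<^esub> \<alpha> = \<alpha>"
    by (rule forms_eqI[OF forms_smult_closed[OF one_closed \<alpha>] \<alpha>])
      (simp add: forms_ops module.smult_one[OF level_module] forms_closed[OF \<alpha>])
qed (auto intro!: forms_cl simp: forms_ops fun_eq_iff forms_closed module.smult_l_distr[OF level_module]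
    module.smult_r_distr[OF level_module] module.smult_assoc1[OF level_module]
    forms_smult_closed[unfolded forms_ops])

lemma forms_value_linear:
  "x \<in> simplices X n \<Longrightarrow> (\<lambda>\<alpha>. \<alpha> n x) \<in> linear_maps R (gr (forms A X) q) (gr (level A n) q)"
  by (rule linear_mapsI) (auto simp: forms_closed, auto simp: forms_ops)

lemma forms_linearI:
  assumes "\<And>u. u \<in> carrier N \<Longrightarrow> F u \<in> carrier (gr (forms A X) q)"
    "\<And>n x. x \<in> simplices X n \<Longrightarrow> (\<lambda>u. F u n x) \<in> linear_maps R N (gr (level A n) q)"
    "\<And>u v. u \<in> carrier N \<Longrightarrow> v \<in> carrier N \<Longrightarrow> u \<oplus>\<^bsub>N\<^esub> v \<in> carrier N"
    "\<And>r u. r \<in> carrier R \<Longrightarrow> u \<in> carrier N \<Longrightarrow> r \<odot>\<^bsub>N\<^esub> u \<in> carrier N"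
  shows "F \<in> linear_maps R N (gr (forms A X) q)"
proof (rule linear_mapsI)
  fix u v assume uv: "u \<in> carrier N" "v \<in> carrier N"
  show "F (u \<oplus>\<^bsub>N\<^esub> v) = F u \<oplus>\<^bsub>gr (forms A X) q\<^esub> F v"
    by (rule forms_eqI[OF assms(1)[OF assms(3)[OF uv]] forms_add_closed[OF assms(1)[OF uv(1)] assms(1)[OF uv(2)]]])
      (simp add: forms_ops linear_add[OF assms(2) uv])
next
  fix r u assume ru: "r \<in> carrier R" "u \<in> carrier N"
  show "F (r \<odot>\<^bsub>N\<^esub> u) = r \<odot>\<^bsub>gr (forms A X) q\<^esub> F u"
    by (rule forms_eqI[OF assms(1)[OF assms(4)[OF ru]] forms_smult_closed[OF ru(1) assms(1)[OF ru(2)]]])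
      (simp add: forms_ops linear_smult[OF assms(2) ru])
qed (rule assms)

lemma forms_signed_value: "\<alpha> \<in> carrier (gr (forms A X) q) \<Longrightarrow> x \<in> simplices X n \<Longrightarrow>
    signed (gr (forms A X) q) k \<alpha> n x = signed (gr (level A n) q) k (\<alpha> n x)"
  using linear_signed[OF forms_module level_module forms_value_linear] .

text \<open>Every axiom is checked on values, where it is an axiom of one level. The theorem serves
  twice: for the forms with values in \<open>A\<close> and for those with values in
  \<open>cochain_sdga A\<close>.\<close>

theorem dg_algebra_forms: "dg_algebra R (forms A X)"
proof (intro dg_algebra.intro cochain_complex.intro cochain_complex_axioms.intro dg_algebra_axioms.intro)
  show "cring R" by (rule is_cring)
  show "module R (gr (forms A X) q)" for q by (rule forms_module)
  note L = dg_algebra.axioms(1)[OF level_dga]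
  show "diff (forms A X) q \<in> linear_maps R (gr (forms A X) q) (gr (forms A X) (Suc q))" for q
    using linear_comp[OF forms_value_linear level_diff_linear]
    by (intro forms_linearI) (auto intro!: forms_cl simp: forms_ops(4) forms_diff_closed[unfolded forms_ops])
  show "diff (forms A X) (Suc q) (diff (forms A X) q \<alpha>) = \<zero>\<^bsub>gr (forms A X) (Suc (Suc q))\<^esub>"
    if "\<alpha> \<in> carrier (gr (forms A X) q)" for \<alpha> q
    using that by (auto simp: forms_ops fun_eq_iff forms_closed cochain_complex.diff_diff[OF L])
  show "gmult (forms A X) p q \<alpha> \<in> linear_maps R (gr (forms A X) q) (gr (forms A X) (p + q))"
    if \<alpha>: "\<alpha> \<in> carrier (gr (forms A X) p)" for p q \<alpha>
    using linear_comp[OF forms_value_linear dg_algebra.gmult_linear_right[OF level_dga forms_closed[OF \<alpha>]]]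
    by (intro forms_linearI) (auto intro!: forms_cl \<alpha> simp: forms_ops(5) forms_gmult_closed[OF \<alpha>, unfolded forms_ops])
  show "(\<lambda>\<alpha>. gmult (forms A X) p q \<alpha> \<beta>) \<in> linear_maps R (gr (forms A X) p) (gr (forms A X) (p + q))"
    if \<beta>: "\<beta> \<in> carrier (gr (forms A X) q)" for p q \<beta>
    using linear_comp[OF forms_value_linear dg_algebra.gmult_linear_left[OF level_dga forms_closed[OF \<beta>]]]
    by (intro forms_linearI) (auto intro!: forms_cl \<beta> simp: forms_ops(5) forms_gmult_closed[OF _ \<beta>, unfolded forms_ops])
  show "gmult (forms A X) (p + q) r (gmult (forms A X) p q x y) z = gmult (forms A X) p (q + r) x (gmult (forms A X) q r y z)"
    if "x \<in> carrier (gr (forms A X) p)" "y \<in> carrier (gr (forms A X) q)" "z \<in> carrier (gr (forms A X) r)" for p q r x y z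
    using forms_closed[OF that(1)] forms_closed[OF that(2)] forms_closed[OF that(3)]
    by (auto simp: forms_ops(5) fun_eq_iff dg_algebra.gmult_assoc[OF level_dga])
  show "gone (forms A X) \<in> carrier (gr (forms A X) 0)" by (rule forms_gone_closed)
  show "gmult (forms A X) 0 q (gone (forms A X)) x = x" if x: "x \<in> carrier (gr (forms A X) q)" for q x
    using forms_gmult_closed[OF forms_gone_closed x]
    by (intro forms_eqI[OF _ x]) (auto simp: forms_ops(5,6) dg_algebra.gmult_one_left[OF level_dga] forms_closed[OF x])
  show "gmult (forms A X) q 0 x (gone (forms A X)) = x" if x: "x \<in> carrier (gr (forms A X) q)" for q x
    using forms_gmult_closed[OF x forms_gone_closed]
    by (intro forms_eqI[OF _ x]) (auto simp: forms_ops(5,6) dg_algebra.gmult_one_right[OF level_dga] forms_closed[OF x])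
  show "diff (forms A X) (p + q) (gmult (forms A X) p q x y) =
        gmult (forms A X) (Suc p) q (diff (forms A X) p x) y
          \<oplus>\<^bsub>gr (forms A X) (Suc (p + q))\<^esub> signed (gr (forms A X) (Suc (p + q))) p (gmult (forms A X) p (Suc q) x (diff (forms A X) q y))"
    if x: "x \<in> carrier (gr (forms A X) p)" and y: "y \<in> carrier (gr (forms A X) q)" for p q x y
  proof (rule forms_eqI)
    have 1: "gmult (forms A X) (Suc p) q (diff (forms A X) p x) y \<in> carrier (gr (forms A X) (Suc (p + q)))"
      using forms_gmult_closed[OF forms_diff_closed[OF x] y] by simp
    have 2: "gmult (forms A X) p (Suc q) x (diff (forms A X) q y) \<in> carrier (gr (forms A X) (Suc (p + q)))"
      using forms_gmult_closed[OF x forms_diff_closed[OF y]] by simp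
    show "diff (forms A X) (p + q) (gmult (forms A X) p q x y) \<in> carrier (gr (forms A X) (Suc (p + q)))"
      by (intro forms_cl x y)
    show "gmult (forms A X) (Suc p) q (diff (forms A X) p x) y
          \<oplus>\<^bsub>gr (forms A X) (Suc (p + q))\<^esub> signed (gr (forms A X) (Suc (p + q))) p (gmult (forms A X) p (Suc q) x (diff (forms A X) q y))
        \<in> carrier (gr (forms A X) (Suc (p + q)))"
      by (rule forms_add_closed[OF 1 abelian_group.signed_closed[OF module_abelian[OF forms_module] 2]])
    fix n \<sigma> assume \<sigma>: "\<sigma> \<in> simplices X n"
    show "diff (forms A X) (p + q) (gmult (forms A X) p q x y) n \<sigma> =
        (gmult (forms A X) (Suc p) q (diff (forms A X) p x) y
          \<oplus>\<^bsub>gr (forms A X) (Suc (p + q))\<^esub> signed (gr (forms A X) (Suc (p + q))) p (gmult (forms A X) p (Suc q) x (diff (forms A X) q y))) n \<sigma>"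
      using dg_algebra.leibniz[OF level_dga forms_closed[OF x \<sigma>] forms_closed[OF y \<sigma>]] \<sigma>
      unfolding forms_ops(1) by (simp add: forms_signed_value[OF 2 \<sigma>]) (simp add: forms_ops(4,5))
  qed
qed

end

section \<open>Exactness on natural families\<close>

text \<open>The element \<open>w\<close> is an edge of A^0 from 1 at vertex 0 to 0 at vertex 1, as
  provided by (b). The last three assumptions spell out (a): the cohomology of each level is R,
  spanned by the unit in degree 0.\<close>

locale acyclic_forms = forms_algebra R A X
  for R :: "('r, 'm) ring_scheme" (structure) and A :: "('r, 'a, 'n) sdga_scheme" and X :: "('x, 'k) sset_scheme" +
  fixes w :: 'a
  assumes w_closed: "w \<in> carrier (gr (level A 1) 0)"
    and w_start: "dact A 0 1 (\<lambda>j\<in>{..0}. 0) 0 w = gone (level A 0)"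
    and w_end: "dact A 0 1 (\<lambda>j\<in>{..0}. 1) 0 w = \<zero>\<^bsub>gr (level A 0) 0\<^esub>"
    and level_exact: "x \<in> carrier (gr (level A n) (Suc q)) \<Longrightarrow> diff (level A n) (Suc q) x = \<zero>\<^bsub>gr (level A n) (Suc (Suc q))\<^esub> \<Longrightarrow>
      \<exists>y\<in>carrier (gr (level A n) q). diff (level A n) q y = x"
    and level_kernel: "x \<in> carrier (gr (level A n) 0) \<Longrightarrow> diff (level A n) 0 x = \<zero>\<^bsub>gr (level A n) 1\<^esub> \<Longrightarrow>
      \<exists>r\<in>carrier R. x = r \<odot>\<^bsub>gr (level A n) 0\<^esub> gone (level A n)"
    and unit_injective: "r \<in> carrier R \<Longrightarrow> r \<odot>\<^bsub>gr (level A n) 0\<^esub> gone (level A n) = \<zero>\<^bsub>gr (level A n) 0\<^esub> \<Longrightarrow> r = \<zero>"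

section \<open>Kernels of natural operators on simplex cochains\<close>

context simplicial_dga
begin

abbreviation simplex_del :: "nat \<Rightarrow> nat \<Rightarrow> nat \<Rightarrow> ((nat \<Rightarrow> nat) \<Rightarrow> 'a) \<Rightarrow> ((nat \<Rightarrow> nat) \<Rightarrow> 'a)"
  where "simplex_del n \<equiv> del (simplex_cochains (level A n) n)"

abbreviation simplex_der :: "nat \<Rightarrow> nat \<Rightarrow> nat \<Rightarrow> ((nat \<Rightarrow> nat) \<Rightarrow> 'a) \<Rightarrow> ((nat \<Rightarrow> nat) \<Rightarrow> 'a)"
  where "simplex_der n \<equiv> der (simplex_cochains (level A n) n)"

lemma simplex_group: "abelian_group (simplex_module n a q)"
  by (rule module_abelian[OF simplex_module_module])

lemma simplex_del_linear: "simplex_del n a q \<in> linear_maps R (simplex_module n a q) (simplex_module n (Suc a) q)"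
  by (rule bigraded_algebra.del_linear[OF simplex_cochains_bigraded])

lemma simplex_der_linear: "simplex_der n a q \<in> linear_maps R (simplex_module n a q) (simplex_module n a (Suc q))"
  by (rule bigraded_algebra.der_linear[OF simplex_cochains_bigraded])

lemma simplex_memI: "(\<And>\<theta>. \<theta> \<in> ord_maps a n \<Longrightarrow> F \<theta> \<in> carrier (gr (level A n) q)) \<Longrightarrow>
    (\<lambda>\<theta>\<in>ord_maps a n. F \<theta>) \<in> carrier (simplex_module n a q)"
  by (simp add: simplex_cochains_simps pi_module_simps)

lemma simplex_zero_value: "\<theta> \<in> ord_maps a n \<Longrightarrow> \<zero>\<^bsub>simplex_module n a q\<^esub> \<theta> = \<zero>\<^bsub>gr (level A n) q\<^esub>"
  by (simp add: simplex_cochains_simps pi_module_simps)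

lemma simplex_zero_closed: "\<zero>\<^bsub>simplex_module n a q\<^esub> \<in> carrier (simplex_module n a q)"
  by (rule abelian_monoid.zero_closed[OF abelian_group.axioms(1)[OF simplex_group]])

lemma simplex_zeroI: "f \<in> carrier (simplex_module n a q) \<Longrightarrow>
    (\<And>\<theta>. \<theta> \<in> ord_maps a n \<Longrightarrow> f \<theta> = \<zero>\<^bsub>gr (level A n) q\<^esub>) \<Longrightarrow> f = \<zero>\<^bsub>simplex_module n a q\<^esub>"
  by (rule simplex_eqI) (auto simp: simplex_zero_value simplex_zero_closed)

lemma simplicial_ab_simplex_module:
  "simplicial_ab (\<lambda>n. simplex_module n a q) (\<lambda>m n \<phi>. simplex_pull A m n \<phi> a q)"
  by (rule simplicial_ab.intro)
    (auto simp: simplex_group linear_closed[OF simplex_pull_linear] linear_add[OF simplex_pull_linear]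
      simplex_pull_id simplex_pull_compose)

text \<open>The kernels of an operator that commutes with pullback form a simplicial subgroup, so
  all that a contraction has to supply is a homotopy that preserves them. This is shared by
  \<open>del\<close> and \<open>der\<close>.\<close>

lemma contracted_kernel:
  assumes u: "\<And>n. u n \<in> linear_maps R (simplex_module n a q) (simplex_module n b r)"
    and pull: "\<And>m n \<phi> f. \<phi> \<in> ord_maps m n \<Longrightarrow> f \<in> carrier (simplex_module n a q) \<Longrightarrow>
      simplex_pull A m n \<phi> b r (u n f) = u m (simplex_pull A m n \<phi> a q f)"
    and mu: "\<And>n \<sigma> f. \<sigma> \<in> ord_maps n 1 \<Longrightarrow> f \<in> carrier (simplex_module n a q) \<Longrightarrow> mu n \<sigma> f \<in> carrier (simplex_module n a q)"
      "\<And>n \<sigma> f. \<sigma> \<in> ord_maps n 1 \<Longrightarrow> f \<in> carrier (simplex_module n a q) \<Longrightarrow> u n f = \<zero>\<^bsub>simplex_module n b r\<^esub> \<Longrightarrow>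
        u n (mu n \<sigma> f) = \<zero>\<^bsub>simplex_module n b r\<^esub>"
      "\<And>n \<sigma>. \<sigma> \<in> ord_maps n 1 \<Longrightarrow> mu n \<sigma> \<zero>\<^bsub>simplex_module n a q\<^esub> = \<zero>\<^bsub>simplex_module n a q\<^esub>"
      "\<And>n f. f \<in> carrier (simplex_module n a q) \<Longrightarrow> mu n (\<lambda>j\<in>{..n}. 0) f = f"
      "\<And>n f. f \<in> carrier (simplex_module n a q) \<Longrightarrow> mu n (\<lambda>j\<in>{..n}. 1) f = \<zero>\<^bsub>simplex_module n a q\<^esub>"
      "\<And>m n \<theta> \<sigma> f. \<theta> \<in> ord_maps m n \<Longrightarrow> \<sigma> \<in> ord_maps n 1 \<Longrightarrow> f \<in> carrier (simplex_module n a q) \<Longrightarrow>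
        simplex_pull A m n \<theta> a q (mu n \<sigma> f) = mu m (compose {..m} \<sigma> \<theta>) (simplex_pull A m n \<theta> a q f)"
  shows "contracted (\<lambda>n. simplex_module n a q) (\<lambda>m n \<phi>. simplex_pull A m n \<phi> a q)
    (\<lambda>n. {f \<in> carrier (simplex_module n a q). u n f = \<zero>\<^bsub>simplex_module n b r\<^esub>}) mu"
proof (intro contracted.intro contracted_axioms.intro simplicial_ab_simplex_module)
  note lin = simplex_module_module simplex_module_module u
  note mon = abelian_group.axioms(1)[OF simplex_group]
  note ops = linear_zero[OF lin] linear_add[OF u] linear_uminus[OF lin] simplex_zero_closed
    abelian_group.a_inv_closed[OF simplex_group] abelian_monoid.a_closed[OF mon]
    abelian_monoid.l_zero[OF mon] abelian_group.r_neg[OF simplex_group]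
  have neg0: "\<ominus>\<^bsub>simplex_module n c s\<^esub> \<zero>\<^bsub>simplex_module n c s\<^esub> = \<zero>\<^bsub>simplex_module n c s\<^esub>" for n c s
    using abelian_group.signed_zero[OF simplex_group, of n c s 1] by (simp add: signed_def)
  show "{f \<in> carrier (simplex_module n a q). u n f = \<zero>\<^bsub>simplex_module n b r\<^esub>} \<subseteq> carrier (simplex_module n a q)" for n by blast
  show "\<zero>\<^bsub>simplex_module n a q\<^esub> \<in> {f \<in> carrier (simplex_module n a q). u n f = \<zero>\<^bsub>simplex_module n b r\<^esub>}" for n
    by (simp add: ops)
  show "x \<oplus>\<^bsub>simplex_module n a q\<^esub> y \<in> {f \<in> carrier (simplex_module n a q). u n f = \<zero>\<^bsub>simplex_module n b r\<^esub>}"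
    if "x \<in> {f \<in> carrier (simplex_module n a q). u n f = \<zero>\<^bsub>simplex_module n b r\<^esub>}"
      "y \<in> {f \<in> carrier (simplex_module n a q). u n f = \<zero>\<^bsub>simplex_module n b r\<^esub>}" for x y n
    using that by (simp add: ops)
  show "\<ominus>\<^bsub>simplex_module n a q\<^esub> x \<in> {f \<in> carrier (simplex_module n a q). u n f = \<zero>\<^bsub>simplex_module n b r\<^esub>}"
    if "x \<in> {f \<in> carrier (simplex_module n a q). u n f = \<zero>\<^bsub>simplex_module n b r\<^esub>}" for x n
    using that by (simp add: ops neg0)
  show "simplex_pull A m n \<theta> a q x \<in> {f \<in> carrier (simplex_module m a q). u m f = \<zero>\<^bsub>simplex_module m b r\<^esub>}"
    if "\<theta> \<in> ord_maps m n" "x \<in> {f \<in> carrier (simplex_module n a q). u n f = \<zero>\<^bsub>simplex_module n b r\<^esub>}" for \<theta> m n x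
    using that pull[of \<theta> m n x]
    by (auto simp: linear_closed[OF simplex_pull_linear] linear_zero[OF simplex_module_module simplex_module_module simplex_pull_linear])
qed (use mu in auto)

end

section \<open>Natural families over X\<close>

context forms_algebra
begin

text \<open>The elements of \<open>E\<close> in a single bidegree, without a convention about values
  off the simplices of X.\<close>

definition natural_family :: "nat \<Rightarrow> nat \<Rightarrow> (nat \<Rightarrow> 'x \<Rightarrow> (nat \<Rightarrow> nat) \<Rightarrow> 'a) \<Rightarrow> bool"
  where "natural_family a q F \<longleftrightarrow>
    (\<forall>n. \<forall>x\<in>simplices X n. F n x \<in> carrier (simplex_module n a q)) \<and>
    (\<forall>m n. \<forall>\<theta>\<in>ord_maps m n. \<forall>x\<in>simplices X n. F m (act X m n \<theta> x) = simplex_pull A m n \<theta> a q (F n x))"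

lemma natural_family_closed: "natural_family a q F \<Longrightarrow> x \<in> simplices X n \<Longrightarrow> F n x \<in> carrier (simplex_module n a q)"
  by (simp add: natural_family_def)

lemma natural_family_act: "natural_family a q F \<Longrightarrow> \<theta> \<in> ord_maps m n \<Longrightarrow> x \<in> simplices X n \<Longrightarrow>
    F m (act X m n \<theta> x) = simplex_pull A m n \<theta> a q (F n x)"
  by (simp add: natural_family_def)

text \<open>The solutions of u f = F n x form a coset of the kernel of \<open>u\<close>. So
  solutions found separately for each simplex, without any naturality, can be exchanged for natural
  ones by \<open>natural_section\<close>.\<close>

lemma natural_family_lift:
  assumes u: "\<And>n. u n \<in> linear_maps R (simplex_module n a q) (simplex_module n b r)"
    and pull: "\<And>m n \<phi> f. \<phi> \<in> ord_maps m n \<Longrightarrow> f \<in> carrier (simplex_module n a q) \<Longrightarrow>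
      simplex_pull A m n \<phi> b r (u n f) = u m (simplex_pull A m n \<phi> a q f)"
    and contr: "contracted (\<lambda>n. simplex_module n a q) (\<lambda>m n \<phi>. simplex_pull A m n \<phi> a q)
      (\<lambda>n. {f \<in> carrier (simplex_module n a q). u n f = \<zero>\<^bsub>simplex_module n b r\<^esub>}) mu"
    and F: "natural_family b r F"
    and surj: "\<And>n x. x \<in> simplices X n \<Longrightarrow> \<exists>f\<in>carrier (simplex_module n a q). u n f = F n x"
  obtains U where "natural_family a q U" "\<And>n x. x \<in> simplices X n \<Longrightarrow> u n (U n x) = F n x"
proof -
  interpret contracted "\<lambda>n. simplex_module n a q" "\<lambda>m n \<phi>. simplex_pull A m n \<phi> a q"
    "\<lambda>n. {f \<in> carrier (simplex_module n a q). u n f = \<zero>\<^bsub>simplex_module n b r\<^esub>}" mu by (rule contr)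
  note lin = simplex_module_module simplex_module_module u
  obtain U where U: "\<And>n x. x \<in> simplices X n \<Longrightarrow> U n x \<in> {f \<in> carrier (simplex_module n a q). u n f = F n x}"
    "\<And>m n \<theta> x. \<theta> \<in> ord_maps m n \<Longrightarrow> x \<in> simplices X n \<Longrightarrow> U m (act X m n \<theta> x) = simplex_pull A m n \<theta> a q (U n x)"
  proof (rule natural_section[OF X.simplicial_set_axioms, of "\<lambda>n x. {f \<in> carrier (simplex_module n a q). u n f = F n x}"])
    fix n x assume x: "x \<in> simplices X n"
    note Fx = natural_family_closed[OF F x]
    interpret M: abelian_group "simplex_module n a q" by (rule simplex_group)
    interpret N: abelian_group "simplex_module n b r" by (rule simplex_group)
    show "{f \<in> carrier (simplex_module n a q). u n f = F n x} \<noteq> {}" using surj[OF x] by blast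
    show "m \<ominus>\<^bsub>simplex_module n a q\<^esub> m' \<in> {f \<in> carrier (simplex_module n a q). u n f = \<zero>\<^bsub>simplex_module n b r\<^esub>}"
      if "m \<in> {f \<in> carrier (simplex_module n a q). u n f = F n x}" "m' \<in> {f \<in> carrier (simplex_module n a q). u n f = F n x}" for m m'
      using that Fx by (simp add: linear_minus[OF lin] N.minus_eq N.r_neg)
    show "m \<ominus>\<^bsub>simplex_module n a q\<^esub> k \<in> {f \<in> carrier (simplex_module n a q). u n f = F n x}"
      if "m \<in> {f \<in> carrier (simplex_module n a q). u n f = F n x}"
        "k \<in> {f \<in> carrier (simplex_module n a q). u n f = \<zero>\<^bsub>simplex_module n b r\<^esub>}" for m k
      using that Fx by (simp add: linear_minus[OF lin] N.minus_eq)
    show "simplex_pull A n' n \<theta> a q m \<in> {f \<in> carrier (simplex_module n' a q). u n' f = F n' (act X n' n \<theta> x)}"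
      if "\<theta> \<in> ord_maps n' n" "m \<in> {f \<in> carrier (simplex_module n a q). u n f = F n x}" for \<theta> n' m
      using that pull[OF that(1), of m] natural_family_act[OF F that(1) x]
      by (simp add: linear_closed[OF simplex_pull_linear])
  qed (use that in auto)
  show thesis by (rule that) (use U in \<open>auto simp: natural_family_def\<close>)
qed

end

section \<open>Exactness of the rows\<close>

context acyclic_forms
begin

text \<open>The vertex 0 of [n] is put in front of the simplex. This stays monotone because 0 is
  least, and it may produce a degenerate simplex.\<close>

abbreviation cone :: "nat \<Rightarrow> (nat \<Rightarrow> nat) \<Rightarrow> nat \<Rightarrow> nat"
  where "cone a \<theta> \<equiv> (\<lambda>j\<in>{..Suc a}. case j of 0 \<Rightarrow> 0 | Suc k \<Rightarrow> \<theta> k)"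

lemma w_pull_closed: "\<sigma> \<in> ord_maps n 1 \<Longrightarrow> dact A n 1 \<sigma> 0 w \<in> carrier (gr (level A n) 0)"
  using dact_closed w_closed by blast

text \<open>A constant map factors through [0], where the path takes its end values, and pullback
  from level 0 preserves unit and zero.\<close>

lemma w_const: "dact A n 1 (\<lambda>j\<in>{..n}. 0) 0 w = gone (level A n)"
    "dact A n 1 (\<lambda>j\<in>{..n}. 1) 0 w = \<zero>\<^bsub>gr (level A n) 0\<^esub>"
proof -
  have c: "(\<lambda>j\<in>{..n}. 0) \<in> ord_maps n 0" by (rule const_ord_maps) simp
  have v: "(\<lambda>j\<in>{..0}. 0) \<in> ord_maps 0 1" "(\<lambda>j\<in>{..0}. 1) \<in> ord_maps 0 1" by (rule const_ord_maps, simp)+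
  have e: "compose {..n} (\<lambda>j\<in>{..0::nat}. i) (\<lambda>j\<in>{..n}. 0) = (\<lambda>j\<in>{..n}. i)" for i :: nat
    by (auto simp: compose_def fun_eq_iff)
  show "dact A n 1 (\<lambda>j\<in>{..n}. 0) 0 w = gone (level A n)"
    using dact_compose[OF c v(1) w_closed] dga_hom_one[OF dact_hom[OF c]] unfolding e w_start by simp
  show "dact A n 1 (\<lambda>j\<in>{..n}. 1) 0 w = \<zero>\<^bsub>gr (level A n) 0\<^esub>"
    using dact_compose[OF c v(2) w_closed] linear_zero[OF level_module level_module dact_linear[OF c]]
    unfolding e w_end by simp
qed

text \<open>A simplex \<sigma> of the interval pulls the path back to an element of A_n of degree 0.
  This factor does not depend on \<theta>, so multiplication by it commutes with the alternating
  sums of \<open>del\<close>; at the two ends of the interval it is 1 and 0.\<close>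

definition path_mult :: "nat \<Rightarrow> nat \<Rightarrow> nat \<Rightarrow> (nat \<Rightarrow> nat) \<Rightarrow> ((nat \<Rightarrow> nat) \<Rightarrow> 'a) \<Rightarrow> ((nat \<Rightarrow> nat) \<Rightarrow> 'a)"
  where "path_mult a q n \<sigma> f = (\<lambda>\<theta>\<in>ord_maps a n. gmult (level A n) 0 q (dact A n 1 \<sigma> 0 w) (f \<theta>))"

lemma path_mult_linear: "\<sigma> \<in> ord_maps n 1 \<Longrightarrow>
    gmult (level A n) 0 q (dact A n 1 \<sigma> 0 w) \<in> linear_maps R (gr (level A n) q) (gr (level A n) q)"
  using dg_algebra.gmult_linear_right[OF level_dga w_pull_closed, of \<sigma> n q] by simp

lemma contracted_del_kernel:
  "contracted (\<lambda>n. simplex_module n a q) (\<lambda>m n \<phi>. simplex_pull A m n \<phi> a q)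
    (\<lambda>n. {f \<in> carrier (simplex_module n a q). simplex_del n a q f = \<zero>\<^bsub>simplex_module n (Suc a) q\<^esub>}) (path_mult a q)"
proof (rule contracted_kernel[OF simplex_del_linear])
  note pl = linear_closed[OF path_mult_linear]
  have closed: "path_mult b q n \<sigma> f \<in> carrier (simplex_module n b q)"
    if "\<sigma> \<in> ord_maps n 1" "f \<in> carrier (simplex_module n b q)" for b n \<sigma> f
    unfolding path_mult_def using that by (intro simplex_memI pl simplex_value)
  have zero: "path_mult b q n \<sigma> \<zero>\<^bsub>simplex_module n b q\<^esub> = \<zero>\<^bsub>simplex_module n b q\<^esub>" if "\<sigma> \<in> ord_maps n 1" for b n \<sigma>
    by (rule simplex_zeroI[OF closed[OF that simplex_zero_closed]])
      (simp add: path_mult_def simplex_zero_value linear_zero[OF level_module level_module path_mult_linear[OF that]] del: One_nat_def)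
  show "path_mult a q n \<sigma> f \<in> carrier (simplex_module n a q)"
    if "\<sigma> \<in> ord_maps n 1" "f \<in> carrier (simplex_module n a q)" for n \<sigma> f
    by (rule closed[OF that])
  show "path_mult a q n \<sigma> \<zero>\<^bsub>simplex_module n a q\<^esub> = \<zero>\<^bsub>simplex_module n a q\<^esub>" if "\<sigma> \<in> ord_maps n 1" for n \<sigma>
    by (rule zero[OF that])
  show "simplex_pull A m n \<phi> (Suc a) q (simplex_del n a q f) = simplex_del m a q (simplex_pull A m n \<phi> a q f)"
    if "\<phi> \<in> ord_maps m n" "f \<in> carrier (simplex_module n a q)" for m n \<phi> f
    by (rule bigraded_hom.f_del[OF bigraded_hom_simplex_pull[OF that(1)] that(2)])
  show "simplex_del n a q (path_mult a q n \<sigma> f) = \<zero>\<^bsub>simplex_module n (Suc a) q\<^esub>"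
    if \<sigma>: "\<sigma> \<in> ord_maps n 1" and f: "f \<in> carrier (simplex_module n a q)" and df: "simplex_del n a q f = \<zero>\<^bsub>simplex_module n (Suc a) q\<^esub>" for n \<sigma> f
  proof -
    have "simplex_del n a q (path_mult a q n \<sigma> f) = path_mult (Suc a) q n \<sigma> (simplex_del n a q f)"
    proof (rule simplex_eqI[OF linear_closed[OF simplex_del_linear closed[OF \<sigma> f]] closed[OF \<sigma> linear_closed[OF simplex_del_linear f]]])
      fix \<theta> assume \<theta>: "\<theta> \<in> ord_maps (Suc a) n"
      show "simplex_del n a q (path_mult a q n \<sigma> f) \<theta> = path_mult (Suc a) q n \<sigma> (simplex_del n a q f) \<theta>"
        using linear_altsum_eq[OF level_module level_module path_mult_linear[OF \<sigma>] simplex_value[OF compose_coface_ord_maps[OF \<theta>] f],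
            of "Suc a" "\<lambda>i. i"] \<theta> compose_coface_ord_maps[OF \<theta>]
        by (simp add: path_mult_def simplex_cochains_simps(2))
    qed
    then show ?thesis by (simp add: df zero[OF \<sigma>])
  qed
  show "path_mult a q n (\<lambda>j\<in>{..n}. 0) f = f" if f: "f \<in> carrier (simplex_module n a q)" for n f
    by (rule simplex_eqI[OF closed[OF const_ord_maps f] f])
      (simp_all add: path_mult_def w_const dg_algebra.gmult_one_left[OF level_dga] simplex_value[OF _ f] del: One_nat_def)
  show "path_mult a q n (\<lambda>j\<in>{..n}. 1) f = \<zero>\<^bsub>simplex_module n a q\<^esub>" if f: "f \<in> carrier (simplex_module n a q)" for n f
  proof (rule simplex_zeroI[OF closed[OF const_ord_maps f]])
    fix \<theta> assume \<theta>: "\<theta> \<in> ord_maps a n"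
    show "path_mult a q n (\<lambda>j\<in>{..n}. 1) f \<theta> = \<zero>\<^bsub>gr (level A n) q\<^esub>"
      using linear_zero[OF level_module level_module dg_algebra.gmult_linear_left[OF level_dga simplex_value[OF \<theta> f]], of 0] \<theta>
      unfolding path_mult_def w_const by simp
  qed simp
  show "simplex_pull A m n \<theta> a q (path_mult a q n \<sigma> f) = path_mult a q m (compose {..m} \<sigma> \<theta>) (simplex_pull A m n \<theta> a q f)"
    if \<theta>: "\<theta> \<in> ord_maps m n" and \<sigma>: "\<sigma> \<in> ord_maps n 1" and f: "f \<in> carrier (simplex_module n a q)" for m n \<theta> \<sigma> f
  proof (rule simplex_eqI[OF linear_closed[OF simplex_pull_linear[OF \<theta>] closed[OF \<sigma> f]]
        closed[OF compose_ord_maps[OF \<theta> \<sigma>] linear_closed[OF simplex_pull_linear[OF \<theta>] f]]])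
    fix \<psi> assume \<psi>: "\<psi> \<in> ord_maps a m"
    note c = compose_ord_maps[OF \<psi> \<theta>]
    show "simplex_pull A m n \<theta> a q (path_mult a q n \<sigma> f) \<psi> =
        path_mult a q m (compose {..m} \<sigma> \<theta>) (simplex_pull A m n \<theta> a q f) \<psi>"
      using dga_hom_mult[OF dact_hom[OF \<theta>] w_pull_closed[OF \<sigma>] simplex_value[OF c f]] dact_compose[OF \<theta> \<sigma> w_closed] \<psi> c
      by (simp add: simplex_pull_value path_mult_def)
  qed
qed

lemma cone_ord_maps: "\<theta> \<in> ord_maps a n \<Longrightarrow> cone a \<theta> \<in> ord_maps (Suc a) n"
  by (rule ord_mapsI) (auto split: nat.split simp: ord_maps_le ord_maps_mono)

text \<open>Coning off vertex 0 solves the equation on each simplex. A monotone map need not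
  preserve vertex 0, so these solutions are not natural and are only used to show that the cosets
  are nonempty.\<close>

lemma del_exact:
  assumes F: "natural_family (Suc a) q F"
    and dF: "\<And>n x. x \<in> simplices X n \<Longrightarrow> simplex_del n (Suc a) q (F n x) = \<zero>\<^bsub>simplex_module n (Suc (Suc a)) q\<^esub>"
  obtains U where "natural_family a q U" "\<And>n x. x \<in> simplices X n \<Longrightarrow> simplex_del n a q (U n x) = F n x"
proof (rule natural_family_lift[OF simplex_del_linear _ contracted_del_kernel F])
  show "simplex_pull A m n \<phi> (Suc a) q (simplex_del n a q f) = simplex_del m a q (simplex_pull A m n \<phi> a q f)"
    if "\<phi> \<in> ord_maps m n" "f \<in> carrier (simplex_module n a q)" for m n \<phi> f
    by (rule bigraded_hom.f_del[OF bigraded_hom_simplex_pull[OF that(1)] that(2)])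
  fix n x assume x: "x \<in> simplices X n"
  define f where "f = F n x"
  have f: "f \<in> carrier (simplex_module n (Suc a) q)" using natural_family_closed[OF F x] by (simp add: f_def)
  define u where "u = (\<lambda>\<theta>\<in>ord_maps a n. f (cone a \<theta>))"
  have u: "u \<in> carrier (simplex_module n a q)"
    unfolding u_def by (intro simplex_memI simplex_value[OF _ f] cone_ord_maps)
  have "simplex_del n a q u = f"
  proof (rule simplex_eqI[OF linear_closed[OF simplex_del_linear u] f])
    fix \<theta> assume \<theta>: "\<theta> \<in> ord_maps (Suc a) n"
    interpret M: abelian_group "gr (level A n) q" by (rule module_abelian[OF level_module])
    note c = cone_ord_maps[OF \<theta>]
    note cl = simplex_value[OF compose_coface_ord_maps[OF c] f]
    \<comment> \<open>Face 0 of a cone is its base and every other face is the cone over a face of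
      the base. So the cocycle condition on the cone expresses \<open>f\<close> at \<theta> as a
      coboundary.\<close>
    have c0: "compose {..Suc a} (cone (Suc a) \<theta>) (coface (Suc a) 0) = \<theta>"
      using ord_maps_undefined[OF \<theta>] by (auto simp: compose_def coface_def fun_eq_iff)
    have cS: "compose {..Suc a} (cone (Suc a) \<theta>) (coface (Suc a) (Suc i)) = cone a (compose {..a} \<theta> (coface a i))" for i
      by (auto simp: compose_def coface_def fun_eq_iff split: nat.split)
    have "\<zero>\<^bsub>gr (level A n) q\<^esub> = simplex_del n (Suc a) q f (cone (Suc a) \<theta>)"
      using dF[OF x] c by (simp add: f_def simplex_zero_value)
    also have "\<dots> = altsum (gr (level A n) q) (Suc (Suc a)) (\<lambda>i. f (compose {..Suc a} (cone (Suc a) \<theta>) (coface (Suc a) i)))"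
      using c by (simp add: simplex_cochains_simps(2))
    also have "\<dots> = f \<theta> \<ominus>\<^bsub>gr (level A n) q\<^esub> altsum (gr (level A n) q) (Suc a) (\<lambda>i. f (cone a (compose {..a} \<theta> (coface a i))))"
      using cl by (subst M.altsum_first) (simp_all only: c0 cS)
    also have "altsum (gr (level A n) q) (Suc a) (\<lambda>i. f (cone a (compose {..a} \<theta> (coface a i)))) = simplex_del n a q u \<theta>"
      using \<theta> compose_coface_ord_maps[OF \<theta>] by (simp add: simplex_cochains_simps(2) u_def)
    finally have "f \<theta> \<ominus>\<^bsub>gr (level A n) q\<^esub> simplex_del n a q u \<theta> = \<zero>\<^bsub>gr (level A n) q\<^esub>" by (rule sym)
    then show "simplex_del n a q u \<theta> = f \<theta>"
      by (rule M.minus_zeroD[OF simplex_value[OF \<theta> f] simplex_value[OF \<theta> linear_closed[OF simplex_del_linear u]], symmetric])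
  qed
  then show "\<exists>u\<in>carrier (simplex_module n a q). simplex_del n a q u = F n x" using u f_def by blast
qed (rule that)

text \<open>The cocycle condition on the edge from vertex 0 to any other vertex makes a 0-cocycle
  constant on vertices. The common value is a natural element of A_n, that is, a form.\<close>

lemma del_kernel:
  assumes F: "natural_family 0 q F"
    and dF: "\<And>n x. x \<in> simplices X n \<Longrightarrow> simplex_del n 0 q (F n x) = \<zero>\<^bsub>simplex_module n 1 q\<^esub>"
  obtains \<alpha> where "\<alpha> \<in> carrier (gr (forms A X) q)"
    "\<And>n x. x \<in> simplices X n \<Longrightarrow> F n x = (\<lambda>\<theta>\<in>ord_maps 0 n. \<alpha> n x)"
proof -
  let ?c = "\<lambda>i. (\<lambda>j\<in>{..0}. i) :: nat \<Rightarrow> nat"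
  have c: "?c i \<in> ord_maps 0 n" if "i \<le> n" for i n using that by (rule const_ord_maps)
  have const: "F n x \<theta> = F n x (?c 0)" if x: "x \<in> simplices X n" and \<theta>: "\<theta> \<in> ord_maps 0 n" for n x \<theta>
  proof -
    interpret M: abelian_group "gr (level A n) q" by (rule module_abelian[OF level_module])
    note f = natural_family_closed[OF F x]
    note cl = simplex_value[OF compose_coface_ord_maps[OF cone_ord_maps[OF \<theta>]] f]
    have e: "compose {..0} (cone 0 \<theta>) (coface 0 0) = \<theta>" "compose {..0} (cone 0 \<theta>) (coface 0 (Suc 0)) = ?c 0"
      using ord_maps_undefined[OF \<theta>] by (auto simp: compose_def coface_def fun_eq_iff)
    have "\<zero>\<^bsub>gr (level A n) q\<^esub> = simplex_del n 0 q (F n x) (cone 0 \<theta>)"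
      using dF[OF x] cone_ord_maps[OF \<theta>] by (simp add: simplex_zero_value)
    also have "\<dots> = F n x \<theta> \<ominus>\<^bsub>gr (level A n) q\<^esub> F n x (?c 0)"
      using cone_ord_maps[OF \<theta>] M.altsum_first[OF cl, of 0 "\<lambda>i. i"] M.altsum_0[of "\<lambda>i. F n x (compose {..0} (cone 0 \<theta>) (coface 0 (Suc i)))", OF cl]
      by (simp only: e simplex_cochains_simps(2) restrict_apply if_True)
    finally have "F n x \<theta> \<ominus>\<^bsub>gr (level A n) q\<^esub> F n x (?c 0) = \<zero>\<^bsub>gr (level A n) q\<^esub>" by (rule sym)
    then show ?thesis by (rule M.minus_zeroD[OF simplex_value[OF \<theta> f] simplex_value[OF c f], rotated]) simp
  qed
  define \<alpha> where "\<alpha> = (\<lambda>n. \<lambda>x\<in>simplices X n. F n x (?c 0))"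
  have "\<alpha> \<in> carrier (gr (forms A X) q)"
    unfolding \<alpha>_def
  proof (rule forms_memI)
    fix n x assume "x \<in> simplices X n"
    then show "F n x (?c 0) \<in> carrier (gr (level A n) q)"
      by (rule simplex_value[OF c natural_family_closed[OF F], rotated]) simp
  next
    fix m n \<theta> x assume \<theta>: "\<theta> \<in> ord_maps m n" and x: "x \<in> simplices X n"
    \<comment> \<open>The map may move vertex 0; constancy brings the value at its image back to the
      value at 0.\<close>
    have "compose {..0} \<theta> (?c 0) \<in> ord_maps 0 n" by (rule compose_ord_maps[OF c \<theta>]) simp
    then show "F m (act X m n \<theta> x) (?c 0) = dact A m n \<theta> q (F n x (?c 0))"
      using const[OF x] c[of 0 m] by (simp add: natural_family_act[OF F \<theta> x] simplex_pull_value del: atMost_0)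
  qed
  moreover have "F n x = (\<lambda>\<theta>\<in>ord_maps 0 n. \<alpha> n x)" if x: "x \<in> simplices X n" for n x
  proof (rule simplex_eqI[OF natural_family_closed[OF F x] simplex_memI])
    show "\<alpha> n x \<in> carrier (gr (level A n) q)" using calculation x by (rule forms_closed)
  qed (use const[OF x] x in \<open>simp add: \<alpha>_def\<close>)
  ultimately show thesis by (rule that)
qed

section \<open>Exactness of the columns\<close>

definition vertex_cut :: "nat \<Rightarrow> nat \<Rightarrow> nat \<Rightarrow> (nat \<Rightarrow> nat) \<Rightarrow> ((nat \<Rightarrow> nat) \<Rightarrow> 'a) \<Rightarrow> ((nat \<Rightarrow> nat) \<Rightarrow> 'a)"
  where "vertex_cut a q n \<sigma> f = (\<lambda>\<theta>\<in>ord_maps a n. if \<sigma> (\<theta> 0) = 0 then f \<theta> else \<zero>\<^bsub>gr (level A n) q\<^esub>)"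

text \<open>The cut keeps or discards each value of a cochain as a whole, so closed values stay
  closed. It keeps everything at the end 0 of the interval and nothing at the end 1, and it is
  natural because the first vertex of a composite is the image of the first vertex.\<close>

lemma contracted_der_kernel:
  "contracted (\<lambda>n. simplex_module n a q) (\<lambda>m n \<phi>. simplex_pull A m n \<phi> a q)
    (\<lambda>n. {f \<in> carrier (simplex_module n a q). simplex_der n a q f = \<zero>\<^bsub>simplex_module n a (Suc q)\<^esub>}) (vertex_cut a q)"
proof (rule contracted_kernel[OF simplex_der_linear])
  have zcl: "\<zero>\<^bsub>gr (level A n) r\<^esub> \<in> carrier (gr (level A n) r)" for n r
    by (rule abelian_monoid.zero_closed[OF abelian_group.axioms(1)[OF module_abelian[OF level_module]]])
  have closed: "vertex_cut a q n \<sigma> f \<in> carrier (simplex_module n a q)"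
    if "f \<in> carrier (simplex_module n a q)" for n \<sigma> f
    unfolding vertex_cut_def using simplex_value[OF _ that] zcl by (intro simplex_memI) auto
  then show "vertex_cut a q n \<sigma> f \<in> carrier (simplex_module n a q)"
    if "f \<in> carrier (simplex_module n a q)" for n \<sigma> f using that .
  show "vertex_cut a q n \<sigma> \<zero>\<^bsub>simplex_module n a q\<^esub> = \<zero>\<^bsub>simplex_module n a q\<^esub>" for n \<sigma>
    by (rule simplex_zeroI[OF closed[OF simplex_zero_closed]]) (simp add: vertex_cut_def simplex_zero_value)
  show "simplex_pull A m n \<phi> a (Suc q) (simplex_der n a q f) = simplex_der m a q (simplex_pull A m n \<phi> a q f)"
    if "\<phi> \<in> ord_maps m n" "f \<in> carrier (simplex_module n a q)" for m n \<phi> f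
    by (rule bigraded_hom.f_der[OF bigraded_hom_simplex_pull[OF that(1)] that(2)])
  show "simplex_der n a q (vertex_cut a q n \<sigma> f) = \<zero>\<^bsub>simplex_module n a (Suc q)\<^esub>"
    if f: "f \<in> carrier (simplex_module n a q)" and df: "simplex_der n a q f = \<zero>\<^bsub>simplex_module n a (Suc q)\<^esub>" for n \<sigma> f
  proof (rule simplex_zeroI[OF linear_closed[OF simplex_der_linear closed[OF f]]])
    fix \<theta> assume \<theta>: "\<theta> \<in> ord_maps a n"
    have "diff (level A n) q (f \<theta>) = \<zero>\<^bsub>gr (level A n) (Suc q)\<^esub>"
      using fun_cong[OF df, of \<theta>] \<theta> by (simp add: simplex_cochains_simps(3) simplex_zero_value)
    then show "simplex_der n a q (vertex_cut a q n \<sigma> f) \<theta> = \<zero>\<^bsub>gr (level A n) (Suc q)\<^esub>"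
      using \<theta> by (simp add: simplex_cochains_simps(3) vertex_cut_def linear_zero[OF level_module level_module level_diff_linear])
  qed
  show "vertex_cut a q n (\<lambda>j\<in>{..n}. 0) f = f" if f: "f \<in> carrier (simplex_module n a q)" for n f
    by (rule simplex_eqI[OF closed[OF f] f]) (simp add: vertex_cut_def ord_maps_le)
  show "vertex_cut a q n (\<lambda>j\<in>{..n}. 1) f = \<zero>\<^bsub>simplex_module n a q\<^esub>" if f: "f \<in> carrier (simplex_module n a q)" for n f
    by (rule simplex_zeroI[OF closed[OF f]]) (simp add: vertex_cut_def ord_maps_le)
  show "simplex_pull A m n \<theta> a q (vertex_cut a q n \<sigma> f) = vertex_cut a q m (compose {..m} \<sigma> \<theta>) (simplex_pull A m n \<theta> a q f)"
    if \<theta>: "\<theta> \<in> ord_maps m n" and \<sigma>: "\<sigma> \<in> ord_maps n 1" and f: "f \<in> carrier (simplex_module n a q)" for m n \<theta> \<sigma> f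
  proof (rule simplex_eqI[OF linear_closed[OF simplex_pull_linear[OF \<theta>] closed[OF f]]
        closed[OF linear_closed[OF simplex_pull_linear[OF \<theta>] f]]])
    fix \<psi> assume \<psi>: "\<psi> \<in> ord_maps a m"
    have "compose {..m} \<sigma> \<theta> (\<psi> 0) = \<sigma> (compose {..a} \<theta> \<psi> 0)"
      using ord_maps_le[OF \<psi>, of 0] by (simp add: compose_def)
    then show "simplex_pull A m n \<theta> a q (vertex_cut a q n \<sigma> f) \<psi> =
        vertex_cut a q m (compose {..m} \<sigma> \<theta>) (simplex_pull A m n \<theta> a q f) \<psi>"
      using \<psi> compose_ord_maps[OF \<psi> \<theta>]
      by (simp add: simplex_pull_value vertex_cut_def linear_zero[OF level_module level_module dact_linear[OF \<theta>]])
  qed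
qed

text \<open>Primitives are chosen independently at every argument by \<open>level_exact\<close>;
  making them natural is left to \<open>natural_family_lift\<close>.\<close>

lemma der_exact:
  assumes F: "natural_family a (Suc q) F"
    and dF: "\<And>n x. x \<in> simplices X n \<Longrightarrow> simplex_der n a (Suc q) (F n x) = \<zero>\<^bsub>simplex_module n a (Suc (Suc q))\<^esub>"
  obtains U where "natural_family a q U" "\<And>n x. x \<in> simplices X n \<Longrightarrow> simplex_der n a q (U n x) = F n x"
proof (rule natural_family_lift[OF simplex_der_linear _ contracted_der_kernel F])
  show "simplex_pull A m n \<phi> a (Suc q) (simplex_der n a q f) = simplex_der m a q (simplex_pull A m n \<phi> a q f)"
    if "\<phi> \<in> ord_maps m n" "f \<in> carrier (simplex_module n a q)" for m n \<phi> f
    by (rule bigraded_hom.f_der[OF bigraded_hom_simplex_pull[OF that(1)] that(2)])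
  fix n x assume x: "x \<in> simplices X n"
  note f = natural_family_closed[OF F x]
  have "\<exists>y\<in>carrier (gr (level A n) q). diff (level A n) q y = F n x \<theta>" if \<theta>: "\<theta> \<in> ord_maps a n" for \<theta>
    using fun_cong[OF dF[OF x], of \<theta>] \<theta>
    by (intro level_exact simplex_value[OF \<theta> f]) (simp add: simplex_cochains_simps(3) simplex_zero_value)
  then obtain y where y: "\<And>\<theta>. \<theta> \<in> ord_maps a n \<Longrightarrow> y \<theta> \<in> carrier (gr (level A n) q)"
    "\<And>\<theta>. \<theta> \<in> ord_maps a n \<Longrightarrow> diff (level A n) q (y \<theta>) = F n x \<theta>" by metis
  have u: "(\<lambda>\<theta>\<in>ord_maps a n. y \<theta>) \<in> carrier (simplex_module n a q)" by (rule simplex_memI[OF y(1)])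
  have "simplex_der n a q (\<lambda>\<theta>\<in>ord_maps a n. y \<theta>) = F n x"
    by (rule simplex_eqI[OF linear_closed[OF simplex_der_linear u] f]) (simp add: simplex_cochains_simps(3) y(2))
  then show "\<exists>u\<in>carrier (simplex_module n a q). simplex_der n a q u = F n x" using u by blast
qed (rule that)

text \<open>Closed values of degree 0 are multiples of the unit. Naturality along \<theta>
  identifies the scalar at \<theta> with the one at the identity over the simplex induced by
  \<theta>, so all scalars come from one function on the a-simplices of X.\<close>

lemma der_kernel:
  assumes F: "natural_family a 0 F"
    and dF: "\<And>n x. x \<in> simplices X n \<Longrightarrow> simplex_der n a 0 (F n x) = \<zero>\<^bsub>simplex_module n a 1\<^esub>"
  obtains c where "c \<in> simplices X a \<rightarrow>\<^sub>E carrier R"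
    "\<And>n x. x \<in> simplices X n \<Longrightarrow>
      F n x = (\<lambda>\<theta>\<in>ord_maps a n. c (act X a n \<theta> x) \<odot>\<^bsub>gr (level A n) 0\<^esub> gone (level A n))"
proof -
  have unit: "\<exists>r\<in>carrier R. F n x \<theta> = r \<odot>\<^bsub>gr (level A n) 0\<^esub> gone (level A n)"
    if x: "x \<in> simplices X n" and \<theta>: "\<theta> \<in> ord_maps a n" for n x \<theta>
    using fun_cong[OF dF[OF x], of \<theta>] \<theta>
    by (intro level_kernel simplex_value[OF \<theta> natural_family_closed[OF F x]])
      (simp add: simplex_cochains_simps(3) simplex_zero_value)
  \<comment> \<open>The scalars are only known through their multiples of the unit, so they must be
    determined by these.\<close>
  have unit_eq: "r = s"
    if rs: "r \<in> carrier R" "s \<in> carrier R"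
      and eq: "r \<odot>\<^bsub>gr (level A n) 0\<^esub> gone (level A n) = s \<odot>\<^bsub>gr (level A n) 0\<^esub> gone (level A n)" for r s n
  proof -
    interpret M: module R "gr (level A n) 0" by (rule level_module)
    have g: "gone (level A n) \<in> carrier (gr (level A n) 0)" by (rule dg_algebra.gone_closed[OF level_dga])
    have "(r \<ominus> s) \<odot>\<^bsub>gr (level A n) 0\<^esub> gone (level A n) = \<zero>\<^bsub>gr (level A n) 0\<^esub>"
      using rs g eq by (simp add: minus_eq M.smult_l_distr M.smult_l_minus M.r_neg)
    then have "r \<ominus> s = \<zero>" using rs by (intro unit_injective) auto
    then show ?thesis using rs by simp
  qed
  have "\<forall>x\<in>simplices X a. \<exists>r\<in>carrier R. F a x (\<lambda>i\<in>{..a}. i) = r \<odot>\<^bsub>gr (level A a) 0\<^esub> gone (level A a)"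
    using unit id_ord_maps by blast
  then obtain c0 where c0: "\<And>x. x \<in> simplices X a \<Longrightarrow> c0 x \<in> carrier R"
    "\<And>x. x \<in> simplices X a \<Longrightarrow> F a x (\<lambda>i\<in>{..a}. i) = c0 x \<odot>\<^bsub>gr (level A a) 0\<^esub> gone (level A a)" by metis
  have "F n x \<theta> = c0 (act X a n \<theta> x) \<odot>\<^bsub>gr (level A n) 0\<^esub> gone (level A n)"
    if x: "x \<in> simplices X n" and \<theta>: "\<theta> \<in> ord_maps a n" for n x \<theta>
  proof -
    note ax = X.act_closed[OF \<theta> x]
    obtain r where r: "r \<in> carrier R" "F n x \<theta> = r \<odot>\<^bsub>gr (level A n) 0\<^esub> gone (level A n)" using unit[OF x \<theta>] by blast
    have "c0 (act X a n \<theta> x) \<odot>\<^bsub>gr (level A a) 0\<^esub> gone (level A a) = F a (act X a n \<theta> x) (\<lambda>i\<in>{..a}. i)"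
      using c0(2)[OF ax] by simp
    also have "\<dots> = dact A a n \<theta> 0 (F n x \<theta>)"
      using id_ord_maps by (simp add: natural_family_act[OF F \<theta> x] simplex_pull_value compose_ord_maps_id[OF \<theta>])
    also have "\<dots> = r \<odot>\<^bsub>gr (level A a) 0\<^esub> gone (level A a)"
      by (simp add: r linear_smult[OF dact_linear[OF \<theta>]] dg_algebra.gone_closed[OF level_dga] dga_hom_one[OF dact_hom[OF \<theta>]])
    finally have "c0 (act X a n \<theta> x) = r" by (rule unit_eq[OF c0(1)[OF ax] r(1)])
    then show ?thesis using r(2) by simp
  qed
  moreover have "r \<odot>\<^bsub>gr (level A n) 0\<^esub> gone (level A n) \<in> carrier (gr (level A n) 0)" if "r \<in> carrier R" for r n
    by (rule module.smult_closed[OF level_module that dg_algebra.gone_closed[OF level_dga]])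
  ultimately show thesis
    using c0(1) X.act_closed
    by (intro that[of "\<lambda>x\<in>simplices X a. c0 x"]) (auto intro!: simplex_eqI[OF natural_family_closed[OF F]] simplex_memI)
qed

end

section \<open>Quasi-isomorphisms\<close>

context cochain_complex
begin

lemma gr_group: "abelian_group (gr C q)"
  by (rule module_abelian[OF gr_module])

lemma cocycle_group_simps:
  "carrier (cocycle_group C q) = {x \<in> carrier (gr C q). diff C q x = \<zero>\<^bsub>gr C (Suc q)\<^esub>}"
  "x \<otimes>\<^bsub>cocycle_group C q\<^esub> y = x \<oplus>\<^bsub>gr C q\<^esub> y"
  "\<one>\<^bsub>cocycle_group C q\<^esub> = \<zero>\<^bsub>gr C q\<^esub>"
  by (simp_all add: cocycle_group_def)

lemma comm_group_cocycle_group: "comm_group (cocycle_group C q)"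
proof -
  interpret M: module R "gr C q" by (rule gr_module)
  interpret N: module R "gr C (Suc q)" by (rule gr_module)
  note d = linear_add[OF diff_linear] linear_zero[OF gr_module gr_module diff_linear]
    linear_uminus[OF gr_module gr_module diff_linear]
  show ?thesis
  proof (rule comm_groupI)
    fix x assume "x \<in> carrier (cocycle_group C q)"
    then show "\<exists>y\<in>carrier (cocycle_group C q). y \<otimes>\<^bsub>cocycle_group C q\<^esub> x = \<one>\<^bsub>cocycle_group C q\<^esub>"
      by (intro bexI[of _ "\<ominus>\<^bsub>gr C q\<^esub> x"]) (auto simp: cocycle_group_simps d M.l_neg)
  qed (auto simp: cocycle_group_simps d M.a_ac)
qed

lemma coboundaries_subgroup: "subgroup (coboundaries C q) (cocycle_group C q)"
proof -
  interpret Z: comm_group "cocycle_group C q" by (rule comm_group_cocycle_group)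
  interpret M: module R "gr C q" by (rule gr_module)
  show ?thesis
  proof (cases q)
    case 0
    then show ?thesis using Z.triv_subgroup by (simp add: cocycle_group_simps)
  next
    case (Suc p)
    interpret N: module R "gr C p" by (rule gr_module)
    note d = linear_closed[OF diff_linear] linear_add[OF diff_linear]
    have sub: "coboundaries C q \<subseteq> carrier (cocycle_group C q)"
      using Suc d diff_diff by (auto simp: cocycle_group_simps)
    show ?thesis
    proof (rule Z.subgroupI[OF sub])
      show "coboundaries C q \<noteq> {}" using Suc N.zero_closed by auto
      fix y assume y: "y \<in> coboundaries C q"
      then obtain x where x: "x \<in> carrier (gr C p)" "y = diff C p x" using Suc by auto
      have neg: "diff C p (\<ominus>\<^bsub>gr C p\<^esub> x) \<in> coboundaries C q" using x Suc by auto
      have "diff C p (\<ominus>\<^bsub>gr C p\<^esub> x) \<otimes>\<^bsub>cocycle_group C q\<^esub> y = \<one>\<^bsub>cocycle_group C q\<^esub>"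
        using x Suc by (simp add: cocycle_group_simps d linear_uminus[OF gr_module gr_module diff_linear] abelian_group.l_neg[OF gr_group])
      then have "inv\<^bsub>cocycle_group C q\<^esub> y = diff C p (\<ominus>\<^bsub>gr C p\<^esub> x)"
        using Z.inv_equality y neg sub by blast
      then show "inv\<^bsub>cocycle_group C q\<^esub> y \<in> coboundaries C q" using neg by simp
      fix y' assume "y' \<in> coboundaries C q"
      then obtain x' where x': "x' \<in> carrier (gr C p)" "y' = diff C p x'" using Suc by auto
      have "y \<otimes>\<^bsub>cocycle_group C q\<^esub> y' = diff C p (x \<oplus>\<^bsub>gr C p\<^esub> x')"
        using x x' Suc by (simp add: cocycle_group_simps d)
      then show "y \<otimes>\<^bsub>cocycle_group C q\<^esub> y' \<in> coboundaries C q" using x x' Suc by auto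
    qed
  qed
qed

lemma coboundaries_normal: "normal (coboundaries C q) (cocycle_group C q)"
  by (rule comm_group.subgroup_imp_normal[OF comm_group_cocycle_group coboundaries_subgroup])

lemma coboundary_closed: "x \<in> coboundaries C q \<Longrightarrow> x \<in> carrier (gr C q) \<and> diff C q x = \<zero>\<^bsub>gr C (Suc q)\<^esub>"
  using subgroup.subset[OF coboundaries_subgroup, of q] by (auto simp: cocycle_group_simps)

lemma coboundaries_zero: "\<zero>\<^bsub>gr C q\<^esub> \<in> coboundaries C q"
  using subgroup.one_closed[OF coboundaries_subgroup, of q] by (simp add: cocycle_group_simps)

lemma coboundaries_add: "x \<in> coboundaries C q \<Longrightarrow> y \<in> coboundaries C q \<Longrightarrow> x \<oplus>\<^bsub>gr C q\<^esub> y \<in> coboundaries C q"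
  using subgroup.m_closed[OF coboundaries_subgroup, of x q y] by (simp add: cocycle_group_simps)

end

text \<open>The hypothesis \<open>lift\<close> says that the cokernel of the injective map \<open>f\<close> is acyclic.\<close>

theorem quasi_isoI:
  assumes C: "cochain_complex R C" and D: "cochain_complex R D" and f: "cochain_map R C D f"
    and inj: "\<And>q x. x \<in> carrier (gr C q) \<Longrightarrow> f q x = \<zero>\<^bsub>gr D q\<^esub> \<Longrightarrow> x = \<zero>\<^bsub>gr C q\<^esub>"
    and lift: "\<And>q y b. y \<in> carrier (gr D q) \<Longrightarrow> b \<in> carrier (gr C (Suc q)) \<Longrightarrow> diff D q y = f (Suc q) b \<Longrightarrow>
      \<exists>a\<in>carrier (gr C q). y \<ominus>\<^bsub>gr D q\<^esub> f q a \<in> coboundaries D q"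
  shows "quasi_iso R C D f"
proof -
  interpret C: cochain_complex R C by (rule C)
  interpret D: cochain_complex R D by (rule D)
  have f_lin: "f q \<in> linear_maps R (gr C q) (gr D q)"
    and f_diff: "x \<in> carrier (gr C q) \<Longrightarrow> f (Suc q) (diff C q x) = diff D q (f q x)" for q x
    using f by (auto simp: cochain_map_def)
  note fc = linear_closed[OF f_lin] and fa = linear_add[OF f_lin] and f0 = linear_zero[OF C.gr_module D.gr_module f_lin]
    and fm = linear_minus[OF C.gr_module D.gr_module f_lin]
    and dC = linear_closed[OF C.diff_linear] and dm = linear_minus[OF D.gr_module D.gr_module D.diff_linear]
    and dmC = linear_minus[OF C.gr_module C.gr_module C.diff_linear]
  have f_inj: "x = y" if "x \<in> carrier (gr C q)" "y \<in> carrier (gr C q)" "f q x = f q y" for q x y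
  proof -
    interpret MC: abelian_group "gr C q" by (rule C.gr_group)
    interpret MD: abelian_group "gr D q" by (rule D.gr_group)
    have "f q (x \<ominus>\<^bsub>gr C q\<^esub> y) = \<zero>\<^bsub>gr D q\<^esub>" using that fc[of y q] by (simp add: fm MD.minus_eq MD.r_neg)
    then have "x \<ominus>\<^bsub>gr C q\<^esub> y = \<zero>\<^bsub>gr C q\<^esub>" by (rule inj[rotated]) (simp add: that)
    then show ?thesis by (rule MC.minus_zeroD[OF that(1,2)])
  qed
  have f_cob: "f q x \<in> coboundaries D q" if x: "x \<in> coboundaries C q" for q x
  proof (cases q)
    case 0
    then show ?thesis using x f0 by simp
  next
    case (Suc p)
    then obtain y where "y \<in> carrier (gr C p)" "x = diff C p y" using x Suc by auto
    then show ?thesis using Suc f_diff fc by auto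
  qed
  \<comment> \<open>This gives injectivity on cohomology. If f x is the coboundary of y, replace y
    modulo coboundaries by some f a; then x and the coboundary of a have the same image, hence
    agree.\<close>
  have f_cob_iff: "x \<in> coboundaries C q" if x: "x \<in> carrier (gr C q)" "f q x \<in> coboundaries D q" for q x
  proof (cases q)
    case 0
    then show ?thesis using x inj by simp
  next
    case (Suc p)
    then obtain y where y: "y \<in> carrier (gr D p)" "f (Suc p) x = diff D p y" using x(2) by auto
    obtain a where a: "a \<in> carrier (gr C p)" "y \<ominus>\<^bsub>gr D p\<^esub> f p a \<in> coboundaries D p"
      using lift[OF y(1), of x] y(2) x(1) Suc by auto
    interpret MD: abelian_group "gr D (Suc p)" by (rule D.gr_group)
    have "diff D p y \<ominus>\<^bsub>gr D (Suc p)\<^esub> diff D p (f p a) = \<zero>\<^bsub>gr D (Suc p)\<^esub>"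
      using D.coboundary_closed[OF a(2)] y a fc by (simp add: dm)
    then have "diff D p y = diff D p (f p a)"
      using y a fc linear_closed[OF D.diff_linear] MD.minus_zeroD[of "diff D p y" "diff D p (f p a)"] by blast
    then have "f (Suc p) x = f (Suc p) (diff C p a)" using y a by (simp add: f_diff)
    then have "x = diff C p a" using f_inj x a dC Suc by blast
    then show ?thesis using a Suc by auto
  qed
  have "cohomology_map D f q \<in> iso (cohomology C q) (cohomology D q)" for q
  proof -
    let ?ZC = "cocycle_group C q" and ?ZD = "cocycle_group D q" and ?BC = "coboundaries C q" and ?BD = "coboundaries D q"
    interpret ZC: comm_group ?ZC by (rule C.comm_group_cocycle_group)
    interpret ZD: comm_group ?ZD by (rule D.comm_group_cocycle_group)
    interpret BC: normal ?BC ?ZC by (rule C.coboundaries_normal)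
    interpret BD: normal ?BD ?ZD by (rule D.coboundaries_normal)
    interpret MC: abelian_group "gr C q" by (rule C.gr_group)
    interpret MD: abelian_group "gr D q" by (rule D.gr_group)
    have fZ: "f q z \<in> carrier ?ZD" if "z \<in> carrier ?ZC" for z
      using that f_diff[of z q] fc f0 by (auto simp: C.cocycle_group_simps D.cocycle_group_simps)
    have f_mult: "f q (z \<otimes>\<^bsub>?ZC\<^esub> z') = f q z \<otimes>\<^bsub>?ZD\<^esub> f q z'" if "z \<in> carrier ?ZC" "z' \<in> carrier ?ZC" for z z'
      using that fa by (simp add: C.cocycle_group_simps D.cocycle_group_simps)
    have map_coset: "cohomology_map D f q (?BC #>\<^bsub>?ZC\<^esub> z) = ?BD #>\<^bsub>?ZD\<^esub> f q z" if z: "z \<in> carrier ?ZC" for z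
    proof -
      have "?BD #>\<^bsub>?ZD\<^esub> f q u = ?BD #>\<^bsub>?ZD\<^esub> f q z" if u: "u \<in> ?BC #>\<^bsub>?ZC\<^esub> z" for u
      proof -
        obtain b where b: "b \<in> ?BC" "u = b \<otimes>\<^bsub>?ZC\<^esub> z" using u by (auto simp: r_coset_def)
        then have "f q u = f q b \<otimes>\<^bsub>?ZD\<^esub> f q z" using z BC.subset by (auto intro: f_mult)
        then have "f q u \<in> ?BD #>\<^bsub>?ZD\<^esub> f q z" using f_cob[OF b(1)] by (auto simp: r_coset_def)
        then show ?thesis by (rule ZD.repr_independence[OF _ fZ[OF z] D.coboundaries_subgroup, symmetric])
      qed
      moreover have "z \<in> ?BC #>\<^bsub>?ZC\<^esub> z" by (rule ZC.rcos_self[OF z C.coboundaries_subgroup])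
      ultimately show ?thesis unfolding cohomology_map_def by blast
    qed
    have carC: "carrier (cohomology C q) = {?BC #>\<^bsub>?ZC\<^esub> z | z. z \<in> carrier ?ZC}"
      and carD: "carrier (cohomology D q) = {?BD #>\<^bsub>?ZD\<^esub> z | z. z \<in> carrier ?ZD}"
      by (auto simp: cohomology_def FactGroup_def RCOSETS_def)
    have hom: "cohomology_map D f q \<in> hom (cohomology C q) (cohomology D q)"
    proof (rule homI)
      fix K assume "K \<in> carrier (cohomology C q)"
      then show "cohomology_map D f q K \<in> carrier (cohomology D q)"
        unfolding carC carD using map_coset fZ by auto
    next
      fix K L assume "K \<in> carrier (cohomology C q)" "L \<in> carrier (cohomology C q)"
      then obtain z z' where z: "z \<in> carrier ?ZC" "K = ?BC #>\<^bsub>?ZC\<^esub> z" "z' \<in> carrier ?ZC" "L = ?BC #>\<^bsub>?ZC\<^esub> z'"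
        unfolding carC by auto
      show "cohomology_map D f q (K \<otimes>\<^bsub>cohomology C q\<^esub> L) =
          cohomology_map D f q K \<otimes>\<^bsub>cohomology D q\<^esub> cohomology_map D f q L"
        using z map_coset fZ by (simp add: cohomology_def FactGroup_def BC.rcos_sum BD.rcos_sum f_mult)
    qed
    have inj_coh: "inj_on (cohomology_map D f q) (carrier (cohomology C q))"
    proof (rule inj_onI)
      fix K L assume "K \<in> carrier (cohomology C q)" "L \<in> carrier (cohomology C q)"
        and eq: "cohomology_map D f q K = cohomology_map D f q L"
      then obtain z z' where z: "z \<in> carrier ?ZC" "K = ?BC #>\<^bsub>?ZC\<^esub> z" "z' \<in> carrier ?ZC" "L = ?BC #>\<^bsub>?ZC\<^esub> z'"
        unfolding carC by auto
      have "f q z \<in> ?BD #>\<^bsub>?ZD\<^esub> f q z'"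
        using eq z map_coset ZD.rcos_self[OF fZ[OF z(1)] D.coboundaries_subgroup] by simp
      then obtain b where b: "b \<in> ?BD" "f q z = b \<oplus>\<^bsub>gr D q\<^esub> f q z'" by (auto simp: r_coset_def D.cocycle_group_simps)
      have zc: "z \<in> carrier (gr C q)" "z' \<in> carrier (gr C q)" using z by (auto simp: C.cocycle_group_simps)
      have "f q (z \<ominus>\<^bsub>gr C q\<^esub> z') = b"
        using zc b D.coboundary_closed[OF b(1)] fc[of z' q] by (simp add: fm MD.minus_eq MD.a_assoc MD.r_neg)
      then have c: "z \<ominus>\<^bsub>gr C q\<^esub> z' \<in> ?BC" using b zc by (intro f_cob_iff) auto
      have "z = (z \<ominus>\<^bsub>gr C q\<^esub> z') \<otimes>\<^bsub>?ZC\<^esub> z'" using zc by (simp add: C.cocycle_group_simps MC.minus_eq MC.a_assoc MC.l_neg)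
      then have "z \<in> ?BC #>\<^bsub>?ZC\<^esub> z'" using c by (auto simp: r_coset_def)
      then have "?BC #>\<^bsub>?ZC\<^esub> z' = ?BC #>\<^bsub>?ZC\<^esub> z"
        by (rule ZC.repr_independence[OF _ z(3) C.coboundaries_subgroup])
      then show "K = L" using z by simp
    qed
    have "carrier (cohomology D q) \<subseteq> cohomology_map D f q ` carrier (cohomology C q)"
    proof
      fix L assume "L \<in> carrier (cohomology D q)"
      then obtain y where y: "y \<in> carrier ?ZD" "L = ?BD #>\<^bsub>?ZD\<^esub> y" unfolding carD by auto
      then have yc: "y \<in> carrier (gr D q)" and dy: "diff D q y = \<zero>\<^bsub>gr D (Suc q)\<^esub>" by (auto simp: D.cocycle_group_simps)
      \<comment> \<open>The case b = 0 of \<open>lift\<close> moves a cocycle y into the image of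
        \<open>f\<close>; injectivity of \<open>f\<close> then makes the preimage a cocycle.\<close>
      have zcl: "\<zero>\<^bsub>gr C (Suc q)\<^esub> \<in> carrier (gr C (Suc q))"
        by (rule abelian_monoid.zero_closed[OF abelian_group.axioms(1)[OF C.gr_group]])
      obtain a where a: "a \<in> carrier (gr C q)" "y \<ominus>\<^bsub>gr D q\<^esub> f q a \<in> ?BD"
        using lift[OF yc zcl] dy f0 by auto
      interpret MD': abelian_group "gr D (Suc q)" by (rule D.gr_group)
      have "\<zero>\<^bsub>gr D (Suc q)\<^esub> \<ominus>\<^bsub>gr D (Suc q)\<^esub> diff D q (f q a) = \<zero>\<^bsub>gr D (Suc q)\<^esub>"
        using D.coboundary_closed[OF a(2)] yc a fc by (simp add: dm dy)
      then have "diff D q (f q a) = \<zero>\<^bsub>gr D (Suc q)\<^esub>"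
        using MD'.minus_zeroD[of "\<zero>\<^bsub>gr D (Suc q)\<^esub>" "diff D q (f q a)"] a fc linear_closed[OF D.diff_linear]
          MD'.zero_closed by metis
      then have "diff C q a = \<zero>\<^bsub>gr C (Suc q)\<^esub>" using inj[OF dC[OF a(1)]] f_diff[OF a(1)] by simp
      then have aZ: "a \<in> carrier ?ZC" using a by (simp add: C.cocycle_group_simps)
      have "y = (y \<ominus>\<^bsub>gr D q\<^esub> f q a) \<otimes>\<^bsub>?ZD\<^esub> f q a"
        using yc fc[OF a(1)] by (simp add: D.cocycle_group_simps MD.minus_eq MD.a_assoc MD.l_neg)
      then have "y \<in> ?BD #>\<^bsub>?ZD\<^esub> f q a" using a(2) by (auto simp: r_coset_def)
      then have "?BD #>\<^bsub>?ZD\<^esub> f q a = ?BD #>\<^bsub>?ZD\<^esub> y"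
        by (rule ZD.repr_independence[OF _ fZ[OF aZ] D.coboundaries_subgroup])
      then have "L = cohomology_map D f q (?BC #>\<^bsub>?ZC\<^esub> a)" using y map_coset[OF aZ] by simp
      then show "L \<in> cohomology_map D f q ` carrier (cohomology C q)" using aZ unfolding carC by blast
    qed
    then have "cohomology_map D f q ` carrier (cohomology C q) = carrier (cohomology D q)"
      by (rule subset_antisym[OF hom_carrier[OF hom]])
    then show ?thesis by (simp add: iso_def bij_betw_def hom inj_coh)
  qed
  then show ?thesis using f by (simp add: quasi_iso_def)
qed

section \<open>Subalgebras\<close>

text \<open>Identities can be verified after an injective map. Applied to cochains inside
  \<open>E\<close>, this yields the algebra axioms of the Alexander-Whitney product without
  computing with it again.\<close>

theorem dg_algebra_embed:
  fixes C :: "('r, 'a, 'n) dga_scheme" and D :: "('r, 'b, 'k) dga_scheme"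
  assumes D: "dg_algebra R D"
    and f_closed: "\<And>q x. x \<in> carrier (gr C q) \<Longrightarrow> f q x \<in> carrier (gr D q)"
    and inj: "\<And>q. inj_on (f q) (carrier (gr C q))"
    and add: "\<And>q x y. x \<in> carrier (gr C q) \<Longrightarrow> y \<in> carrier (gr C q) \<Longrightarrow>
      x \<oplus>\<^bsub>gr C q\<^esub> y \<in> carrier (gr C q) \<and> f q (x \<oplus>\<^bsub>gr C q\<^esub> y) = f q x \<oplus>\<^bsub>gr D q\<^esub> f q y"
    and zero: "\<And>q. \<zero>\<^bsub>gr C q\<^esub> \<in> carrier (gr C q) \<and> f q \<zero>\<^bsub>gr C q\<^esub> = \<zero>\<^bsub>gr D q\<^esub>"
    and smult: "\<And>q r x. r \<in> carrier R \<Longrightarrow> x \<in> carrier (gr C q) \<Longrightarrow>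
      r \<odot>\<^bsub>gr C q\<^esub> x \<in> carrier (gr C q) \<and> f q (r \<odot>\<^bsub>gr C q\<^esub> x) = r \<odot>\<^bsub>gr D q\<^esub> f q x"
    and diff: "\<And>q x. x \<in> carrier (gr C q) \<Longrightarrow>
      diff C q x \<in> carrier (gr C (Suc q)) \<and> f (Suc q) (diff C q x) = diff D q (f q x)"
    and mult: "\<And>p q x y. x \<in> carrier (gr C p) \<Longrightarrow> y \<in> carrier (gr C q) \<Longrightarrow>
      gmult C p q x y \<in> carrier (gr C (p + q)) \<and> f (p + q) (gmult C p q x y) = gmult D p q (f p x) (f q y)"
    and one: "gone C \<in> carrier (gr C 0) \<and> f 0 (gone C) = gone D"
  shows "dga_hom R C D f"
proof -
  interpret D: dg_algebra R D by (rule D)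
  have eqI: "x = y" if "x \<in> carrier (gr C q)" "y \<in> carrier (gr C q)" "f q x = f q y" for q x y
    using inj that by (auto dest: inj_onD)
  note mon = abelian_group.axioms(1)[OF D.gr_group]
  note D_ac = abelian_monoid.a_assoc[OF mon] abelian_monoid.a_comm[OF mon] abelian_monoid.a_lcomm[OF mon]
  have module: "module R (gr C q)" for q
  proof (rule moduleI)
    show "cring R" by (rule D.is_cring)
    show "abelian_group (gr C q)"
    proof (rule abelian_groupI)
      fix x assume x: "x \<in> carrier (gr C q)"
      interpret M: module R "gr D q" by (rule D.gr_module)
      \<comment> \<open>The hypotheses do not mention negatives; they are obtained as multiples by
        -1.\<close>
      have "(\<ominus>\<^bsub>R\<^esub> \<one>\<^bsub>R\<^esub>) \<odot>\<^bsub>gr C q\<^esub> x \<oplus>\<^bsub>gr C q\<^esub> x = \<zero>\<^bsub>gr C q\<^esub>"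
        by (rule eqI[of _ q]) (use x in \<open>simp_all add: add smult zero f_closed M.smult_l_minus M.l_neg\<close>)
      then show "\<exists>y\<in>carrier (gr C q). y \<oplus>\<^bsub>gr C q\<^esub> x = \<zero>\<^bsub>gr C q\<^esub>" using smult x D.one_closed D.a_inv_closed by blast
    next
      fix x y z assume "x \<in> carrier (gr C q)" "y \<in> carrier (gr C q)" "z \<in> carrier (gr C q)"
      then show "x \<oplus>\<^bsub>gr C q\<^esub> y \<oplus>\<^bsub>gr C q\<^esub> z = x \<oplus>\<^bsub>gr C q\<^esub> (y \<oplus>\<^bsub>gr C q\<^esub> z)"
        by (intro eqI[of _ q]) (simp_all add: add f_closed D_ac)
    next
      fix x y assume "x \<in> carrier (gr C q)" "y \<in> carrier (gr C q)"
      then show "x \<oplus>\<^bsub>gr C q\<^esub> y = y \<oplus>\<^bsub>gr C q\<^esub> x" by (intro eqI[of _ q]) (simp_all add: add f_closed D_ac)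
    next
      fix x assume "x \<in> carrier (gr C q)"
      then show "\<zero>\<^bsub>gr C q\<^esub> \<oplus>\<^bsub>gr C q\<^esub> x = x"
        by (intro eqI[of _ q]) (simp_all add: add zero f_closed abelian_monoid.l_zero[OF mon])
    qed (simp_all add: add zero)
  next
    fix r s x assume "r \<in> carrier R" "s \<in> carrier R" "x \<in> carrier (gr C q)"
    then show "(r \<oplus>\<^bsub>R\<^esub> s) \<odot>\<^bsub>gr C q\<^esub> x = r \<odot>\<^bsub>gr C q\<^esub> x \<oplus>\<^bsub>gr C q\<^esub> s \<odot>\<^bsub>gr C q\<^esub> x"
      "(r \<otimes>\<^bsub>R\<^esub> s) \<odot>\<^bsub>gr C q\<^esub> x = r \<odot>\<^bsub>gr C q\<^esub> (s \<odot>\<^bsub>gr C q\<^esub> x)"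
      by (auto intro!: eqI[of _ q] simp: add smult f_closed module.smult_l_distr[OF D.gr_module] module.smult_assoc1[OF D.gr_module])
  next
    fix r x y assume "r \<in> carrier R" "x \<in> carrier (gr C q)" "y \<in> carrier (gr C q)"
    then show "r \<odot>\<^bsub>gr C q\<^esub> (x \<oplus>\<^bsub>gr C q\<^esub> y) = r \<odot>\<^bsub>gr C q\<^esub> x \<oplus>\<^bsub>gr C q\<^esub> r \<odot>\<^bsub>gr C q\<^esub> y"
      by (intro eqI[of _ q]) (simp_all add: add smult f_closed module.smult_r_distr[OF D.gr_module])
  next
    fix x assume "x \<in> carrier (gr C q)"
    then show "\<one>\<^bsub>R\<^esub> \<odot>\<^bsub>gr C q\<^esub> x = x"
      by (intro eqI[of _ q]) (simp_all add: smult f_closed module.smult_one[OF D.gr_module])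
  qed (simp add: smult)
  have f_lin: "f q \<in> linear_maps R (gr C q) (gr D q)" for q
    by (rule linear_mapsI) (simp_all add: f_closed add smult)
  have lin: "g \<in> linear_maps R (gr C p) (gr C q)"
    if g: "\<And>x. x \<in> carrier (gr C p) \<Longrightarrow> g x \<in> carrier (gr C q)" "\<And>x. x \<in> carrier (gr C p) \<Longrightarrow> f q (g x) = h (f p x)"
      and h: "h \<in> linear_maps R (gr D p) (gr D q)" for g h p q
    by (rule linear_mapsI) (auto intro!: eqI[of _ q] simp: g add smult f_closed linear_add[OF h] linear_smult[OF h])
  have "dg_algebra R C"
  proof (intro dg_algebra.intro cochain_complex.intro cochain_complex_axioms.intro dg_algebra_axioms.intro)
    show "cring R" by (rule D.is_cring)
    show "module R (gr C q)" for q by (rule module)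
    show "diff C q \<in> linear_maps R (gr C q) (gr C (Suc q))" for q
      by (rule lin[OF _ _ D.diff_linear]) (simp_all add: diff)
    show "diff C (Suc q) (diff C q x) = \<zero>\<^bsub>gr C (Suc (Suc q))\<^esub>" if "x \<in> carrier (gr C q)" for x q
      by (rule eqI[of _ "Suc (Suc q)"]) (use that in \<open>simp_all add: diff zero f_closed D.diff_diff\<close>)
    show "gmult C p q x \<in> linear_maps R (gr C q) (gr C (p + q))" if "x \<in> carrier (gr C p)" for x p q
      by (rule lin[OF _ _ D.gmult_linear_right[OF f_closed[OF that]]]) (use that in \<open>simp_all add: mult\<close>)
    show "(\<lambda>x. gmult C p q x y) \<in> linear_maps R (gr C p) (gr C (p + q))" if "y \<in> carrier (gr C q)" for y p q
      by (rule lin[OF _ _ D.gmult_linear_left[OF f_closed[OF that]]]) (use that in \<open>simp_all add: mult\<close>)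
    show "gmult C (p + q) r (gmult C p q x y) z = gmult C p (q + r) x (gmult C q r y z)"
      if "x \<in> carrier (gr C p)" "y \<in> carrier (gr C q)" "z \<in> carrier (gr C r)" for x y z p q r
    proof (rule eqI[of _ "p + q + r"])
      show "gmult C (p + q) r (gmult C p q x y) z \<in> carrier (gr C (p + q + r))" using that mult by blast
      show "gmult C p (q + r) x (gmult C q r y z) \<in> carrier (gr C (p + q + r))"
        using that mult[of x p "gmult C q r y z" "q + r"] mult[of y q z r] by (simp add: add.assoc)
      show "f (p + q + r) (gmult C (p + q) r (gmult C p q x y) z) = f (p + q + r) (gmult C p (q + r) x (gmult C q r y z))"
        using that mult[of x p "gmult C q r y z" "q + r"] by (simp add: add.assoc[symmetric] mult f_closed D.gmult_assoc)
    qed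
    show "gone C \<in> carrier (gr C 0)" using one by blast
    show "gmult C 0 q (gone C) x = x" if "x \<in> carrier (gr C q)" for x q
      using mult[of "gone C" 0 x q] one that by (intro eqI[of _ q]) (simp_all add: f_closed D.gmult_one_left)
    show "gmult C q 0 x (gone C) = x" if "x \<in> carrier (gr C q)" for x q
      using mult[of x q "gone C" 0] one that by (intro eqI[of _ q]) (simp_all add: f_closed D.gmult_one_right)
    show "diff C (p + q) (gmult C p q x y) = gmult C (Suc p) q (diff C p x) y
          \<oplus>\<^bsub>gr C (Suc (p + q))\<^esub> signed (gr C (Suc (p + q))) p (gmult C p (Suc q) x (diff C q y))"
      if x: "x \<in> carrier (gr C p)" and y: "y \<in> carrier (gr C q)" for x y p q
    proof -
      have 1: "gmult C (Suc p) q (diff C p x) y \<in> carrier (gr C (Suc (p + q)))"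
        "f (Suc (p + q)) (gmult C (Suc p) q (diff C p x) y) = gmult D (Suc p) q (diff D p (f p x)) (f q y)"
        using mult[of "diff C p x" "Suc p" y q] diff[OF x] y by simp_all
      have 2: "gmult C p (Suc q) x (diff C q y) \<in> carrier (gr C (Suc (p + q)))"
        "f (Suc (p + q)) (gmult C p (Suc q) x (diff C q y)) = gmult D p (Suc q) (f p x) (diff D q (f q y))"
        using mult[of x p "diff C q y" "Suc q"] diff[OF y] x by simp_all
      show ?thesis
        by (rule eqI[of _ "Suc (p + q)"])
          (use x y in \<open>simp_all add: diff mult add 1 2 f_closed abelian_group.signed_closed[OF module_abelian[OF module]]
            linear_signed[OF module D.gr_module f_lin] D.leibniz\<close>)
    qed
  qed
  then show ?thesis
    using D f_lin diff mult one by (simp add: dga_hom_def cochain_map_def)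
qed

section \<open>Consequences of the hypotheses on the coefficients\<close>

text \<open>In positive degrees the unit map is zero, so the homotopy on D writes -x as the
  coboundary of h x for a cocycle x. In degree 0 it vanishes on cocycles, so x is the unit times g
  x. Injectivity comes from the other homotopy, which vanishes because \<open>ring_complex\<close>
  has zero differential.\<close>

lemma unit_equivalence:
  fixes D :: "('r, 'a, 'n) dga_scheme"
  assumes D: "dg_algebra R D"
    and eq: "cochain_homotopy_equivalence R (ring_complex R) D (unit_map D)"
  shows "x \<in> carrier (gr D (Suc q)) \<Longrightarrow> diff D (Suc q) x = \<zero>\<^bsub>gr D (Suc (Suc q))\<^esub> \<Longrightarrow>
      \<exists>y\<in>carrier (gr D q). diff D q y = x"
    and "x \<in> carrier (gr D 0) \<Longrightarrow> diff D 0 x = \<zero>\<^bsub>gr D 1\<^esub> \<Longrightarrow> \<exists>r\<in>carrier R. x = r \<odot>\<^bsub>gr D 0\<^esub> gone D"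
    and "r \<in> carrier R \<Longrightarrow> r \<odot>\<^bsub>gr D 0\<^esub> gone D = \<zero>\<^bsub>gr D 0\<^esub> \<Longrightarrow> r = \<zero>\<^bsub>R\<^esub>"
proof -
  interpret D: dg_algebra R D by (rule D)
  obtain g where g: "cochain_map R D (ring_complex R) g"
    and gf: "cochain_homotopic R (ring_complex R) (ring_complex R) (\<lambda>q x. g q (unit_map D q x)) (\<lambda>q x. x)"
    and fg: "cochain_homotopic R D D (\<lambda>q x. unit_map D q (g q x)) (\<lambda>q x. x)"
    using eq by (auto simp: cochain_homotopy_equivalence_def)
  have g_lin: "g q \<in> linear_maps R (gr D q) (gr (ring_complex R) q)" for q using g by (simp add: cochain_map_def)
  obtain h where h': "\<forall>q. h q \<in> linear_maps R (gr D (Suc q)) (gr D q)"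
    "\<forall>x\<in>carrier (gr D 0). unit_map D 0 (g 0 x) \<ominus>\<^bsub>gr D 0\<^esub> x = h 0 (diff D 0 x)"
    "\<forall>q. \<forall>x\<in>carrier (gr D (Suc q)). unit_map D (Suc q) (g (Suc q) x) \<ominus>\<^bsub>gr D (Suc q)\<^esub> x =
      diff D q (h q x) \<oplus>\<^bsub>gr D (Suc q)\<^esub> h (Suc q) (diff D (Suc q) x)"
    using fg unfolding cochain_homotopic_def by (elim exE conjE)
  note h = h'(1)[rule_format] h'(2)[rule_format] h'(3)[rule_format]
  note h0 = linear_zero[OF D.gr_module D.gr_module h(1)]
  show "\<exists>y\<in>carrier (gr D q). diff D q y = x"
    if x: "x \<in> carrier (gr D (Suc q))" and dx: "diff D (Suc q) x = \<zero>\<^bsub>gr D (Suc (Suc q))\<^esub>"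
  proof
    interpret M: abelian_group "gr D (Suc q)" by (rule D.gr_group)
    interpret N: abelian_group "gr D q" by (rule D.gr_group)
    have hx: "h q x \<in> carrier (gr D q)" by (rule linear_closed[OF h(1) x])
    then show "\<ominus>\<^bsub>gr D q\<^esub> h q x \<in> carrier (gr D q)" by simp
    have dhx: "diff D q (h q x) \<in> carrier (gr D (Suc q))" by (rule linear_closed[OF D.diff_linear hx])
    have eq: "\<ominus>\<^bsub>gr D (Suc q)\<^esub> x = diff D q (h q x)"
      using h(3)[OF x] x dhx by (simp add: unit_map_def dx h0 M.minus_eq)
    have "diff D q (\<ominus>\<^bsub>gr D q\<^esub> h q x) = \<ominus>\<^bsub>gr D (Suc q)\<^esub> diff D q (h q x)"
      by (rule linear_uminus[OF D.gr_module D.gr_module D.diff_linear hx])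
    then show "diff D q (\<ominus>\<^bsub>gr D q\<^esub> h q x) = x" using x by (simp flip: eq)
  qed
  show "\<exists>r\<in>carrier R. x = r \<odot>\<^bsub>gr D 0\<^esub> gone D"
    if x: "x \<in> carrier (gr D 0)" and dx: "diff D 0 x = \<zero>\<^bsub>gr D 1\<^esub>"
  proof
    interpret M: module R "gr D 0" by (rule D.gr_module)
    show r: "g 0 x \<in> carrier R" using linear_closed[OF g_lin x] by (simp add: ring_complex_def)
    have "unit_map D 0 (g 0 x) \<ominus>\<^bsub>gr D 0\<^esub> x = \<zero>\<^bsub>gr D 0\<^esub>" using h(2)[OF x] h0[of 0] dx by simp
    then have "unit_map D 0 (g 0 x) = x"
      by (rule M.minus_zeroD[rotated 2]) (simp_all add: unit_map_def x r D.gone_closed)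
    then show "x = g 0 x \<odot>\<^bsub>gr D 0\<^esub> gone D" by (simp add: unit_map_def)
  qed
  show "r = \<zero>\<^bsub>R\<^esub>" if r: "r \<in> carrier R" and r0: "r \<odot>\<^bsub>gr D 0\<^esub> gone D = \<zero>\<^bsub>gr D 0\<^esub>"
  proof -
    let ?C = "ring_complex R"
    obtain k where k': "\<forall>q. k q \<in> linear_maps R (gr ?C (Suc q)) (gr ?C q)"
      "\<forall>x\<in>carrier (gr ?C 0). g 0 (unit_map D 0 x) \<ominus>\<^bsub>gr ?C 0\<^esub> x = k 0 (diff ?C 0 x)"
      using gf unfolding cochain_homotopic_def by (elim exE conjE)
    note k = k'(1)[rule_format, of 0] k'(2)[rule_format]
    have add0: "x \<oplus>\<^bsub>gr ?C q\<^esub> y = x \<oplus>\<^bsub>R\<^esub> y" "\<zero>\<^bsub>gr ?C q\<^esub> = \<zero>\<^bsub>R\<^esub>" for x y q by (simp_all add: ring_complex_def)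
    have car: "carrier (gr ?C 0) = carrier R" "carrier (gr ?C (Suc q)) = {\<zero>\<^bsub>R\<^esub>}" for q by (simp_all add: ring_complex_def)
    \<comment> \<open>Degree 0 of \<open>ring_complex R\<close> is a different record with the
      carrier and addition of \<open>R\<close>, so its subtraction unfolds to that of
      \<open>R\<close>.\<close>
    have inv: "x \<ominus>\<^bsub>gr ?C 0\<^esub> y = x \<ominus>\<^bsub>R\<^esub> y" for x y
      by (simp add: a_minus_def a_inv_def m_inv_def ring_complex_def)
    \<comment> \<open>Additivity alone gives that 0 goes to 0, without first making
      \<open>ring_complex R\<close> a complex of modules.\<close>
    have dbl: "z = \<zero>\<^bsub>R\<^esub>" if "z \<in> carrier R" "z = z \<oplus>\<^bsub>R\<^esub> z" for z
      using that D.add.r_cancel_one' by metis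
    have "k 0 \<zero>\<^bsub>R\<^esub> \<in> carrier R" using linear_closed[OF k(1)] car by simp
    moreover have "k 0 \<zero>\<^bsub>R\<^esub> = k 0 \<zero>\<^bsub>R\<^esub> \<oplus>\<^bsub>R\<^esub> k 0 \<zero>\<^bsub>R\<^esub>"
      using linear_add[OF k(1), of "\<zero>\<^bsub>R\<^esub>" "\<zero>\<^bsub>R\<^esub>"] car by (simp add: add0)
    ultimately have k0: "k 0 \<zero>\<^bsub>R\<^esub> = \<zero>\<^bsub>R\<^esub>" by (rule dbl)
    interpret M: module R "gr D 0" by (rule D.gr_module)
    have "g 0 \<zero>\<^bsub>gr D 0\<^esub> \<in> carrier R" using linear_closed[OF g_lin M.zero_closed] car by simp
    moreover have "g 0 \<zero>\<^bsub>gr D 0\<^esub> = g 0 \<zero>\<^bsub>gr D 0\<^esub> \<oplus>\<^bsub>R\<^esub> g 0 \<zero>\<^bsub>gr D 0\<^esub>"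
      using linear_add[OF g_lin M.zero_closed M.zero_closed] by (simp add: add0)
    ultimately have g0: "g 0 \<zero>\<^bsub>gr D 0\<^esub> = \<zero>\<^bsub>R\<^esub>" by (rule dbl)
    have "g 0 (unit_map D 0 r) \<ominus>\<^bsub>R\<^esub> r = \<zero>\<^bsub>R\<^esub>"
      using k(2)[of r] r car k0 inv by (simp add: ring_complex_def)
    then show ?thesis using r r0 g0 by (simp add: unit_map_def D.minus_eq)
  qed
qed

text \<open>Only reflexivity of the homotopy relation is required. A one-element quotient means that
  all vertices have the same set of related vertices; the set of \<open>y\<close> contains
  \<open>y\<close>, hence so does the set of \<open>x\<close>.\<close>

lemma (in simplicial_set) homotopic_vertices:
  assumes single: "is_singleton (homotopy_group X v 0)" and x: "x \<in> simplices X 0" and y: "y \<in> simplices X 0"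
  obtains e where "e \<in> simplices X 1" "face X 0 0 e = x" "face X 0 1 e = y"
proof -
  have sph: "spheres X v 0 = simplices X 0" by (simp add: spheres_def)
  have rel: "(x, y) \<in> sphere_homotopy X v 0 \<longleftrightarrow> x \<in> simplices X 0 \<and> y \<in> simplices X 0 \<and>
      (\<exists>e\<in>simplices X 1. face X 0 0 e = x \<and> face X 0 1 e = y)" for x y
    by (auto simp: sphere_homotopy_def sph)
  have refl: "(z, z) \<in> sphere_homotopy X v 0" if z: "z \<in> simplices X 0" for z
  proof -
    \<comment> \<open>The degenerate edge has both ends at z.\<close>
    define e where "e = act X 1 0 (codegen 0 0) z"
    have s: "codegen 0 0 \<in> ord_maps 1 0" using codegen_ord_maps[of 0 0] by simp
    have f: "coface 0 i \<in> ord_maps 0 1" for i using coface_ord_maps[of 0 i] by simp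
    have "e \<in> simplices X 1" unfolding e_def by (rule act_closed[OF s z])
    moreover have "face X 0 i e = z" if "i = 0 \<or> i = Suc 0" for i
      using act_compose[OF f s z, of i] act_id[OF z] codegen_coface_same[of i 0 0] that
      by (simp add: e_def face_def coface_def)
    ultimately show ?thesis using z by (auto simp: rel)
  qed
  obtain S where S: "spheres X v 0 // sphere_homotopy X v 0 = {S}"
    using single by (auto simp: homotopy_group_def is_singleton_def)
  have "sphere_homotopy X v 0 `` {z} = S" if "z \<in> simplices X 0" for z
    using quotientI[of z "spheres X v 0" "sphere_homotopy X v 0"] that S sph by auto
  then have "(x, y) \<in> sphere_homotopy X v 0" using refl[OF y] x y by blast
  then show thesis using that rel by blast
qed

section \<open>The two comparison maps\<close>

context bigraded_algebra
begin

lemma tot_diff_single_value: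
  assumes v: "v \<in> carrier (comp K a q)" and m: "m = a + q" and c: "c \<le> Suc m"
  shows "tot_diff K m (single K m a v) c = (if c = Suc a then del K a q v
    else if c = a then signed (comp K a (Suc q)) a (der K a q v) else \<zero>\<^bsub>comp K c (Suc m - c)\<^esub>)"
proof -
  have dv: "del K a q v \<in> carrier (comp K (Suc a) q)" "der K a q v \<in> carrier (comp K a (Suc q))"
    using linear_closed[OF del_linear v] linear_closed[OF der_linear v] by auto
  have e: "Suc m = a + Suc q" using m by simp
  show ?thesis
    unfolding tot_diff_single[OF v m] single_signed[OF e dv(2), symmetric] tot_add_component[OF c]
    using dv m c by (auto simp: single_def)
qed

text \<open>Where the neighbouring component vanishes, the total differential shows a single partial
  differential; \<open>tot_diff_der\<close> is the mirror image. This makes the outermost component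
  of an element closed in the direction in which it is to be removed.\<close>

lemma tot_diff_del:
  assumes f: "f \<in> carrier (tot_module K m)" and b: "b \<le> m" and z: "Suc b \<le> m \<Longrightarrow> f (Suc b) = \<zero>\<^bsub>comp K (Suc b) (m - Suc b)\<^esub>"
  shows "tot_diff K m f (Suc b) = del K b (m - b) (f b)"
proof -
  have d: "del K b (m - b) (f b) \<in> carrier (comp K (Suc b) (m - b))"
    by (rule linear_closed[OF del_linear tot_component[OF f b]])
  have "Suc (m - Suc b) = m - b" if "Suc b \<le> m" using that by simp
  then show ?thesis
    using b d z linear_zero[OF comp_module comp_module der_linear, of "Suc b" "m - Suc b"]
    by (auto simp: tot_diff_def)
qed

lemma tot_diff_der:
  assumes f: "f \<in> carrier (tot_module K m)" and b: "b \<le> m" and z: "\<And>a. b = Suc a \<Longrightarrow> f a = \<zero>\<^bsub>comp K a (m - a)\<^esub>"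
  shows "tot_diff K m f b = signed (comp K b (Suc m - b)) b (der K b (m - b) (f b))"
proof -
  have "der K b (m - b) (f b) \<in> carrier (comp K b (Suc m - b))"
    using linear_closed[OF der_linear tot_component[OF f b]] b by (simp add: Suc_diff_le)
  then show ?thesis
    using b z linear_zero[OF comp_module comp_module del_linear]
    by (cases b) (auto simp: tot_diff_def)
qed

end

section \<open>The intermediate algebra\<close>

context acyclic_forms
begin

abbreviation E :: "('r, nat \<Rightarrow> 'x \<Rightarrow> nat \<Rightarrow> (nat \<Rightarrow> nat) \<Rightarrow> 'a) dga"
  where "E \<equiv> forms (cochain_sdga A) X"

abbreviation simplex_algebra :: "nat \<Rightarrow> ('r, (nat \<Rightarrow> nat) \<Rightarrow> 'a) bigraded"
  where "simplex_algebra n \<equiv> simplex_cochains (level A n) n"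

interpretation E: forms_algebra R "cochain_sdga A" X
  by (intro forms_algebra.intro simplicial_dga_cochain_sdga X.simplicial_set_axioms)

interpretation K: bigraded_algebra R "simplex_algebra n" for n
  by (rule simplex_cochains_bigraded)

interpretation E: dg_algebra R E
  by (rule E.dg_algebra_forms)

lemma level_cochain_sdga:
  "gr (level (cochain_sdga A) n) m = tot_module (simplex_algebra n) m"
  "diff (level (cochain_sdga A) n) m = tot_diff (simplex_algebra n) m"
  "gmult (level (cochain_sdga A) n) m m' = tot_mult (simplex_algebra n) m m'"
  "gone (level (cochain_sdga A) n) = single (simplex_algebra n) 0 0 (unit (simplex_algebra n))"
  "dact (cochain_sdga A) l n \<phi> = tot_map (simplex_pull A l n \<phi>)"
  by (simp_all add: cochain_sdga_def tot_def)

lemma E_closed: "\<Phi> \<in> carrier (gr E m) \<Longrightarrow> x \<in> simplices X n \<Longrightarrow> \<Phi> n x \<in> carrier (tot_module (simplex_algebra n) m)"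
  using E.forms_closed by (simp add: level_cochain_sdga)

lemma E_component_linear: "x \<in> simplices X n \<Longrightarrow> a \<le> m \<Longrightarrow>
    (\<lambda>\<Phi>. \<Phi> n x a) \<in> linear_maps R (gr E m) (simplex_module n a (m - a))"
  using linear_comp[OF E.forms_value_linear, unfolded level_cochain_sdga, OF _ K.linear_component] .

lemma E_eqI:
  assumes "\<Phi> \<in> carrier (gr E m)" "\<Psi> \<in> carrier (gr E m)"
    "\<And>n x a. x \<in> simplices X n \<Longrightarrow> a \<le> m \<Longrightarrow> \<Phi> n x a = \<Psi> n x a"
  shows "\<Phi> = \<Psi>"
  by (rule E.forms_eqI[OF assms(1,2)], rule K.tot_eqI[OF E_closed[OF assms(1)] E_closed[OF assms(2)]]) (use assms(3) in auto)

lemma E_diff_value: "x \<in> simplices X n \<Longrightarrow> diff E m \<Phi> n x = tot_diff (simplex_algebra n) m (\<Phi> n x)"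
  by (simp add: E.forms_ops level_cochain_sdga)

lemma E_component_natural:
  assumes \<Phi>: "\<Phi> \<in> carrier (gr E m)" and a: "a \<le> m"
  shows "natural_family a (m - a) (\<lambda>n x. \<Phi> n x a)"
  unfolding natural_family_def
proof (intro conjI allI ballI)
  fix n x assume "x \<in> simplices X n"
  then show "\<Phi> n x a \<in> carrier (simplex_module n a (m - a))" using K.tot_component[OF E_closed[OF \<Phi>] a] by blast
next
  fix l n \<theta> x assume "\<theta> \<in> ord_maps l n" "x \<in> simplices X n"
  then show "\<Phi> l (act X l n \<theta> x) a = simplex_pull A l n \<theta> a (m - a) (\<Phi> n x a)"
    using E.forms_natural[OF \<Phi>] a by (simp add: level_cochain_sdga tot_map_def)
qed

text \<open>A natural family in one bidegree, regarded as an element of \<open>E\<close> with its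
  other components zero.\<close>

definition family_form :: "nat \<Rightarrow> nat \<Rightarrow> (nat \<Rightarrow> 'x \<Rightarrow> (nat \<Rightarrow> nat) \<Rightarrow> 'a) \<Rightarrow> nat \<Rightarrow> 'x \<Rightarrow> nat \<Rightarrow> (nat \<Rightarrow> nat) \<Rightarrow> 'a"
  where "family_form m a F = (\<lambda>n. \<lambda>x\<in>simplices X n. single (simplex_algebra n) m a (F n x))"

lemma family_form_value: "x \<in> simplices X n \<Longrightarrow> family_form m a F n x = single (simplex_algebra n) m a (F n x)"
  by (simp add: family_form_def)

lemma family_form_closed:
  assumes F: "natural_family a q F" and m: "m = a + q"
  shows "family_form m a F \<in> carrier (gr E m)"
  unfolding family_form_def
proof (rule E.forms_memI)
  fix n x assume "x \<in> simplices X n"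
  then show "single (simplex_algebra n) m a (F n x) \<in> carrier (gr (level (cochain_sdga A) n) m)"
    using K.single_closed[OF natural_family_closed[OF F] m] by (simp add: level_cochain_sdga)
next
  fix l n \<theta> x assume \<theta>: "\<theta> \<in> ord_maps l n" and x: "x \<in> simplices X n"
  show "single (simplex_algebra l) m a (F l (act X l n \<theta> x)) =
      dact (cochain_sdga A) l n \<theta> m (single (simplex_algebra n) m a (F n x))"
    by (simp add: level_cochain_sdga natural_family_act[OF F \<theta> x]
        bigraded_hom.tot_map_single[OF bigraded_hom_simplex_pull[OF \<theta>] m])
qed

section \<open>Forms as the column a = 0\<close>

lemma simplex_const_linear:
  "(\<lambda>v. \<lambda>\<theta>\<in>ord_maps 0 n. v) \<in> linear_maps R (gr (level A n) q) (simplex_module n 0 q)"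
  unfolding simplex_cochains_simps by (rule linear_into_pi[OF is_cring level_module linear_ident])

definition form_inclusion :: "nat \<Rightarrow> (nat \<Rightarrow> 'x \<Rightarrow> 'a) \<Rightarrow> nat \<Rightarrow> 'x \<Rightarrow> nat \<Rightarrow> (nat \<Rightarrow> nat) \<Rightarrow> 'a"
  where "form_inclusion q \<alpha> = family_form q 0 (\<lambda>n x. \<lambda>\<theta>\<in>ord_maps 0 n. \<alpha> n x)"

lemma form_family_natural:
  assumes \<alpha>: "\<alpha> \<in> carrier (gr (forms A X) q)"
  shows "natural_family 0 q (\<lambda>n x. \<lambda>\<theta>\<in>ord_maps 0 n. \<alpha> n x)"
  unfolding natural_family_def
proof (intro conjI allI ballI)
  fix n x assume "x \<in> simplices X n"
  then show "(\<lambda>\<theta>\<in>ord_maps 0 n. \<alpha> n x) \<in> carrier (simplex_module n 0 q)"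
    by (rule linear_closed[OF simplex_const_linear forms_closed[OF \<alpha>]])
next
  fix m n \<theta> x assume \<theta>: "\<theta> \<in> ord_maps m n" and x: "x \<in> simplices X n"
  have "compose {..0} \<theta> \<psi> \<in> ord_maps 0 n" if "\<psi> \<in> ord_maps 0 m" for \<psi> by (rule compose_ord_maps[OF that \<theta>])
  then show "(\<lambda>\<psi>\<in>ord_maps 0 m. \<alpha> m (act X m n \<theta> x)) = simplex_pull A m n \<theta> 0 q (\<lambda>\<psi>\<in>ord_maps 0 n. \<alpha> n x)"
    using forms_natural[OF \<alpha> \<theta> x] by (auto simp: simplex_pull_def fun_eq_iff simp del: atMost_0)
qed

lemma form_inclusion_closed: "\<alpha> \<in> carrier (gr (forms A X) q) \<Longrightarrow> form_inclusion q \<alpha> \<in> carrier (gr E q)"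
  unfolding form_inclusion_def by (rule family_form_closed[OF form_family_natural]) simp_all

lemma form_inclusion_value: "x \<in> simplices X n \<Longrightarrow>
    form_inclusion q \<alpha> n x = single (simplex_algebra n) q 0 (\<lambda>\<theta>\<in>ord_maps 0 n. \<alpha> n x)"
  by (simp add: form_inclusion_def family_form_value)

lemma simplex_del_const: "v \<in> carrier (gr (level A n) q) \<Longrightarrow>
    simplex_del n 0 q (\<lambda>\<theta>\<in>ord_maps 0 n. v) = \<zero>\<^bsub>simplex_module n (Suc 0) q\<^esub>"
proof (rule simplex_zeroI[OF linear_closed[OF simplex_del_linear linear_closed[OF simplex_const_linear]]])
  fix \<theta> assume v: "v \<in> carrier (gr (level A n) q)" and \<theta>: "\<theta> \<in> ord_maps (Suc 0) n"
  interpret M: abelian_group "gr (level A n) q" by (rule module_abelian[OF level_module])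
  have "altsum (gr (level A n) q) (Suc 0) (\<lambda>i. v) = \<zero>\<^bsub>gr (level A n) q\<^esub>"
    using v by (simp add: M.altsum_first M.altsum_0 M.minus_eq M.r_neg)
  then show "simplex_del n 0 q (\<lambda>\<theta>\<in>ord_maps 0 n. v) \<theta> = \<zero>\<^bsub>gr (level A n) q\<^esub>"
    using \<theta> compose_coface_ord_maps[OF \<theta>] by (simp add: simplex_cochains_simps(2) del: atMost_0)
qed

text \<open>Constants on vertices are killed by \<open>del\<close>, so only \<open>der\<close>
  remains of the total differential. In products the sign exponent contains the factor a = 0, and
  front and back face of a vertex are the vertex itself, so the cup product is the pointwise
  one.\<close>

theorem dga_hom_form_inclusion: "dga_hom R (forms A X) E form_inclusion"
  unfolding dga_hom_def cochain_map_def
proof (intro conjI allI ballI)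
  show "dg_algebra R (forms A X)" "dg_algebra R E" by (rule dg_algebra_forms E.dg_algebra_forms)+
  show "form_inclusion q \<in> linear_maps R (gr (forms A X) q) (gr E q)" for q
  proof (rule E.forms_linearI)
    fix n x assume x: "x \<in> simplices X n"
    have "(\<lambda>\<alpha>. single (simplex_algebra n) q 0 (\<lambda>\<theta>\<in>ord_maps 0 n. \<alpha> n x))
        \<in> linear_maps R (gr (forms A X) q) (tot_module (simplex_algebra n) q)"
      by (rule linear_comp[OF linear_comp[OF forms_value_linear[OF x] simplex_const_linear] K.linear_single]) simp
    then show "(\<lambda>\<alpha>. form_inclusion q \<alpha> n x) \<in> linear_maps R (gr (forms A X) q) (gr (level (cochain_sdga A) n) q)"
      by (simp add: form_inclusion_value[OF x] level_cochain_sdga)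
  qed (auto intro: form_inclusion_closed forms_cl)
  show "form_inclusion 0 (gone (forms A X)) = gone E"
    by (rule E.forms_eqI[OF form_inclusion_closed[OF forms_gone_closed] E.forms_gone_closed])
      (simp add: form_inclusion_value E.forms_ops forms_ops level_cochain_sdga simplex_cochains_simps(5))
next
  fix q \<alpha> assume \<alpha>: "\<alpha> \<in> carrier (gr (forms A X) q)"
  show "form_inclusion (Suc q) (diff (forms A X) q \<alpha>) = diff E q (form_inclusion q \<alpha>)"
  proof (rule E_eqI[OF form_inclusion_closed[OF forms_diff_closed[OF \<alpha>]] E.forms_diff_closed[OF form_inclusion_closed[OF \<alpha>]]])
    fix n x a assume x: "x \<in> simplices X n" and a: "a \<le> Suc q"
    have der: "simplex_der n 0 q (\<lambda>\<theta>\<in>ord_maps 0 n. \<alpha> n x) = (\<lambda>\<theta>\<in>ord_maps 0 n. diff (level A n) q (\<alpha> n x))"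
      by (auto simp: simplex_cochains_simps(3))
    have "tot_diff (simplex_algebra n) q (single (simplex_algebra n) q 0 (\<lambda>\<theta>\<in>ord_maps 0 n. \<alpha> n x)) a =
        (if a = Suc 0 then \<zero>\<^bsub>simplex_module n (Suc 0) q\<^esub>
         else if a = 0 then (\<lambda>\<theta>\<in>ord_maps 0 n. diff (level A n) q (\<alpha> n x)) else \<zero>\<^bsub>simplex_module n a (Suc q - a)\<^esub>)"
      using K.tot_diff_single_value[OF linear_closed[OF simplex_const_linear forms_closed[OF \<alpha> x]] _ a]
        simplex_del_const[OF forms_closed[OF \<alpha> x]] der
      by (simp add: signed_def)
    then show "form_inclusion (Suc q) (diff (forms A X) q \<alpha>) n x a = diff E q (form_inclusion q \<alpha>) n x a"
      using x a by (simp add: E_diff_value form_inclusion_value forms_ops(4)) (auto simp: single_def)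
  qed
next
  fix p q \<alpha> \<beta> assume \<alpha>: "\<alpha> \<in> carrier (gr (forms A X) p)" and \<beta>: "\<beta> \<in> carrier (gr (forms A X) q)"
  show "form_inclusion (p + q) (gmult (forms A X) p q \<alpha> \<beta>) = gmult E p q (form_inclusion p \<alpha>) (form_inclusion q \<beta>)"
  proof (rule E.forms_eqI[OF form_inclusion_closed[OF forms_gmult_closed[OF \<alpha> \<beta>]]
        E.forms_gmult_closed[OF form_inclusion_closed[OF \<alpha>] form_inclusion_closed[OF \<beta>]]])
    fix n x assume x: "x \<in> simplices X n"
    have fb: "compose {..0} \<theta> (front_map 0) \<in> ord_maps 0 n" "compose {..0} \<theta> (back_map 0 0) \<in> ord_maps 0 n"
      if "\<theta> \<in> ord_maps 0 n" for \<theta>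
      using that compose_front_map[of \<theta> 0 0 n] compose_back_map[of \<theta> 0 0 n] by simp_all
    show "form_inclusion (p + q) (gmult (forms A X) p q \<alpha> \<beta>) n x =
        gmult E p q (form_inclusion p \<alpha>) (form_inclusion q \<beta>) n x"
      using x K.tot_mult_single[OF linear_closed[OF simplex_const_linear forms_closed[OF \<alpha> x]]
          linear_closed[OF simplex_const_linear forms_closed[OF \<beta> x]], of p q] fb
      by (simp add: form_inclusion_value E.forms_ops(5) forms_ops(5) level_cochain_sdga signed_def simplex_cochains_simps(4)
          cong: restrict_cong)
  qed
qed

text \<open>Induction on a bound k for the nonzero components. The topmost component is closed under
  \<open>del\<close>, and by exactness of the rows it can be removed by a coboundary that otherwise
  changes only the component below. What reaches column 0 is closed under \<open>del\<close> and
  hence a form.\<close>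

lemma form_inclusion_lift:
  assumes "\<Phi> \<in> carrier (gr E m)" "k \<le> m"
    and "\<And>n x c. x \<in> simplices X n \<Longrightarrow> c \<le> m \<Longrightarrow> diff E m \<Phi> n x (Suc c) = \<zero>\<^bsub>simplex_module n (Suc c) (m - c)\<^esub>"
    and "\<And>n x a. x \<in> simplices X n \<Longrightarrow> k < a \<Longrightarrow> a \<le> m \<Longrightarrow> \<Phi> n x a = \<zero>\<^bsub>simplex_module n a (m - a)\<^esub>"
  shows "\<exists>\<alpha>\<in>carrier (gr (forms A X) m). \<Phi> \<ominus>\<^bsub>gr E m\<^esub> form_inclusion m \<alpha> \<in> coboundaries E m"
  using assms
proof (induction k arbitrary: \<Phi>)
  case 0
  note \<Phi> = "0.prems"(1)
  have "simplex_del n 0 m (\<Phi> n x 0) = \<zero>\<^bsub>simplex_module n 1 m\<^esub>" if x: "x \<in> simplices X n" for n x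
    using K.tot_diff_del[OF E_closed[OF \<Phi> x], of 0] "0.prems"(3)[OF x, of 0] "0.prems"(4)[OF x, of 1] x
    by (simp add: E_diff_value)
  then obtain \<alpha> where \<alpha>: "\<alpha> \<in> carrier (gr (forms A X) m)"
    "\<And>n x. x \<in> simplices X n \<Longrightarrow> \<Phi> n x 0 = (\<lambda>\<theta>\<in>ord_maps 0 n. \<alpha> n x)"
    using del_kernel[OF E_component_natural[OF \<Phi>, of 0, unfolded minus_nat.diff_0]] by auto
  have eq: "\<Phi> = form_inclusion m \<alpha>"
  proof (rule E_eqI[OF \<Phi> form_inclusion_closed[OF \<alpha>(1)]])
    fix n x a assume "x \<in> simplices X n" "a \<le> m"
    then show "\<Phi> n x a = form_inclusion m \<alpha> n x a"
      using "0.prems"(4)[of x n a] \<alpha>(2) by (auto simp: form_inclusion_value single_def)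
  qed
  interpret M: abelian_group "gr E m" by (rule E.gr_group)
  have "\<Phi> \<ominus>\<^bsub>gr E m\<^esub> form_inclusion m \<alpha> = \<zero>\<^bsub>gr E m\<^esub>"
    using form_inclusion_closed[OF \<alpha>(1)] by (simp add: eq M.minus_eq M.r_neg)
  then show ?case using E.coboundaries_zero[of m] by (intro bexI[OF _ \<alpha>(1)]) (simp only:)
next
  case (Suc k)
  note \<Phi> = Suc.prems(1)
  obtain l where l: "m = Suc l" "k \<le> l" using Suc.prems(2) by (cases m) auto
  have F: "natural_family (Suc k) (l - k) (\<lambda>n x. \<Phi> n x (Suc k))"
    using E_component_natural[OF \<Phi> Suc.prems(2)] l by simp
  \<comment> \<open>Component k + 2 of \<Phi> vanishes, so this is component k + 2 of its total
    differential, which is zero by assumption.\<close>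
  have "simplex_del n (Suc k) (l - k) (\<Phi> n x (Suc k)) = \<zero>\<^bsub>simplex_module n (Suc (Suc k)) (l - k)\<^esub>" if x: "x \<in> simplices X n" for n x
    using K.tot_diff_del[OF E_closed[OF \<Phi> x], of "Suc k"] Suc.prems(3)[OF x, of "Suc k"] Suc.prems(4)[OF x, of "Suc (Suc k)"] x l
    by (simp add: E_diff_value)
  then obtain U where U: "natural_family k (l - k) U"
    "\<And>n x. x \<in> simplices X n \<Longrightarrow> simplex_del n k (l - k) (U n x) = \<Phi> n x (Suc k)"
    using del_exact[OF F] by blast
  have lk: "l = k + (l - k)" using l by simp
  define \<Psi> where "\<Psi> = family_form l k U"
  have \<Psi>: "\<Psi> \<in> carrier (gr E l)" unfolding \<Psi>_def by (rule family_form_closed[OF U(1) lk])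
  have d\<Psi>: "diff E l \<Psi> \<in> carrier (gr E m)" using E.forms_diff_closed[OF \<Psi>] l by simp
  \<comment> \<open>Above column k the coboundary of \<Psi> has only the component
    \<open>del U\<close>, which is the one to be removed; its \<open>der\<close> part falls into
    column k.\<close>
  have \<Psi>_val: "diff E l \<Psi> n x c = (if c = Suc k then \<Phi> n x (Suc k) else \<zero>\<^bsub>simplex_module n c (m - c)\<^esub>)"
    if x: "x \<in> simplices X n" and c: "k < c" "c \<le> m" for n x c
    using K.tot_diff_single_value[OF natural_family_closed[OF U(1) x] lk, of c] c U(2)[OF x] l x
    by (simp add: E_diff_value \<Psi>_def family_form_value)
  interpret M: abelian_group "gr E m" by (rule E.gr_group)
  let ?\<Phi> = "\<Phi> \<ominus>\<^bsub>gr E m\<^esub> diff E l \<Psi>"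
  have \<Phi>': "?\<Phi> \<in> carrier (gr E m)" using \<Phi> d\<Psi> by simp
  have "\<exists>\<alpha>\<in>carrier (gr (forms A X) m). ?\<Phi> \<ominus>\<^bsub>gr E m\<^esub> form_inclusion m \<alpha> \<in> coboundaries E m"
  proof (rule Suc.IH[OF \<Phi>'])
    show "k \<le> m" using l by simp
    \<comment> \<open>Subtracting a coboundary leaves the differential, and with it the hypothesis
      of the induction, unchanged.\<close>
    have "diff E m ?\<Phi> = diff E m \<Phi>"
    proof -
      interpret N: abelian_group "gr E (Suc m)" by (rule E.gr_group)
      have "diff E m (diff E l \<Psi>) = \<zero>\<^bsub>gr E (Suc m)\<^esub>" using E.diff_diff[OF \<Psi>] l by simp
      then show ?thesis
        using linear_minus[OF E.gr_module E.gr_module E.diff_linear \<Phi> d\<Psi>] linear_closed[OF E.diff_linear \<Phi>]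
        by (simp add: N.minus_eq)
    qed
    then show "diff E m ?\<Phi> n x (Suc c) = \<zero>\<^bsub>simplex_module n (Suc c) (m - c)\<^esub>" if "x \<in> simplices X n" "c \<le> m" for n x c
      using Suc.prems(3)[OF that] by simp
    show "?\<Phi> n x a = \<zero>\<^bsub>simplex_module n a (m - a)\<^esub>" if x: "x \<in> simplices X n" and a: "k < a" "a \<le> m" for n x a
    proof -
      interpret S: abelian_group "simplex_module n a (m - a)" by (rule simplex_group)
      have "?\<Phi> n x a = \<Phi> n x a \<ominus>\<^bsub>simplex_module n a (m - a)\<^esub> diff E l \<Psi> n x a"
        by (rule linear_minus[OF E.gr_module simplex_module_module E_component_linear[OF x a(2)] \<Phi> d\<Psi>])
      moreover have "\<Phi> n x a \<in> carrier (simplex_module n a (m - a))"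
        by (rule linear_closed[OF E_component_linear[OF x a(2)] \<Phi>])
      moreover have "diff E l \<Psi> n x a = \<Phi> n x a" using \<Psi>_val[OF x a] Suc.prems(4)[OF x _ a(2)] a by auto
      ultimately show ?thesis by (simp add: S.minus_eq S.r_neg)
    qed
  qed
  then obtain \<alpha> where \<alpha>: "\<alpha> \<in> carrier (gr (forms A X) m)"
    "?\<Phi> \<ominus>\<^bsub>gr E m\<^esub> form_inclusion m \<alpha> \<in> coboundaries E m" by blast
  note i = form_inclusion_closed[OF \<alpha>(1)]
  have "diff E l \<Psi> \<in> coboundaries E m" using \<Psi> l by simp
  from E.coboundaries_add[OF \<alpha>(2) this]
  have "?\<Phi> \<ominus>\<^bsub>gr E m\<^esub> form_inclusion m \<alpha> \<oplus>\<^bsub>gr E m\<^esub> diff E l \<Psi> \<in> coboundaries E m" .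
  moreover have "?\<Phi> \<ominus>\<^bsub>gr E m\<^esub> form_inclusion m \<alpha> \<oplus>\<^bsub>gr E m\<^esub> diff E l \<Psi> = \<Phi> \<ominus>\<^bsub>gr E m\<^esub> form_inclusion m \<alpha>"
    by (rule M.minus_minus_plus[OF \<Phi> d\<Psi> i])
  ultimately show ?case using \<alpha>(1) by auto
qed

theorem quasi_iso_form_inclusion: "quasi_iso R (forms A X) E form_inclusion"
proof (rule quasi_isoI)
  show "cochain_complex R (forms A X)" "cochain_complex R E"
    using dg_algebra.axioms(1)[OF dg_algebra_forms] dg_algebra.axioms(1)[OF E.dg_algebra_forms] .
  show "cochain_map R (forms A X) E form_inclusion" using dga_hom_form_inclusion by (simp add: dga_hom_def)
  \<comment> \<open>Evaluation at the vertex 0 recovers the form; this gives injectivity.\<close>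
  have comp_eq: "form_inclusion q \<alpha> n x 0 (\<lambda>j\<in>{..0}. 0) = \<alpha> n x" if "x \<in> simplices X n" for q \<alpha> n x
    using that const_ord_maps[of 0 n 0] by (simp add: form_inclusion_value single_def del: atMost_0)
  show "\<alpha> = \<zero>\<^bsub>gr (forms A X) q\<^esub>"
    if \<alpha>: "\<alpha> \<in> carrier (gr (forms A X) q)" and z: "form_inclusion q \<alpha> = \<zero>\<^bsub>gr E q\<^esub>" for q \<alpha>
  proof (rule forms_eqI[OF \<alpha> forms_zero_closed])
    fix n x assume x: "x \<in> simplices X n"
    have "\<alpha> n x = \<zero>\<^bsub>gr E q\<^esub> n x 0 (\<lambda>j\<in>{..0}. 0)" using comp_eq[OF x, of q \<alpha>] z by simp
    also have "\<dots> = \<zero>\<^bsub>simplex_module n 0 q\<^esub> (\<lambda>j\<in>{..0}. 0)"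
      using linear_zero[OF E.gr_module simplex_module_module E_component_linear[OF x, of 0 q]] by simp
    also have "\<dots> = \<zero>\<^bsub>gr (level A n) q\<^esub>" by (rule simplex_zero_value[OF const_ord_maps]) simp
    finally show "\<alpha> n x = \<zero>\<^bsub>gr (forms A X) q\<^esub> n x" using x by (simp add: forms_ops)
  qed
  show "\<exists>\<alpha>\<in>carrier (gr (forms A X) m). \<Phi> \<ominus>\<^bsub>gr E m\<^esub> form_inclusion m \<alpha> \<in> coboundaries E m"
    if \<Phi>: "\<Phi> \<in> carrier (gr E m)" and "\<beta> \<in> carrier (gr (forms A X) (Suc m))" and d: "diff E m \<Phi> = form_inclusion (Suc m) \<beta>" for m \<Phi> \<beta>
  proof (rule form_inclusion_lift[OF \<Phi> le_refl])
    show "diff E m \<Phi> n x (Suc c) = \<zero>\<^bsub>simplex_module n (Suc c) (m - c)\<^esub>" if "x \<in> simplices X n" "c \<le> m" for n x c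
      using that by (simp add: d form_inclusion_value single_def)
  qed simp
qed

end

section \<open>Cochains as the row q = 0\<close>

context acyclic_forms
begin

interpretation E: forms_algebra R "cochain_sdga A" X
  by (intro forms_algebra.intro simplicial_dga_cochain_sdga X.simplicial_set_axioms)

interpretation K: bigraded_algebra R "simplex_algebra n" for n
  by (rule simplex_cochains_bigraded)

interpretation E: dg_algebra R E
  by (rule E.dg_algebra_forms)

abbreviation level_one :: "nat \<Rightarrow> 'a"
  where "level_one n \<equiv> gone (level A n)"

lemma level_one_closed: "level_one n \<in> carrier (gr (level A n) 0)"
  by (rule dg_algebra.gone_closed[OF level_dga])

lemma scalar_closed: "r \<in> carrier R \<Longrightarrow> r \<odot>\<^bsub>gr (level A n) 0\<^esub> level_one n \<in> carrier (gr (level A n) 0)"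
  by (rule module.smult_closed[OF level_module _ level_one_closed])

text \<open>The Leibniz rule for 1 = 1 1 gives d1 = d1 + d1, so the unit and its multiples are
  closed.\<close>

lemma diff_scalar:
  assumes "r \<in> carrier R"
  shows "diff (level A n) 0 (r \<odot>\<^bsub>gr (level A n) 0\<^esub> level_one n) = \<zero>\<^bsub>gr (level A n) 1\<^esub>"
proof -
  interpret D: dg_algebra R "level A n" by (rule level_dga)
  interpret M: module R "gr (level A n) (Suc 0)" by (rule level_module)
  note d = linear_closed[OF D.diff_linear level_one_closed]
  have "diff (level A n) 0 (level_one n) =
      diff (level A n) 0 (level_one n) \<oplus>\<^bsub>gr (level A n) 1\<^esub> diff (level A n) 0 (level_one n)"
    using D.leibniz[OF level_one_closed level_one_closed] d level_one_closed
    by (simp add: signed_def D.gmult_one_left D.gmult_one_right[of _ 1, simplified])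
  then have "diff (level A n) 0 (level_one n) = \<zero>\<^bsub>gr (level A n) 1\<^esub>" using d by simp
  then show ?thesis
    using assms by (simp add: linear_smult[OF D.diff_linear _ level_one_closed] M.smult_r_null)
qed

lemma scalar_mult:
  assumes r: "r \<in> carrier R" and s: "s \<in> carrier R"
  shows "gmult (level A n) 0 0 (r \<odot>\<^bsub>gr (level A n) 0\<^esub> level_one n) (s \<odot>\<^bsub>gr (level A n) 0\<^esub> level_one n) =
    (r \<otimes> s) \<odot>\<^bsub>gr (level A n) 0\<^esub> level_one n"
proof -
  interpret D: dg_algebra R "level A n" by (rule level_dga)
  show ?thesis
    using linear_smult[OF D.gmult_linear_right[OF scalar_closed[OF r], of 0] s level_one_closed]
      D.gmult_one_right[OF scalar_closed[OF r]] module.smult_assoc1[OF level_module s r level_one_closed] m_comm[OF r s]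
    by simp
qed

definition cochain_family :: "nat \<Rightarrow> ('x \<Rightarrow> 'r) \<Rightarrow> nat \<Rightarrow> 'x \<Rightarrow> (nat \<Rightarrow> nat) \<Rightarrow> 'a"
  where "cochain_family q c n x = (\<lambda>\<theta>\<in>ord_maps q n. c (act X q n \<theta> x) \<odot>\<^bsub>gr (level A n) 0\<^esub> level_one n)"

definition cochain_inclusion :: "nat \<Rightarrow> ('x \<Rightarrow> 'r) \<Rightarrow> nat \<Rightarrow> 'x \<Rightarrow> nat \<Rightarrow> (nat \<Rightarrow> nat) \<Rightarrow> 'a"
  where "cochain_inclusion q c = family_form q q (cochain_family q c)"

lemma cochains_carrier: "carrier (gr (cochains R X) q) = simplices X q \<rightarrow>\<^sub>E carrier R"
  by (simp add: cochains_def)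

lemma cochain_closed: "c \<in> carrier (gr (cochains R X) q) \<Longrightarrow> x \<in> simplices X q \<Longrightarrow> c x \<in> carrier R"
  by (auto simp: cochains_def)

lemma cochain_act_closed: "c \<in> carrier (gr (cochains R X) q) \<Longrightarrow> x \<in> simplices X n \<Longrightarrow> \<theta> \<in> ord_maps q n \<Longrightarrow>
    c (act X q n \<theta> x) \<in> carrier R"
  by (rule cochain_closed[OF _ X.act_closed])

lemma cochain_family_closed: "c \<in> carrier (gr (cochains R X) q) \<Longrightarrow> x \<in> simplices X n \<Longrightarrow>
    cochain_family q c n x \<in> carrier (simplex_module n q 0)"
  unfolding cochain_family_def by (intro simplex_memI scalar_closed cochain_act_closed)

lemma cochain_family_natural:
  assumes c: "c \<in> carrier (gr (cochains R X) q)"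
  shows "natural_family q 0 (cochain_family q c)"
  unfolding natural_family_def
proof (intro conjI allI ballI)
  fix m n \<theta> x assume \<theta>: "\<theta> \<in> ord_maps m n" and x: "x \<in> simplices X n"
  show "cochain_family q c m (act X m n \<theta> x) = simplex_pull A m n \<theta> q 0 (cochain_family q c n x)"
  proof (rule simplex_eqI[OF cochain_family_closed[OF c X.act_closed[OF \<theta> x]]
        linear_closed[OF simplex_pull_linear[OF \<theta>] cochain_family_closed[OF c x]]])
    fix \<psi> assume \<psi>: "\<psi> \<in> ord_maps q m"
    note cm = compose_ord_maps[OF \<psi> \<theta>]
    show "cochain_family q c m (act X m n \<theta> x) \<psi> = simplex_pull A m n \<theta> q 0 (cochain_family q c n x) \<psi>"
      using \<psi> cm X.act_compose[OF \<psi> \<theta> x]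
        linear_smult[OF dact_linear[OF \<theta>] cochain_act_closed[OF c x cm] level_one_closed] dga_hom_one[OF dact_hom[OF \<theta>]]
      by (simp add: cochain_family_def simplex_pull_value)
  qed
qed (rule cochain_family_closed[OF c])

lemma cochain_inclusion_closed: "c \<in> carrier (gr (cochains R X) q) \<Longrightarrow> cochain_inclusion q c \<in> carrier (gr E q)"
  unfolding cochain_inclusion_def by (rule family_form_closed[OF cochain_family_natural]) simp_all

lemma cochain_inclusion_value: "x \<in> simplices X n \<Longrightarrow>
    cochain_inclusion q c n x = single (simplex_algebra n) q q (cochain_family q c n x)"
  by (simp add: cochain_inclusion_def family_form_value)

lemma cochains_ops:
  "c \<oplus>\<^bsub>gr (cochains R X) q\<^esub> c' = (\<lambda>x\<in>simplices X q. c x \<oplus> c' x)"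
  "\<zero>\<^bsub>gr (cochains R X) q\<^esub> = (\<lambda>x\<in>simplices X q. \<zero>)"
  "r \<odot>\<^bsub>gr (cochains R X) q\<^esub> c = (\<lambda>x\<in>simplices X q. r \<otimes> c x)"
  "diff (cochains R X) q c = (\<lambda>x\<in>simplices X (Suc q). altsum R (Suc q) (\<lambda>i. c (act X q (Suc q) (coface q i) x)))"
  "gmult (cochains R X) p q c c' = (\<lambda>x\<in>simplices X (p + q).
      c (act X p (p + q) (front_map p) x) \<otimes> c' (act X q (p + q) (back_map p q) x))"
  "gone (cochains R X) = (\<lambda>x\<in>simplices X 0. \<one>)"
  by (simp_all add: cochains_def altsum_def face_def coface_def front_map_def back_map_def)

text \<open>At the identity of [q] the family over a q-simplex \<open>x\<close> has the value
  \<open>c x\<close> times the unit, and the unit has no annihilator.\<close>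

lemma cochain_inclusion_eq_zero:
  assumes c: "c \<in> carrier (gr (cochains R X) q)" and z: "cochain_inclusion q c = \<zero>\<^bsub>gr E q\<^esub>"
  shows "c = \<zero>\<^bsub>gr (cochains R X) q\<^esub>"
proof -
  have "c x = \<zero>" if x: "x \<in> simplices X q" for x
  proof (rule unit_injective[of _ q])
    show "c x \<in> carrier R" by (rule cochain_closed[OF c x])
    have "c x \<odot>\<^bsub>gr (level A q) 0\<^esub> level_one q = cochain_inclusion q c q x q (\<lambda>i\<in>{..q}. i)"
      using x id_ord_maps X.act_id[OF x] by (simp add: cochain_inclusion_value single_def cochain_family_def)
    also have "\<dots> = \<zero>\<^bsub>simplex_module q q 0\<^esub> (\<lambda>i\<in>{..q}. i)"
      unfolding z using linear_zero[OF E.gr_module simplex_module_module E_component_linear[OF x, of q q]] by simp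
    also have "\<dots> = \<zero>\<^bsub>gr (level A q) 0\<^esub>" by (rule simplex_zero_value[OF id_ord_maps])
    finally show "c x \<odot>\<^bsub>gr (level A q) 0\<^esub> level_one q = \<zero>\<^bsub>gr (level A q) 0\<^esub>" .
  qed
  then show ?thesis using c by (auto simp: cochains_carrier cochains_ops(2) fun_eq_iff PiE_iff extensional_def)
qed

lemma cochain_inclusion_add:
  assumes c: "c \<in> carrier (gr (cochains R X) q)" and c': "c' \<in> carrier (gr (cochains R X) q)"
  shows "c \<oplus>\<^bsub>gr (cochains R X) q\<^esub> c' \<in> carrier (gr (cochains R X) q)"
    and "cochain_inclusion q (c \<oplus>\<^bsub>gr (cochains R X) q\<^esub> c') = cochain_inclusion q c \<oplus>\<^bsub>gr E q\<^esub> cochain_inclusion q c'"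
proof -
  show cl: "c \<oplus>\<^bsub>gr (cochains R X) q\<^esub> c' \<in> carrier (gr (cochains R X) q)"
    using c c' by (auto simp: cochains_carrier cochains_ops)
  show "cochain_inclusion q (c \<oplus>\<^bsub>gr (cochains R X) q\<^esub> c') = cochain_inclusion q c \<oplus>\<^bsub>gr E q\<^esub> cochain_inclusion q c'"
  proof (rule E.forms_eqI[OF cochain_inclusion_closed[OF cl]
        E.forms_add_closed[OF cochain_inclusion_closed[OF c] cochain_inclusion_closed[OF c']]])
    fix n x assume x: "x \<in> simplices X n"
    have "cochain_family q (c \<oplus>\<^bsub>gr (cochains R X) q\<^esub> c') n x =
        cochain_family q c n x \<oplus>\<^bsub>simplex_module n q 0\<^esub> cochain_family q c' n x"
      using cochain_act_closed[OF c x] cochain_act_closed[OF c' x] X.act_closed[OF _ x] level_one_closed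
      by (auto simp: cochain_family_def cochains_ops(1) simplex_cochains_simps(1) pi_module_simps fun_eq_iff
          module.smult_l_distr[OF level_module])
    then show "cochain_inclusion q (c \<oplus>\<^bsub>gr (cochains R X) q\<^esub> c') n x =
        (cochain_inclusion q c \<oplus>\<^bsub>gr E q\<^esub> cochain_inclusion q c') n x"
      using x K.single_add[OF _ cochain_family_closed[OF c x] cochain_family_closed[OF c' x], of q]
      by (simp add: cochain_inclusion_value E.forms_ops(1) level_cochain_sdga)
  qed
qed

lemma cochain_inclusion_smult:
  assumes r: "r \<in> carrier R" and c: "c \<in> carrier (gr (cochains R X) q)"
  shows "r \<odot>\<^bsub>gr (cochains R X) q\<^esub> c \<in> carrier (gr (cochains R X) q)"
    and "cochain_inclusion q (r \<odot>\<^bsub>gr (cochains R X) q\<^esub> c) = r \<odot>\<^bsub>gr E q\<^esub> cochain_inclusion q c"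
proof -
  show cl: "r \<odot>\<^bsub>gr (cochains R X) q\<^esub> c \<in> carrier (gr (cochains R X) q)"
    using r c by (auto simp: cochains_carrier cochains_ops)
  show "cochain_inclusion q (r \<odot>\<^bsub>gr (cochains R X) q\<^esub> c) = r \<odot>\<^bsub>gr E q\<^esub> cochain_inclusion q c"
  proof (rule E.forms_eqI[OF cochain_inclusion_closed[OF cl] E.forms_smult_closed[OF r cochain_inclusion_closed[OF c]]])
    fix n x assume x: "x \<in> simplices X n"
    have "cochain_family q (r \<odot>\<^bsub>gr (cochains R X) q\<^esub> c) n x = r \<odot>\<^bsub>simplex_module n q 0\<^esub> cochain_family q c n x"
      using cochain_act_closed[OF c x] X.act_closed[OF _ x] level_one_closed r
      by (auto simp: cochain_family_def cochains_ops(3) simplex_cochains_simps(1) pi_module_simps fun_eq_iff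
          module.smult_assoc1[OF level_module])
    then show "cochain_inclusion q (r \<odot>\<^bsub>gr (cochains R X) q\<^esub> c) n x = (r \<odot>\<^bsub>gr E q\<^esub> cochain_inclusion q c) n x"
      using x linear_smult[OF K.linear_single r cochain_family_closed[OF c x], of q]
      by (simp add: cochain_inclusion_value E.forms_ops(3) level_cochain_sdga)
  qed
qed

lemma cochain_inclusion_zero:
  shows "\<zero>\<^bsub>gr (cochains R X) q\<^esub> \<in> carrier (gr (cochains R X) q)"
    and "cochain_inclusion q \<zero>\<^bsub>gr (cochains R X) q\<^esub> = \<zero>\<^bsub>gr E q\<^esub>"
proof -
  show cl: "\<zero>\<^bsub>gr (cochains R X) q\<^esub> \<in> carrier (gr (cochains R X) q)"
    by (auto simp: cochains_carrier cochains_ops)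
  interpret M: abelian_group "gr E q" by (rule E.gr_group)
  have "\<zero>\<^bsub>gr (cochains R X) q\<^esub> \<oplus>\<^bsub>gr (cochains R X) q\<^esub> \<zero>\<^bsub>gr (cochains R X) q\<^esub> = \<zero>\<^bsub>gr (cochains R X) q\<^esub>"
    by (auto simp: cochains_ops)
  then show "cochain_inclusion q \<zero>\<^bsub>gr (cochains R X) q\<^esub> = \<zero>\<^bsub>gr E q\<^esub>"
    using cochain_inclusion_add(2)[OF cl cl] cochain_inclusion_closed[OF cl] by simp
qed

text \<open>Values are multiples of the unit, so \<open>der\<close> vanishes on them; what remains
  is \<open>del\<close>, which commutes with passing from scalars to multiples and so is the
  simplicial coboundary.\<close>

lemma cochain_inclusion_diff:
  assumes c: "c \<in> carrier (gr (cochains R X) q)"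
  shows "diff (cochains R X) q c \<in> carrier (gr (cochains R X) (Suc q))"
    and "cochain_inclusion (Suc q) (diff (cochains R X) q c) = diff E q (cochain_inclusion q c)"
proof -
  show cl: "diff (cochains R X) q c \<in> carrier (gr (cochains R X) (Suc q))"
    using cochain_act_closed[OF c _ coface_ord_maps] by (auto simp: cochains_carrier cochains_ops altsum_closed)
  show "cochain_inclusion (Suc q) (diff (cochains R X) q c) = diff E q (cochain_inclusion q c)"
  proof (rule E_eqI[OF cochain_inclusion_closed[OF cl] E.forms_diff_closed[OF cochain_inclusion_closed[OF c]]])
    fix n x a assume x: "x \<in> simplices X n" and a: "a \<le> Suc q"
    note f = cochain_family_closed[OF c x]
    have der: "simplex_der n q 0 (cochain_family q c n x) = \<zero>\<^bsub>simplex_module n q (Suc 0)\<^esub>"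
      by (rule simplex_zeroI[OF linear_closed[OF simplex_der_linear f]])
        (simp add: simplex_cochains_simps(3) cochain_family_def diff_scalar[simplified] cochain_act_closed[OF c x])
    have del: "simplex_del n q 0 (cochain_family q c n x) = cochain_family (Suc q) (diff (cochains R X) q c) n x"
    proof (rule simplex_eqI[OF linear_closed[OF simplex_del_linear f] cochain_family_closed[OF cl x]])
      fix \<theta> assume \<theta>: "\<theta> \<in> ord_maps (Suc q) n"
      note co = compose_coface_ord_maps[OF \<theta>]
      have "simplex_del n q 0 (cochain_family q c n x) \<theta> = altsum (gr (level A n) 0) (Suc q)
          (\<lambda>i. c (act X q n (compose {..q} \<theta> (coface q i)) x) \<odot>\<^bsub>gr (level A n) 0\<^esub> level_one n)"
        using \<theta> co by (simp add: simplex_cochains_simps(2) cochain_family_def)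
      also have "\<dots> = altsum R (Suc q) (\<lambda>i. c (act X q n (compose {..q} \<theta> (coface q i)) x)) \<odot>\<^bsub>gr (level A n) 0\<^esub> level_one n"
        by (rule module.altsum_smult[OF level_module level_one_closed, symmetric]) (rule cochain_act_closed[OF c x co])
      finally show "simplex_del n q 0 (cochain_family q c n x) \<theta> =
          cochain_family (Suc q) (diff (cochains R X) q c) n x \<theta>"
        using \<theta> X.act_closed[OF \<theta> x] X.act_compose[OF coface_ord_maps \<theta> x]
        by (simp add: cochain_family_def cochains_ops(4))
    qed
    show "cochain_inclusion (Suc q) (diff (cochains R X) q c) n x a = diff E q (cochain_inclusion q c) n x a"
      using x a K.tot_diff_single_value[OF f _ a] del der
      by (simp add: E_diff_value cochain_inclusion_value) (auto simp: single_def)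
  qed
qed

text \<open>The sign exponent contains the second degree 0 of the left factor. Front and back face
  of the simplex induced by \<theta> are induced by front and back part of \<theta>, which matches
  the two Alexander-Whitney formulas.\<close>

lemma cochain_inclusion_mult:
  assumes c: "c \<in> carrier (gr (cochains R X) p)" and c': "c' \<in> carrier (gr (cochains R X) q)"
  shows "gmult (cochains R X) p q c c' \<in> carrier (gr (cochains R X) (p + q))"
    and "cochain_inclusion (p + q) (gmult (cochains R X) p q c c') = gmult E p q (cochain_inclusion p c) (cochain_inclusion q c')"
proof -
  show cl: "gmult (cochains R X) p q c c' \<in> carrier (gr (cochains R X) (p + q))"
    using cochain_act_closed[OF c _ front_map_ord_maps] cochain_act_closed[OF c' _ back_map_ord_maps]
    by (auto simp: cochains_carrier cochains_ops)
  show "cochain_inclusion (p + q) (gmult (cochains R X) p q c c') = gmult E p q (cochain_inclusion p c) (cochain_inclusion q c')"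
  proof (rule E.forms_eqI[OF cochain_inclusion_closed[OF cl]
        E.forms_gmult_closed[OF cochain_inclusion_closed[OF c] cochain_inclusion_closed[OF c']]])
    fix n x assume x: "x \<in> simplices X n"
    note f = cochain_family_closed[OF c x] and f' = cochain_family_closed[OF c' x]
    have "cup (simplex_algebra n) p 0 q 0 (cochain_family p c n x) (cochain_family q c' n x) =
        cochain_family (p + q) (gmult (cochains R X) p q c c') n x"
    proof (rule simplex_eqI[OF _ cochain_family_closed[OF cl x]])
      show "cup (simplex_algebra n) p 0 q 0 (cochain_family p c n x) (cochain_family q c' n x) \<in> carrier (simplex_module n (p + q) 0)"
        using linear_closed[OF K.cup_right[OF f] f'] by simp
      fix \<theta> assume \<theta>: "\<theta> \<in> ord_maps (p + q) n"
      note fb = compose_front_map[OF \<theta>] compose_back_map[OF \<theta>]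
      note scalars = cochain_act_closed[OF c X.act_closed[OF \<theta> x] front_map_ord_maps]
        cochain_act_closed[OF c' X.act_closed[OF \<theta> x] back_map_ord_maps]
      show "cup (simplex_algebra n) p 0 q 0 (cochain_family p c n x) (cochain_family q c' n x) \<theta> =
          cochain_family (p + q) (gmult (cochains R X) p q c c') n x \<theta>"
        using \<theta> fb X.act_closed[OF \<theta> x] X.act_compose[OF front_map_ord_maps \<theta> x] X.act_compose[OF back_map_ord_maps \<theta> x]
        by (simp add: cochain_family_def cochains_ops(5) simplex_cochains_simps(4)
            scalar_mult[OF scalars])
    qed
    then show "cochain_inclusion (p + q) (gmult (cochains R X) p q c c') n x =
        gmult E p q (cochain_inclusion p c) (cochain_inclusion q c') n x"
      using x K.tot_mult_single[OF f f', of p q]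
      by (simp add: cochain_inclusion_value E.forms_ops(5) level_cochain_sdga signed_def)
  qed
qed

lemma cochain_inclusion_one:
  shows "gone (cochains R X) \<in> carrier (gr (cochains R X) 0)"
    and "cochain_inclusion 0 (gone (cochains R X)) = gone E"
proof -
  show cl: "gone (cochains R X) \<in> carrier (gr (cochains R X) 0)"
    by (auto simp: cochains_carrier cochains_ops)
  show "cochain_inclusion 0 (gone (cochains R X)) = gone E"
  proof (rule E.forms_eqI[OF cochain_inclusion_closed[OF cl] E.forms_gone_closed])
    fix n x assume x: "x \<in> simplices X n"
    have "cochain_family 0 (gone (cochains R X)) n x = unit (simplex_algebra n)"
      using X.act_closed[OF _ x] level_one_closed
      by (auto simp: cochain_family_def cochains_ops(6) simplex_cochains_simps(5) fun_eq_iff module.smult_one[OF level_module])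
    then show "cochain_inclusion 0 (gone (cochains R X)) n x = gone E n x"
      using x by (simp add: cochain_inclusion_value E.forms_ops(6) level_cochain_sdga)
  qed
qed

text \<open>The difference is formed with the scalar -1 because the module structure of the cochains
  is only derived afterwards, from this injectivity by \<open>dg_algebra_embed\<close>.\<close>

lemma cochain_inclusion_inj: "inj_on (cochain_inclusion q) (carrier (gr (cochains R X) q))"
proof (rule inj_onI)
  fix c c' assume c: "c \<in> carrier (gr (cochains R X) q)" and c': "c' \<in> carrier (gr (cochains R X) q)"
    and eq: "cochain_inclusion q c = cochain_inclusion q c'"
  interpret M: module R "gr E q" by (rule E.gr_module)
  let ?d = "c \<oplus>\<^bsub>gr (cochains R X) q\<^esub> ((\<ominus> \<one>) \<odot>\<^bsub>gr (cochains R X) q\<^esub> c')"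
  have m1: "\<ominus> \<one> \<in> carrier R" by simp
  note n = cochain_inclusion_smult[OF m1 c']
  have "cochain_inclusion q ?d = cochain_inclusion q c' \<oplus>\<^bsub>gr E q\<^esub> (\<ominus> \<one>) \<odot>\<^bsub>gr E q\<^esub> cochain_inclusion q c'"
    using cochain_inclusion_add(2)[OF c n(1)] n(2) eq by simp
  also have "\<dots> = \<zero>\<^bsub>gr E q\<^esub>"
    using cochain_inclusion_closed[OF c'] by (simp add: M.smult_l_minus M.r_neg)
  finally have "?d = \<zero>\<^bsub>gr (cochains R X) q\<^esub>"
    by (rule cochain_inclusion_eq_zero[OF cochain_inclusion_add(1)[OF c n(1)]])
  then have d: "?d x = \<zero>\<^bsub>gr (cochains R X) q\<^esub> x" for x by (rule fun_cong)
  have "c x = c' x" if x: "x \<in> simplices X q" for x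
  proof (rule minus_zeroD[OF cochain_closed[OF c x] cochain_closed[OF c' x]])
    show "c x \<ominus> c' x = \<zero>"
      using d[of x] x cochain_closed[OF c' x] by (simp add: cochains_ops l_minus minus_eq)
  qed
  then show "c = c'" using c c' unfolding cochains_carrier by (rule PiE_ext[rotated 2])
qed

text \<open>The conclusion includes that \<open>cochains R X\<close> is a differential graded
  algebra; this is inherited from \<open>E\<close>.\<close>

theorem dga_hom_cochain_inclusion: "dga_hom R (cochains R X) E cochain_inclusion"
  by (rule dg_algebra_embed[OF E.dg_algebra_forms cochain_inclusion_closed cochain_inclusion_inj])
    (auto simp: cochain_inclusion_add cochain_inclusion_zero cochain_inclusion_smult cochain_inclusion_diff
      cochain_inclusion_mult cochain_inclusion_one)

text \<open>The mirror image of \<open>form_inclusion_lift\<close>: now components below k vanish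
  and k rises to m. The lowest component is closed under \<open>der\<close> and, by exactness of the
  columns, is removed by a coboundary that otherwise changes only the next one. In bidegree (m, 0) a
  closed family is a cochain of X.\<close>

lemma cochain_inclusion_lift:
  assumes "\<Phi> \<in> carrier (gr E m)" "k \<le> m"
    and "\<And>n x c. x \<in> simplices X n \<Longrightarrow> c \<le> m \<Longrightarrow> diff E m \<Phi> n x c = \<zero>\<^bsub>simplex_module n c (Suc m - c)\<^esub>"
    and "\<And>n x a. x \<in> simplices X n \<Longrightarrow> a < k \<Longrightarrow> \<Phi> n x a = \<zero>\<^bsub>simplex_module n a (m - a)\<^esub>"
  shows "\<exists>c\<in>carrier (gr (cochains R X) m). \<Phi> \<ominus>\<^bsub>gr E m\<^esub> cochain_inclusion m c \<in> coboundaries E m"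
  using assms(2,1,3,4)
proof (induction k arbitrary: \<Phi> rule: inc_induct)
  case base
  note \<Phi> = base.prems(1)
  have F: "natural_family m 0 (\<lambda>n x. \<Phi> n x m)" using E_component_natural[OF \<Phi>, of m] by simp
  have "simplex_der n m 0 (\<Phi> n x m) = \<zero>\<^bsub>simplex_module n m 1\<^esub>" if x: "x \<in> simplices X n" for n x
  proof -
    interpret S: abelian_group "simplex_module n m 1" by (rule simplex_group)
    \<comment> \<open>The total differential carries the sign (-1)^m on \<open>der\<close>; applying
      this sign once more removes it.\<close>
    have "signed (simplex_module n m 1) m (simplex_der n m 0 (\<Phi> n x m)) = \<zero>\<^bsub>simplex_module n m 1\<^esub>"
      using K.tot_diff_der[OF E_closed[OF \<Phi> x] le_refl] base.prems(2)[OF x, of m] base.prems(3)[OF x] x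
      by (simp add: E_diff_value)
    then show ?thesis
      using S.signed_signed[of "simplex_der n m 0 (\<Phi> n x m)" m m] linear_closed[OF simplex_der_linear natural_family_closed[OF F x]]
        S.signed_zero[of m]
      by (simp add: signed_def[of _ "m + m"])
  qed
  then obtain c where c: "c \<in> simplices X m \<rightarrow>\<^sub>E carrier R"
    "\<And>n x. x \<in> simplices X n \<Longrightarrow> \<Phi> n x m = (\<lambda>\<theta>\<in>ord_maps m n. c (act X m n \<theta> x) \<odot>\<^bsub>gr (level A n) 0\<^esub> level_one n)"
    using der_kernel[OF F] by auto
  have c': "c \<in> carrier (gr (cochains R X) m)" using c by (simp add: cochains_carrier)
  have eq: "\<Phi> = cochain_inclusion m c"
  proof (rule E_eqI[OF \<Phi> cochain_inclusion_closed[OF c']])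
    fix n x a assume "x \<in> simplices X n" "a \<le> m"
    then show "\<Phi> n x a = cochain_inclusion m c n x a"
      using base.prems(3)[of x n a] c(2) by (auto simp: cochain_inclusion_value single_def cochain_family_def)
  qed
  interpret M: abelian_group "gr E m" by (rule E.gr_group)
  have "\<Phi> \<ominus>\<^bsub>gr E m\<^esub> cochain_inclusion m c = \<zero>\<^bsub>gr E m\<^esub>"
    using cochain_inclusion_closed[OF c'] by (simp add: eq M.minus_eq M.r_neg)
  then show ?case using E.coboundaries_zero[of m] by (intro bexI[OF _ c']) (simp only:)
next
  case (step k)
  note \<Phi> = step.prems(1)
  obtain l where l: "m = Suc l" "k \<le> l" using step.hyps(2) by (cases m) auto
  have km: "m - k = Suc (l - k)" using l by simp
  have \<Phi>k: "natural_family k (Suc (l - k)) (\<lambda>n x. \<Phi> n x k)"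
    using E_component_natural[OF \<Phi>, of k] l km by simp
  let ?M = "\<lambda>n. simplex_module n k (Suc (l - k))" and ?N = "\<lambda>n. simplex_module n k (Suc (Suc (l - k)))"
  \<comment> \<open>The sign is inserted before lifting: the total differential of the lift puts
    (-1)^k in front of \<open>der U\<close>, and the two signs cancel.\<close>
  have F: "natural_family k (Suc (l - k)) (\<lambda>n x. signed (?M n) k (\<Phi> n x k))"
    unfolding natural_family_def
    using natural_family_closed[OF \<Phi>k] natural_family_act[OF \<Phi>k]
    by (auto simp: abelian_group.signed_closed[OF simplex_group]
        linear_signed[OF simplex_module_module simplex_module_module simplex_pull_linear])
  have "simplex_der n k (Suc (l - k)) (signed (?M n) k (\<Phi> n x k)) = \<zero>\<^bsub>?N n\<^esub>" if x: "x \<in> simplices X n" for n x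
  proof -
    have "signed (?N n) k (simplex_der n k (Suc (l - k)) (\<Phi> n x k)) = \<zero>\<^bsub>?N n\<^esub>"
      using K.tot_diff_der[OF E_closed[OF \<Phi> x], of k] step.prems(2)[OF x, of k] step.prems(3)[OF x] x l km
      by (simp add: E_diff_value Suc_diff_le)
    then show ?thesis
      using linear_signed[OF simplex_module_module simplex_module_module simplex_der_linear natural_family_closed[OF \<Phi>k x]] by simp
  qed
  then obtain U where U: "natural_family k (l - k) U"
    "\<And>n x. x \<in> simplices X n \<Longrightarrow> simplex_der n k (l - k) (U n x) = signed (?M n) k (\<Phi> n x k)"
    using der_exact[OF F] by blast
  have lk: "l = k + (l - k)" using l by simp
  define \<Psi> where "\<Psi> = family_form l k U"
  have \<Psi>: "\<Psi> \<in> carrier (gr E l)" unfolding \<Psi>_def by (rule family_form_closed[OF U(1) lk])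
  have d\<Psi>: "diff E l \<Psi> \<in> carrier (gr E m)" using E.forms_diff_closed[OF \<Psi>] l by simp
  have \<Psi>_val: "diff E l \<Psi> n x c = (if c = k then \<Phi> n x k else \<zero>\<^bsub>simplex_module n c (m - c)\<^esub>)"
    if x: "x \<in> simplices X n" and c: "c < Suc k" for n x c
  proof -
    have "signed (?M n) k (signed (?M n) k (\<Phi> n x k)) = \<Phi> n x k"
      using abelian_group.signed_signed[OF simplex_group natural_family_closed[OF \<Phi>k x]] by (simp add: signed_def[of _ "k + k"])
    then show ?thesis
      using K.tot_diff_single_value[OF natural_family_closed[OF U(1) x] lk, of c] c U(2)[OF x] l x
      by (simp add: E_diff_value \<Psi>_def family_form_value)
  qed
  interpret M: abelian_group "gr E m" by (rule E.gr_group)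
  let ?\<Phi> = "\<Phi> \<ominus>\<^bsub>gr E m\<^esub> diff E l \<Psi>"
  have \<Phi>': "?\<Phi> \<in> carrier (gr E m)" using \<Phi> d\<Psi> by simp
  have "\<exists>c\<in>carrier (gr (cochains R X) m). ?\<Phi> \<ominus>\<^bsub>gr E m\<^esub> cochain_inclusion m c \<in> coboundaries E m"
  proof (rule step.IH[OF \<Phi>'])
    have "diff E m ?\<Phi> = diff E m \<Phi>"
    proof -
      interpret N: abelian_group "gr E (Suc m)" by (rule E.gr_group)
      have "diff E m (diff E l \<Psi>) = \<zero>\<^bsub>gr E (Suc m)\<^esub>" using E.diff_diff[OF \<Psi>] l by simp
      then show ?thesis
        using linear_minus[OF E.gr_module E.gr_module E.diff_linear \<Phi> d\<Psi>] linear_closed[OF E.diff_linear \<Phi>]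
        by (simp add: N.minus_eq)
    qed
    then show "diff E m ?\<Phi> n x c = \<zero>\<^bsub>simplex_module n c (Suc m - c)\<^esub>" if "x \<in> simplices X n" "c \<le> m" for n x c
      using step.prems(2)[OF that] by simp
    show "?\<Phi> n x a = \<zero>\<^bsub>simplex_module n a (m - a)\<^esub>" if x: "x \<in> simplices X n" and a: "a < Suc k" for n x a
    proof -
      interpret S: abelian_group "simplex_module n a (m - a)" by (rule simplex_group)
      have am: "a \<le> m" using a step.hyps by simp
      have "?\<Phi> n x a = \<Phi> n x a \<ominus>\<^bsub>simplex_module n a (m - a)\<^esub> diff E l \<Psi> n x a"
        by (rule linear_minus[OF E.gr_module simplex_module_module E_component_linear[OF x am] \<Phi> d\<Psi>])
      moreover have "\<Phi> n x a \<in> carrier (simplex_module n a (m - a))"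
        by (rule linear_closed[OF E_component_linear[OF x am] \<Phi>])
      moreover have "diff E l \<Psi> n x a = \<Phi> n x a" using \<Psi>_val[OF x a] step.prems(3)[OF x, of a] a by auto
      ultimately show ?thesis by (simp add: S.minus_eq S.r_neg)
    qed
  qed
  then obtain c where c: "c \<in> carrier (gr (cochains R X) m)"
    "?\<Phi> \<ominus>\<^bsub>gr E m\<^esub> cochain_inclusion m c \<in> coboundaries E m" by blast
  note i = cochain_inclusion_closed[OF c(1)]
  have "diff E l \<Psi> \<in> coboundaries E m" using \<Psi> l by simp
  from E.coboundaries_add[OF c(2) this]
  have "?\<Phi> \<ominus>\<^bsub>gr E m\<^esub> cochain_inclusion m c \<oplus>\<^bsub>gr E m\<^esub> diff E l \<Psi> \<in> coboundaries E m" .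
  moreover have "?\<Phi> \<ominus>\<^bsub>gr E m\<^esub> cochain_inclusion m c \<oplus>\<^bsub>gr E m\<^esub> diff E l \<Psi> = \<Phi> \<ominus>\<^bsub>gr E m\<^esub> cochain_inclusion m c"
    by (rule M.minus_minus_plus[OF \<Phi> d\<Psi> i])
  ultimately show ?case using c(1) by auto
qed

theorem quasi_iso_cochain_inclusion: "quasi_iso R (cochains R X) E cochain_inclusion"
proof (rule quasi_isoI)
  show "cochain_complex R (cochains R X)" "cochain_complex R E" "cochain_map R (cochains R X) E cochain_inclusion"
    using dga_hom_cochain_inclusion by (simp_all add: dga_hom_def dg_algebra_def)
  show "\<exists>c\<in>carrier (gr (cochains R X) m). \<Phi> \<ominus>\<^bsub>gr E m\<^esub> cochain_inclusion m c \<in> coboundaries E m"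
    if \<Phi>: "\<Phi> \<in> carrier (gr E m)" and "b \<in> carrier (gr (cochains R X) (Suc m))" and d: "diff E m \<Phi> = cochain_inclusion (Suc m) b" for m \<Phi> b
  proof (rule cochain_inclusion_lift[OF \<Phi> le0])
    show "diff E m \<Phi> n x c = \<zero>\<^bsub>simplex_module n c (Suc m - c)\<^esub>" if "x \<in> simplices X n" "c \<le> m" for n x c
      using that by (simp add: d cochain_inclusion_value single_def)
  qed simp
qed (rule cochain_inclusion_eq_zero)

end

section \<open>The weak equivalence\<close>

(* The intermediate algebras may be taken with elements of the type given by TYPE(...): it is large
   enough for simplicial maps from X to the total complex of the simplicial cochains on the standard
   simplices with coefficients in A. *)

theorem corollary9p2p1:
  fixes R :: "('r, 'm) ring_scheme"
    and A :: "('r, 'a) sdga"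
    and X :: "'x sset"
  assumes sdga: "simplicial_dga R A"
    and a: "\<And>p. cochain_homotopy_equivalence R (ring_complex R) (level A p) (unit_map (level A p))"
    and b: "\<And>q. simplicially_contractible (degree_part A q)"
    and c_pid: "principal_domain R"
    and c_free: "\<And>p q. free_module R (gr (level A p) q)"
    and sset: "simplicial_set X"
  shows "weakly_equivalent TYPE(nat \<Rightarrow> 'x \<Rightarrow> nat \<Rightarrow> (nat \<Rightarrow> nat) \<Rightarrow> 'a) R (cochains R X) (forms A X)"
proof -
  interpret A: simplicial_dga R A by (rule sdga)
  interpret S: simplicial_set "degree_part A 0"
    by (rule simplicial_set.intro) (simp_all add: degree_part_def A.dact_closed A.dact_id A.dact_compose)
  have vertices: "gone (level A 0) \<in> simplices (degree_part A 0) 0" "\<zero>\<^bsub>gr (level A 0) 0\<^esub> \<in> simplices (degree_part A 0) 0"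
    using dg_algebra.gone_closed[OF A.level_dga] abelian_monoid.zero_closed[OF abelian_group.axioms(1)[OF module_abelian[OF A.level_module]]]
    by (simp_all add: degree_part_def)
  \<comment> \<open>The edge is to run from 1 to 0. Face 0 omits the start and is the end point, so
    the zero comes first.\<close>
  obtain w where w: "w \<in> simplices (degree_part A 0) 1"
    "face (degree_part A 0) 0 0 w = \<zero>\<^bsub>gr (level A 0) 0\<^esub>" "face (degree_part A 0) 0 1 w = gone (level A 0)"
    using S.homotopic_vertices[OF _ vertices(2,1)] b[of 0] vertices(1) unfolding simplicially_contractible_def by blast
  interpret acyclic_forms R A X w
  proof (intro acyclic_forms.intro acyclic_forms_axioms.intro forms_algebra.intro sdga sset)
    show "w \<in> carrier (gr (level A 1) 0)" using w(1) by (simp add: degree_part_def)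
    \<comment> \<open>The i-th coface of [0] has the value 1 - i, so face 0 reads vertex 1 and face
      1 reads vertex 0.\<close>
    have e: "(\<lambda>j\<in>{..0}. if j < i then j else Suc j) = (\<lambda>j\<in>{..0}. 1 - i)" for i :: nat
      by (auto simp: fun_eq_iff)
    show "dact A 0 1 (\<lambda>j\<in>{..0}. 0) 0 w = gone (level A 0)" "dact A 0 1 (\<lambda>j\<in>{..0}. 1) 0 w = \<zero>\<^bsub>gr (level A 0) 0\<^esub>"
      using w(2,3) unfolding face_def e by (simp_all add: degree_part_def)
  qed (use unit_equivalence[OF A.level_dga a] in auto)
  have "dga_linked R (cochains R X) E" "dga_linked R E (forms A X)"
    unfolding dga_linked_def
    using dga_hom_cochain_inclusion quasi_iso_cochain_inclusion dga_hom_form_inclusion quasi_iso_form_inclusion by blast+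
  \<comment> \<open>The zigzag has length two: \<open>E\<close> serves as both ends of the middle
    chain, which is reflexive.\<close>
  then show ?thesis unfolding weakly_equivalent_def by blast
qed

end
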